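(* Let $A$ be a simple central Lie algebra with triality (not assumed finite dimensional) over an algebraically closed field $k$ of characteristic $\neq 2,3$. Then $A$ is a finite dimensional simple Lie algebra of type $D_4$.
   Context: Let $S_3=\langle \sigma,\rho \mid \sigma^2=\rho^3=1,\ \sigma\rho\sigma=\rho^{-1}\rangle$. A Lie algebra with triality over $k$ is a Lie algebra $A$ with a nontrivial action $x\mapsto x^g$ of $S_3$ by automorphisms such that $(x^{\sigma}-x)+(x^{\sigma}-x)^{\rho}+(x^{\sigma}-x)^{\rho^2}=0$ for all $x\in A$. Simple central means that $A$ is simple as a Lie algebra and its centroid is $k$. *)

theory Defs
  imports "HOL-Analysis.Analysis" "HOL-Computational_Algebra.Polynomial"
begin

locale lie_algebra = vector_space scale
  for scale :: "'k::field \<Rightarrow> 'a::ab_group_add \<Rightarrow> 'a" (infixr \<open>*s\<close> 75) +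
  fixes bracket :: "'a \<Rightarrow> 'a \<Rightarrow> 'a"
  assumes linear_left: "Vector_Spaces.linear scale scale (\<lambda>x. bracket x y)"
    and linear_right: "Vector_Spaces.linear scale scale (\<lambda>y. bracket x y)"
    and alternating: "bracket x x = 0"
    and jacobi: "bracket x (bracket y z) + bracket y (bracket z x) + bracket z (bracket x y) = 0"
begin

definition lie_ideal :: "'a set \<Rightarrow> bool" where
  "lie_ideal I \<longleftrightarrow> subspace I \<and> (\<forall>x. \<forall>y\<in>I. bracket x y \<in> I)"

definition lie_simple :: bool where
  "lie_simple \<longleftrightarrow>
     (\<exists>x y. bracket x y \<noteq> 0) \<and> (\<forall>I. lie_ideal I \<longrightarrow> I = {0} \<or> I = UNIV)"

definition centroid :: "('a \<Rightarrow> 'a) set" where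
  "centroid = {T. Vector_Spaces.linear scale scale T \<and>
     (\<forall>x y. T (bracket x y) = bracket (T x) y \<and> T (bracket x y) = bracket x (T y))}"

definition simple_central :: bool where
  "simple_central \<longleftrightarrow> lie_simple \<and> centroid = range scale"

definition lie_automorphism :: "('a \<Rightarrow> 'a) \<Rightarrow> bool" where
  "lie_automorphism f \<longleftrightarrow> Vector_Spaces.linear scale scale f \<and> bij f \<and>
     (\<forall>x y. f (bracket x y) = bracket (f x) (f y))"

definition finite_dimensional :: bool where
  "finite_dimensional \<longleftrightarrow> (\<exists>B. finite B \<and> span B = UNIV)"

end

text \<open>
  An action of the group with presentation
  \<open>\<langle>\<sigma>, \<rho> | \<sigma>\<^sup>2 = \<rho>\<^sup>3 = 1, \<sigma>\<rho>\<sigma> = \<rho>\<^sup>-\<^sup>1\<rangle>\<close> is given by the images of the two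
  generators, subject to the defining relations; the action is nontrivial iff
  one of the generators acts nontrivially. The element written \<open>x\<^sup>\<sigma>\<close> in exponential
  notation is \<open>\<sigma> x\<close> here. The relations are unchanged by reversing words,
  so right and left actions are given by the same data.
\<close>

locale lie_algebra_with_triality = lie_algebra scale bracket
  for scale :: "'k::field \<Rightarrow> 'a::ab_group_add \<Rightarrow> 'a" (infixr \<open>*s\<close> 75)
    and bracket :: "'a \<Rightarrow> 'a \<Rightarrow> 'a" +
  fixes \<sigma> \<rho> :: "'a \<Rightarrow> 'a"
  assumes automorphism_sigma: "lie_automorphism \<sigma>"
    and automorphism_rho: "lie_automorphism \<rho>"
    and sigma_square: "\<sigma> \<circ> \<sigma> = id"
    and rho_cube: "\<rho> \<circ> \<rho> \<circ> \<rho> = id"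
    and sigma_rho_sigma: "\<sigma> \<circ> \<rho> \<circ> \<sigma> = inv \<rho>"
    and nontrivial: "\<sigma> \<noteq> id \<or> \<rho> \<noteq> id"
    and triality: "(\<sigma> x - x) + \<rho> (\<sigma> x - x) + \<rho> (\<rho> (\<sigma> x - x)) = 0"

definition matrix_scale :: "'k::field \<Rightarrow> 'k^'n^'m \<Rightarrow> 'k^'n^'m" where
  "matrix_scale c A = (\<chi> i j. c * A $ i $ j)"

definition commutator :: "'k::field^'n^'n \<Rightarrow> 'k^'n^'n \<Rightarrow> 'k^'n^'n" where
  "commutator A B = A ** B - B ** A"

text \<open>
  The classical Lie algebra of type \<open>D\<^sub>n\<close> (\<open>n = CARD('n)\<close>) is the even orthogonal
  Lie algebra of the split symmetric bilinear form with block matrix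
  \<open>S = (0 I; I 0)\<close>, i.e. all \<open>2n \<times> 2n\<close> matrices \<open>A\<close> with \<open>A\<^sup>T S + S A = 0\<close>, under the
  commutator. The index type \<open>'n + 'n\<close> provides the block decomposition.
\<close>

definition split_form :: "'k::field^('n + 'n)^('n::finite + 'n)" where
  "split_form = (\<chi> i j. case (i, j) of
      (Inl a, Inr b) \<Rightarrow> (if a = b then 1 else 0)
    | (Inr a, Inl b) \<Rightarrow> (if a = b then 1 else 0)
    | _ \<Rightarrow> 0)"

definition classical_D :: "('k::field^('n + 'n)^('n::finite + 'n)) set" where
  "classical_D = {A. transpose A ** split_form + split_form ** A = 0}"

definition (in lie_algebra) type_D4 :: bool where
  "type_D4 \<longleftrightarrow> (\<exists>\<phi> :: 'a \<Rightarrow> 'k^(4 + 4)^(4 + 4).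
     Vector_Spaces.linear scale matrix_scale \<phi> \<and> bij_betw \<phi> UNIV classical_D \<and>
     (\<forall>x y. \<phi> (bracket x y) = commutator (\<phi> x) (\<phi> y)))"

lemma vector_space_matrix_scale:
  "vector_space (matrix_scale :: 'k::field \<Rightarrow> 'k^'n^'m \<Rightarrow> 'k^'n^'m)"
  by unfold_locales (simp_all add: matrix_scale_def vec_eq_iff algebra_simps)

lemma matrix_scale_mult:
  "matrix_scale c A ** B = matrix_scale c (A ** B)"
  "A ** matrix_scale c B = matrix_scale c (A ** B)"
  by (simp_all add: matrix_scale_def matrix_matrix_mult_def vec_eq_iff sum_distrib_left mult_ac)

lemma matrix_add_diff_mult:
  fixes A B C :: "'k::field^'n^'n"
  shows "(A - B) ** C = A ** C - B ** C" "C ** (A - B) = C ** A - C ** B"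
    "(A + B) ** C = A ** C + B ** C" "C ** (A + B) = C ** A + C ** B"
  by (simp_all add: matrix_matrix_mult_def vec_eq_iff sum_subtractf sum.distrib algebra_simps)

lemma lie_algebra_commutator:
  "lie_algebra matrix_scale (commutator :: 'k::field^'n^'n \<Rightarrow> _)"
proof -
  interpret vector_space "matrix_scale :: 'k \<Rightarrow> 'k^'n^'n \<Rightarrow> 'k^'n^'n"
    by (rule vector_space_matrix_scale)
  show ?thesis
    by unfold_locales
      (simp_all add: commutator_def matrix_scale_mult matrix_add_diff_mult scale_right_diff_distrib matrix_mul_assoc)
qed

lemma classical_D_commutator_closed:
  assumes "A \<in> classical_D" "B \<in> classical_D"
  shows "commutator A B \<in> classical_D"
proof -
  let ?S = split_form
  have A: "transpose A ** ?S = - (?S ** A)" and B: "transpose B ** ?S = - (?S ** B)"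
    using assms by (simp_all add: classical_D_def eq_neg_iff_add_eq_0)
  have neg: "X ** (- Y) = - (X ** Y)" "(- X) ** Y = - (X ** Y)" for X Y :: "'a^('b + 'b)^('b + 'b)"
    by (simp_all add: matrix_matrix_mult_def vec_eq_iff sum_negf)
  have "transpose A ** (transpose B ** ?S) = ?S ** A ** B"
    by (simp add: B neg A matrix_mul_assoc)
  moreover have "transpose B ** (transpose A ** ?S) = ?S ** B ** A"
    by (simp add: B neg A matrix_mul_assoc)
  moreover have "transpose (commutator A B) = transpose B ** transpose A - transpose A ** transpose B"
    by (simp add: commutator_def matrix_transpose_mul [symmetric])
      (simp add: transpose_def vec_eq_iff)
  ultimately show ?thesis
    by (simp add: classical_D_def commutator_def matrix_add_diff_mult matrix_mul_assoc)
qed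

end

theory Submission
  imports Defs
begin

text \<open>
  Let \<open>C\<close> be the \<open>-1\<close>-eigenspace of \<open>\<sigma>\<close> and \<open>\<tau> x = \<rho> x - \<rho>\<^sup>2 x\<close>, which is fixed by \<open>\<sigma>\<close> for \<open>x\<close> in \<open>C\<close>.
  The product \<open>x \<star> y = [\<tau> x, y]\<close> makes \<open>C\<close> a Malcev algebra, and \<open>[[x, y], z] = (x \<star> y) \<star> z - d x y z\<close>,
  where \<open>3 d\<close> is the Jacobian of \<open>\<star>\<close>. An alternating form in four arguments that is compatible with
  \<open>\<star>\<close> vanishes as soon as one argument has the form \<open>(a \<star> b) \<star> (c \<star> e)\<close>. By simplicity such elements span \<open>C\<close>,
  and applying this to suitable forms built from \<open>d\<close> gives \<open>2 [[r, s], v] = T\<^bsub>r,v\<^esub> s - T\<^bsub>s,v\<^esub> r\<close> with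
  operators \<open>T\<^bsub>r,v\<^esub>\<close> that commute with all multiplications. These extend to the centroid, hence
  are scalars, and \<open>[[r, s], v] = form s v \<cdot> r - form r v \<cdot> s\<close> for a nondegenerate
  symmetric bilinear form. It follows that \<open>x \<star> (x \<star> y) = form x x \<cdot> y - form x y \<cdot> x\<close>, so that \<open>C\<close> is the
  space of imaginary octonions: doubling yields an orthonormal basis of seven elements. Finally \<open>A\<close> acts faithfully
  on \<open>k \<oplus> C\<close>, and its image consists of all skew-symmetric matrices.
\<close>

section \<open>Malcev algebras with a triple product\<close>

text \<open>Nothing bounds the dimension of \<open>A\<close> at the start, so trace forms and root
  systems are out of reach: the bilinear form has to come out of polynomial identities, and finite
  dimension only appears when an orthonormal family turns out to be complete. The route works
  backwards from the expected answer. If \<open>t r s v\<close> were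
  \<open>form s v \<cdot> r - form r v \<cdot> s\<close>, certain expressions in \<open>d\<close>
  and \<open>t\<close> alone would be \<open>form r v\<close> times a value of \<open>d\<close>. The
  identities that such a multiple must satisfy are proved directly, and only afterwards is
  \<open>d\<close> divided out; this is possible because the values of \<open>d\<close> span
  \<open>C\<close> and the common kernel of the operators \<open>d x y\<close> is zero. The
  four-argument forms do the work of a dimension count: they measure how far an identity known for
  coinciding arguments is from holding in general. The identities involve no scalars, only
  cancellation of 2 and 3, and so they are proved in abelian groups without 2- and
  3-torsion.\<close>

lemma lincomb:
  fixes a b :: "'a::ab_group_add"
  shows lincomb1: "a - b = c1 - e1 \<Longrightarrow> c1 = e1 \<Longrightarrow> a = b"
    and lincomb2: "a - b = (c1 - e1) + (c2 - e2) \<Longrightarrow> c1 = e1 \<Longrightarrow> c2 = e2 \<Longrightarrow> a = b"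
    and lincomb3: "a - b = (c1 - e1) + (c2 - e2) + (c3 - e3) \<Longrightarrow> c1 = e1 \<Longrightarrow> c2 = e2 \<Longrightarrow> c3 = e3 \<Longrightarrow> a = b"
    and lincomb4: "a - b = (c1 - e1) + (c2 - e2) + (c3 - e3) + (c4 - e4) \<Longrightarrow>
      c1 = e1 \<Longrightarrow> c2 = e2 \<Longrightarrow> c3 = e3 \<Longrightarrow> c4 = e4 \<Longrightarrow> a = b"
    and lincomb5: "a - b = (c1 - e1) + (c2 - e2) + (c3 - e3) + (c4 - e4) + (c5 - e5) \<Longrightarrow>
      c1 = e1 \<Longrightarrow> c2 = e2 \<Longrightarrow> c3 = e3 \<Longrightarrow> c4 = e4 \<Longrightarrow> c5 = e5 \<Longrightarrow> a = b"
    and lincomb6: "a - b = (c1 - e1) + (c2 - e2) + (c3 - e3) + (c4 - e4) + (c5 - e5) + (c6 - e6) \<Longrightarrow>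
      c1 = e1 \<Longrightarrow> c2 = e2 \<Longrightarrow> c3 = e3 \<Longrightarrow> c4 = e4 \<Longrightarrow> c5 = e5 \<Longrightarrow> c6 = e6 \<Longrightarrow> a = b"
  by simp_all

text \<open>\<open>t\<close> is a Lie triple system on which the left multiplications
  \<open>L_x\<close> act by derivations. \<open>m_m\<close> is the action of
  \<open>[\<tau> x, \<tau> y]\<close>, and \<open>derivation\<close> says that
  \<open>[L_x, L_y] + L_(x \<star> y)\<close> is a derivation of the product.\<close>

locale malcev_triple =
  fixes m :: "'a::ab_group_add \<Rightarrow> 'a \<Rightarrow> 'a" (infixl \<open>\<star>\<close> 75)
    and t :: "'a \<Rightarrow> 'a \<Rightarrow> 'a \<Rightarrow> 'a"
  assumes m_add_left: "(x + y) \<star> z = x \<star> z + y \<star> z"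
    and m_anti: "x \<star> y = - (y \<star> x)"
    and t_add1: "t (x + x') y z = t x y z + t x' y z"
    and t_add3: "t x y (z + z') = t x y z + t x y z'"
    and t_anti: "t x y z = - t y x z"
    and t_cyc: "t x y z + t y z x + t z x y = 0"
    and m_t: "w \<star> t x y z = t (w \<star> x) y z + t x (w \<star> y) z + t x y (w \<star> z)"
    and t_t: "t u v (t x y z) = t (t u v x) y z + t x (t u v y) z + t x y (t u v z)"
    and m_m: "x \<star> (y \<star> z) - y \<star> (x \<star> z) = t x y z + t x y z + t x y z - (x \<star> y) \<star> z - (x \<star> y) \<star> z"
    and derivation: "x \<star> (y \<star> (z \<star> w)) - y \<star> (x \<star> (z \<star> w)) + (x \<star> y) \<star> (z \<star> w)
      = (x \<star> (y \<star> z) - y \<star> (x \<star> z) + (x \<star> y) \<star> z) \<star> w + z \<star> (x \<star> (y \<star> w) - y \<star> (x \<star> w) + (x \<star> y) \<star> w)"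
    and torsion2: "x + x = 0 \<Longrightarrow> x = (0::'a)"
    and torsion3: "x + x + x = 0 \<Longrightarrow> x = (0::'a)"
begin

lemma m_add_right: "x \<star> (y + z) = x \<star> y + x \<star> z"
  by (subst (1 2 3) m_anti) (simp add: m_add_left)

lemma t_add2: "t x (y + y') z = t x y z + t x y' z"
  by (subst (1 2 3) t_anti) (simp add: t_add1)

lemma additive_zero: "(\<And>x y. f (x + y) = f x + f y) \<Longrightarrow> f (0::'a) = (0::'a)"
proof -
  assume "\<And>x y. f (x + y) = f x + f y"
  from this [of 0 0] show "f 0 = 0" by simp
qed

lemma additive_minus: "(\<And>x y. f (x + y) = f x + f y) \<Longrightarrow> f (- x) = - f (x::'a) \<and> f (x - y) = f x - (f y::'a)"
proof -
  assume f: "\<And>x y. f (x + y) = f x + f y"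
  have 1: "f (- x) = - f x" for x
    using f [of x "- x"] additive_zero [of f, OF f] by (simp add: eq_neg_iff_add_eq_0 add.commute)
  show ?thesis
    using 1 f [of x "- y"] by simp
qed

lemma m_simps [simp]:
  "0 \<star> x = 0" "x \<star> 0 = 0" "(- x) \<star> y = - (x \<star> y)" "x \<star> (- y) = - (x \<star> y)"
  "(x - x') \<star> y = x \<star> y - x' \<star> y" "x \<star> (y - y') = x \<star> y - x \<star> y'"
  using additive_zero [of "\<lambda>u. u \<star> x"] additive_zero [of "\<lambda>u. x \<star> u"]
    additive_minus [of "\<lambda>u. u \<star> y"] additive_minus [of "\<lambda>u. x \<star> u"]
  by (simp_all add: m_add_left m_add_right)

lemma t_simps [simp]:
  "t 0 y z = 0" "t x 0 z = 0" "t x y 0 = 0"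
  "t (- x) y z = - t x y z" "t x (- y) z = - t x y z" "t x y (- z) = - t x y z"
  "t (x - x') y z = t x y z - t x' y z" "t x (y - y') z = t x y z - t x y' z"
  "t x y (z - z') = t x y z - t x y z'"
  using additive_zero [of "\<lambda>u. t u y z"] additive_zero [of "\<lambda>u. t x u z"] additive_zero [of "\<lambda>u. t x y u"]
    additive_minus [of "\<lambda>u. t u y z"] additive_minus [of "\<lambda>u. t x u z"] additive_minus [of "\<lambda>u. t x y u"]
  by (simp_all add: t_add1 t_add2 t_add3)

lemmas add_simps = m_add_left m_add_right t_add1 t_add2 t_add3

lemma eq_self_neg: "x = - x \<Longrightarrow> x = (0::'a)"
  by (rule torsion2) (metis add.right_inverse)

lemma m_self [simp]: "x \<star> x = 0" and t_self [simp]: "t x x z = 0"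
  by (rule eq_self_neg, rule m_anti) (rule eq_self_neg, rule t_anti)

lemma cancel3: "x + x + x = y + y + y \<Longrightarrow> x = (y::'a)"
  using torsion3 [of "x - y"] by (simp add: algebra_simps)

section \<open>The Jacobian of the product and the Malcev identities\<close>

definition d :: "'a \<Rightarrow> 'a \<Rightarrow> 'a \<Rightarrow> 'a" where
  "d x y z = (x \<star> y) \<star> z - t x y z"

lemma d_simps [simp]:
  "d 0 y z = 0" "d x 0 z = 0" "d x y 0 = 0"
  "d (- x) y z = - d x y z" "d x (- y) z = - d x y z" "d x y (- z) = - d x y z"
  "d (x - x') y z = d x y z - d x' y z" "d x (y - y') z = d x y z - d x y' z"
  "d x y (z - z') = d x y z - d x y z'"
  by (simp_all add: d_def)

lemma d_add:
  "d (x + x') y z = d x y z + d x' y z" "d x (y + y') z = d x y z + d x y' z"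
  "d x y (z + z') = d x y z + d x y z'"
  by (simp_all add: d_def add_simps)

lemmas lin = add_simps d_add

lemma commutator_d: "x \<star> (y \<star> z) - y \<star> (x \<star> z) = (x \<star> y) \<star> z - d x y z - d x y z - d x y z"
  by (simp add: m_m d_def algebra_simps)

lemma three_d: "d x y z + d x y z + d x y z = (x \<star> y) \<star> z - x \<star> (y \<star> z) + y \<star> (x \<star> z)"
  using commutator_d [of x y z] by (simp add: algebra_simps)

lemma d_swap12: "d y x z = - d x y z"
  by (simp add: d_def m_anti [of y x] t_anti [of y x])

lemma d_self [simp]: "d x x z = 0" "d x y y = 0" "d x y x = 0"
proof -
  show 1: "d x x z = 0" for x z by (simp add: d_def)
  show 2: "d x y y = 0" for x y
    by (rule torsion3) (simp add: three_d m_anti [of y "x \<star> y"])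
  show "d x y x = 0"
    using 2 [of y x] by (simp add: d_swap12 [of x y])
qed

lemma d_swap23: "d x z y = - d x y z"
proof -
  have "d x (y + z) (y + z) = d x y z + d x z y"
    by (simp add: lin d_self(2) [of x y] d_self(2) [of x z] del: d_self)
  then show ?thesis
    by (simp add: eq_neg_iff_add_eq_0 add.commute)
qed

lemma d_cycle: "d x y z = d z x y"
  by (simp add: d_swap12 [of z x] d_swap23 [of x z y])

text \<open>The derivation \<open>[L_x, L_y] + L_(x \<star> y)\<close> is
  \<open>2 L_(x \<star> y) - 3 d x y\<close>. Its Leibniz rule on \<open>z \<star> w\<close> becomes
  three times this identity once the products with \<open>x \<star> y\<close> are collected into
  \<open>d (x \<star> y) z w\<close>.\<close>

lemma sagle_aux: "d (x \<star> y) z w + d (x \<star> y) z w + d x y (z \<star> w) = z \<star> d x y w - w \<star> d x y z"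
proof -
  let ?j = "d (x \<star> y) z w"
  have 1: "?j + ?j + ?j = (x \<star> y) \<star> z \<star> w - (x \<star> y) \<star> (z \<star> w) + z \<star> ((x \<star> y) \<star> w)"
    by (rule three_d)
  have D: "x \<star> (y \<star> u) - y \<star> (x \<star> u) + (x \<star> y) \<star> u
      = (x \<star> y) \<star> u + (x \<star> y) \<star> u - (d x y u + d x y u + d x y u)" for u
    by (simp add: commutator_d algebra_simps)
  have 2: "(x \<star> y) \<star> (z \<star> w) + (x \<star> y) \<star> (z \<star> w) - (d x y (z \<star> w) + d x y (z \<star> w) + d x y (z \<star> w))
      = ((x \<star> y) \<star> z + (x \<star> y) \<star> z - (d x y z + d x y z + d x y z)) \<star> w
        + z \<star> ((x \<star> y) \<star> w + (x \<star> y) \<star> w - (d x y w + d x y w + d x y w))"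
    using derivation [of x y z w] unfolding D .
  \<comment> \<open>Three times the claim is twice \<open>1\<close> minus \<open>2\<close>. The
    \<open>lincomb\<close> rules reduce such a combination of known equations to an identity between
    differences in an abelian group, which simplification decides.\<close>
  show ?thesis
    by (rule cancel3, rule lincomb3 [OF _ 1 1 2 [symmetric]])
      (simp add: lin algebra_simps m_anti [of "d x y z" w])
qed

text \<open>Twice \<open>sagle_aux\<close> minus the same identity with the pairs
  \<open>x, y\<close> and \<open>z, w\<close> exchanged eliminates
  \<open>d x y (z \<star> w)\<close>.\<close>

lemma sagle: "d (x \<star> y) z w + d (x \<star> y) z w + d (x \<star> y) z w
    = z \<star> d x y w + z \<star> d x y w - w \<star> d x y z - w \<star> d x y z + y \<star> d z w x - x \<star> d z w y"
  by (rule lincomb3 [OF _ sagle_aux [of x y z w] sagle_aux [of x y z w] sagle_aux [of z w x y, symmetric]])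
    (simp add: algebra_simps d_cycle [of z w "x \<star> y"] d_cycle [of x y "z \<star> w"])

text \<open>\<open>sagle\<close> with its third argument equal to \<open>x\<close> is the Malcev
  identity; alternation of \<open>d\<close> gives the other placements.\<close>

lemma malcev: "d (x \<star> y) x z = x \<star> d x y z" "d x (x \<star> y) z = - (x \<star> d x y z)"
  "d x y (x \<star> z) = - (x \<star> d x y z)" "d x y (y \<star> z) = - (y \<star> d x y z)"
proof -
  show 1: "d (x \<star> y) x z = x \<star> d x y z" for x y z
    by (rule cancel3) (use sagle [of x y x z] in \<open>simp add: d_swap23 [of x z y] algebra_simps\<close>)
  show 2: "d x (x \<star> y) z = - (x \<star> d x y z)" for x y z
    by (simp add: 1 d_swap12 [of x "x \<star> y"])
  show 3: "d x y (x \<star> z) = - (x \<star> d x y z)" for x y z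
    by (simp add: 2 d_swap23 [of x y "x \<star> z"] d_swap23 [of x z y])
  show "d x y (y \<star> z) = - (y \<star> d x y z)"
    by (simp add: 3 d_swap12 [of x y])
qed

lemma malcev_lin:
  "d z (x \<star> y) v + d x (z \<star> y) v = - (z \<star> d x y v) - x \<star> d z y v"
  "d z y (x \<star> v) + d x y (z \<star> v) = - (z \<star> d x y v) - x \<star> d z y v"
  by (rule lincomb3 [OF _ malcev(2) [of "x + z" y v] malcev(2) [of x y v, symmetric] malcev(2) [of z y v, symmetric]],
      simp add: lin algebra_simps)
    (rule lincomb3 [OF _ malcev(3) [of "x + z" y v] malcev(3) [of x y v, symmetric] malcev(3) [of z y v, symmetric]],
      simp add: lin algebra_simps)

lemma d_mult_left: "d (x \<star> y) y v = y \<star> d x y v"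
  using malcev(2) [of y x v]
  by (simp add: m_anti [of y x] d_swap12 [of y "x \<star> y"] d_swap12 [of y x])

section \<open>Mutual annihilation of the operators \<open>d x y\<close> and
  \<open>t x y\<close>\<close>

lemma d_mult: "d x y ((x \<star> y) \<star> v) = (x \<star> y) \<star> d x y v"
proof -
  have "(x \<star> y) \<star> u = x \<star> (y \<star> u) - y \<star> (x \<star> u) + (d x y u + d x y u + d x y u)" for u
    by (simp add: commutator_d algebra_simps)
  then show ?thesis
    by (simp add: lin malcev)
qed

text \<open>The linearized Malcev identity with \<open>x \<star> y\<close> as additional argument
  compares the two orders of \<open>L_x\<close> and \<open>L_y\<close> on \<open>d x y v\<close>. As
  \<open>d x y + t x y = L_(x \<star> y)\<close>, the outcome is that the two summands annihilate
  each other, in both orders.\<close>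

lemma mult_d: "(x \<star> y) \<star> d x y v = d x y (d x y v)"
proof (rule cancel3)
  let ?e = "d x y v"
  have 1: "- (y \<star> (x \<star> ?e)) + (x \<star> y) \<star> ?e = - ((x \<star> y) \<star> ?e) - x \<star> (y \<star> ?e)"
    using malcev_lin(2) [of "x \<star> y" y x v] by (simp add: d_mult_left d_mult malcev)
  show "(x \<star> y) \<star> ?e + (x \<star> y) \<star> ?e + (x \<star> y) \<star> ?e = d x y ?e + d x y ?e + d x y ?e"
    by (rule lincomb2 [OF _ 1 commutator_d [of x y ?e, symmetric]]) (simp add: algebra_simps)
qed

lemma t_d [simp]: "t x y (d x y v) = 0"
  using d_def [of x y "d x y v"] by (simp add: mult_d)

lemma d_t [simp]: "d x y (t x y v) = 0"
proof -
  have "t x y v = (x \<star> y) \<star> v - d x y v"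
    by (simp add: d_def)
  then show ?thesis
    by (simp add: d_mult mult_d)
qed

lemma td_swap: "t x y (d x w v) = - t x w (d x y v)"
  by (rule lincomb1 [OF _ t_d [of x "y + w" v]]) (simp add: lin algebra_simps)

lemma dt_swap: "d x y (t x w v) = - d x w (t x y v)"
  by (rule lincomb1 [OF _ d_t [of x "y + w" v]]) (simp add: lin algebra_simps)

lemma dt_swap': "d x y (t w y v) = - d w y (t x y v)"
  using dt_swap [of y x w v]
  by (simp add: d_swap12 [of x y] d_swap12 [of w y] t_anti [of w y] t_anti [of x y])

lemma dt_lin: "d x y (t z q v) + d z y (t x q v) + d x q (t z y v) + d z q (t x y v) = 0"
  by (rule lincomb3 [OF _ dt_swap [of "x + z" y q v] dt_swap [of x y q v, symmetric] dt_swap [of z y q v, symmetric]])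
    (simp add: lin algebra_simps)

lemma d_t_mult: "d x y (t x w (x \<star> v)) = 0"
proof -
  have "t x w (x \<star> v) = x \<star> t x w v - t x (x \<star> w) v"
    by (simp add: m_t)
  then show ?thesis
    by (simp add: malcev dt_swap [of x y "x \<star> w"] dt_swap [of x y w])
qed

text \<open>Evaluation at \<open>x + z\<close> and at \<open>2x + z\<close> separates the part
  linear in \<open>z\<close> from the quadratic one, so only a factor 2 has to be cancelled.\<close>

lemma cubic_polar:
  assumes F: "\<And>x. F x x x = 0"
    and add: "\<And>x x' y z. F (x + x') y z = F x y z + F x' y z"
      "\<And>x y y' z. F x (y + y') z = F x y z + F x y' z"
      "\<And>x y z z'. F x y (z + z') = F x y z + F x y z'"
  shows "F z x x + F x z x + F x x z = (0::'a)"
proof (rule torsion2)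
  let ?A = "F z x x + F x z x + F x x z"
  let ?B = "F x z z + F z x z + F z z x"
  have 1: "?A + ?B = 0"
    using F [of "x + z"] by (simp add: add F [of x] F [of z] ac_simps)
  have 2: "(?A + ?A) + (?A + ?A) + (?B + ?B) = 0"
    using F [of "(x + x) + z"] by (simp add: add F [of x] F [of z] ac_simps)
  show "?A + ?A = 0"
    by (rule lincomb3 [OF _ 2 1 [symmetric] 1 [symmetric]]) (simp add: algebra_simps)
qed

lemma d_t_mult_swap: "d x y (t y w (x \<star> v)) = - d x y (t x w (y \<star> v))"
  using cubic_polar [of "\<lambda>a b c. d a y (t b w (c \<star> v))" y x]
  by (simp add: d_t_mult lin eq_neg_iff_add_eq_0)

text \<open>This settles the case \<open>r = s\<close> of the compatibility of \<open>psi\<close> with multiplication: the difference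
  \<open>U\<close> of the two sides satisfies both \<open>3 U = 2 V\<close> and \<open>6 U = V\<close> for the same \<open>V\<close>.\<close>

lemma d_mult_t: "d x (x \<star> y) (t q y v) = d x y (t (x \<star> q) y v)"
proof -
  \<comment> \<open>Because \<open>d x y v' = 0\<close>, \<open>sagle\<close> expresses three times
    each of the Jacobians in \<open>s1\<close> to \<open>s4\<close> through \<open>X\<close>,
    \<open>Y\<close> and \<open>Q\<close> only.\<close>
  define v' where "v' = t x y v"
  define X where "X = x \<star> d y q v'"
  define Y where "Y = y \<star> d x q v'"
  define Q where "Q = v' \<star> d x y q"
  define U where "U = d x (x \<star> y) (t q y v) - d x y (t (x \<star> q) y v)"
  define V where "V = Y - X + Q"
  define a where "a = d x y (t (x \<star> y) q v)"
  define b where "b = d x y (t x q (y \<star> v))"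
  have dv': "d x y v' = 0"
    by (simp add: v'_def)
  have U1: "U = - X + d (x \<star> q) y v'"
    by (simp add: U_def X_def v'_def malcev dt_swap' [of x y] d_swap12 [of q y])
  have "U = d x y (t q (x \<star> y) v) + d x y (t q y (x \<star> v))"
    unfolding U_def malcev(2) malcev(3) [symmetric] by (simp add: malcev(3) [symmetric] m_t lin)
  then have U2: "U = b - a"
    by (simp add: a_def b_def t_anti [of q] d_t_mult_swap)
  have 1: "d (x \<star> y) y (t x q v) = a + d x (y \<star> q) v' - b"
  proof -
    have "d (x \<star> y) y (t x q v) = - d x y (y \<star> t x q v)"
      by (simp add: d_mult_left malcev)
    also have "\<dots> = a + d x (y \<star> q) v' - b"
      by (simp add: m_t lin a_def b_def v'_def m_anti [of y x] dt_swap [of x y "y \<star> q"])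
    finally show ?thesis .
  qed
  have 2: "d x q (t (x \<star> y) y v) = - b - d x q (y \<star> v')"
  proof -
    have "t (x \<star> y) y v = t x y (y \<star> v) - y \<star> v'"
      by (simp add: v'_def m_t m_anti [of y x])
    then show ?thesis
      by (simp add: b_def dt_swap [of x q y])
  qed
  have 3: "(a - b) + (a - b) = d x q (y \<star> v') - d x (y \<star> q) v' - d (x \<star> y) q v'"
    using dt_lin [of x y "x \<star> y" q v]
    by (simp add: 1 2 a_def [symmetric] v'_def [symmetric] algebra_simps)
  have s1: "d (x \<star> q) y v' + d (x \<star> q) y v' + d (x \<star> q) y v' = Y + Y + Q + Q + X"
    using sagle [of x q y v'] dv' d_cycle [of y v' x]
    by (simp add: X_def Y_def Q_def d_swap23 [of x q y] d_swap23 [of y v' q] algebra_simps)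
  have s2: "d (x \<star> y) q v' + d (x \<star> y) q v' + d (x \<star> y) q v' = Y - X - Q - Q"
    using sagle [of x y q v'] dv'
    by (simp add: X_def Y_def Q_def d_cycle [of q v' x] d_cycle [of q v' y] algebra_simps)
  have s3: "d x (y \<star> q) v' + d x (y \<star> q) v' + d x (y \<star> q) v' = Q + Q - X - X - Y"
    using sagle [of y q x v'] dv'
    by (simp add: X_def Y_def Q_def d_swap12 [of x "y \<star> q"] d_cycle [of y q x] d_swap23 [of x v' q] d_swap23 [of x v' y] algebra_simps)
  have s4: "d x q (y \<star> v') + d x q (y \<star> v') + d x q (y \<star> v') = - X - X - Q - Y"
    by (rule lincomb1 [OF _ sagle [of y v' x q]]) (simp add: dv' d_cycle [of y v' x] X_def Y_def Q_def d_cycle [of x q "y \<star> v'"] d_swap23 [of x q y] d_swap23 [of y v' q] algebra_simps)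
  have V1: "U + U + U = V + V"
    unfolding U1 V_def by (rule lincomb1 [OF _ s1]) (simp add: algebra_simps)
  have V2: "U + U + U + (U + U + U) = V"
    unfolding U2 V_def
    by (rule lincomb6 [OF _ 3 [symmetric] 3 [symmetric] 3 [symmetric] s2 s3 s4 [symmetric]])
      (simp add: algebra_simps)
  have "V + V + V = 0"
    by (rule lincomb3 [OF _ V1 [symmetric] V1 [symmetric] V2]) (simp add: algebra_simps)
  then have "V = 0"
    by (rule torsion3)
  with V1 have "U + U + U = 0"
    by simp
  then have "U = 0"
    by (rule torsion3)
  then show ?thesis
    by (simp add: U_def)
qed

text \<open>If \<open>t r s v\<close> is \<open>form s v \<cdot> r - form r v \<cdot> s\<close>,
  this sum collapses to \<open>(- 2 * form r v) \<cdot> d p q s\<close>: the terms with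
  \<open>form s v\<close> and \<open>form q v\<close> cancel since \<open>d\<close> alternates. So
  \<open>psi\<close> imitates a scalar depending on \<open>r, v\<close> times \<open>d p q s\<close>
  before any scalar exists. The lemmas on it are what this predicts: alternation in
  \<open>p, q, s\<close>, compatibility with \<open>\<star>\<close>, symmetry in
  \<open>r, v\<close>, and invariance under \<open>d\<close>.\<close>

definition psi :: "'a \<Rightarrow> 'a \<Rightarrow> 'a \<Rightarrow> 'a \<Rightarrow> 'a \<Rightarrow> 'a" where
  "psi r v p q s = d p q (t r s v) + d p r (t q s v) + d p s (t q r v)"

lemma psi_simps [simp]:
  "psi 0 v p q s = 0" "psi r 0 p q s = 0" "psi r v 0 q s = 0" "psi r v p 0 s = 0" "psi r v p q 0 = 0"
  "psi (- r) v p q s = - psi r v p q s" "psi r (- v) p q s = - psi r v p q s"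
  "psi r v (- p) q s = - psi r v p q s" "psi r v p (- q) s = - psi r v p q s"
  "psi r v p q (- s) = - psi r v p q s"
  "psi (r - r') v p q s = psi r v p q s - psi r' v p q s" "psi r (v - v') p q s = psi r v p q s - psi r v' p q s"
  "psi r v (p - p') q s = psi r v p q s - psi r v p' q s" "psi r v p (q - q') s = psi r v p q s - psi r v p q' s"
  "psi r v p q (s - s') = psi r v p q s - psi r v p q s'"
  by (simp_all add: psi_def lin algebra_simps)

lemma psi_add:
  "psi (r + r') v p q s = psi r v p q s + psi r' v p q s" "psi r (v + v') p q s = psi r v p q s + psi r v' p q s"
  "psi r v (p + p') q s = psi r v p q s + psi r v p' q s" "psi r v p (q + q') s = psi r v p q s + psi r v p q' s"
  "psi r v p q (s + s') = psi r v p q s + psi r v p q s'"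
  by (simp_all add: psi_def lin algebra_simps)

lemma psi_swap23: "psi r v p s q = - psi r v p q s"
  by (simp add: psi_def t_anti [of s q] t_anti [of s r] t_anti [of q r] algebra_simps)

lemma psi_self [simp]: "psi r v p p s = 0" "psi r v p q q = 0" "psi r v p q p = 0"
proof -
  show 1: "psi r v p p s = 0" for p s
    by (simp add: psi_def dt_swap [of p r s v])
  show "psi r v p q q = 0"
    by (rule eq_self_neg) (rule psi_swap23)
  show "psi r v p q p = 0"
    using 1 [of p q] by (simp add: psi_swap23 [of r v p p q])
qed

lemma psi_swap12: "psi r v q p s = - psi r v p q s"
proof -
  have "psi r v (p + q) (p + q) s = psi r v p q s + psi r v q p s"
    by (simp add: psi_add psi_self(1) [of r v p] psi_self(1) [of r v q] del: psi_self)
  then show ?thesis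
    by (simp add: eq_neg_iff_add_eq_0 add.commute)
qed

text \<open>The way back from \<open>psi\<close> to \<open>t\<close>; it turns into
  \<open>t_scalar\<close> once \<open>d p q\<close> is divided out.\<close>

lemma two_d_t: "d p q (t r s v) + d p q (t r s v) = psi r v p q s - psi s v p q r"
  by (simp add: psi_def t_anti [of s r] algebra_simps)

lemma psi_diag: "psi x v x q s = d x q (t x s v) + d x q (t x s v)"
  by (simp add: psi_def t_anti [of q x] dt_swap [of x s q])

lemma malcev': "x \<star> d x y z = - d x (x \<star> y) z"
  by (simp add: malcev)

text \<open>The summand with \<open>d x q\<close> obeys the rule by the Malcev identity alone. The
  other two need \<open>d_mult_t\<close>, polarized at \<open>r + s\<close>.\<close>

lemma psi_malcev: "psi r v x (x \<star> q) s = - (x \<star> psi r v x q s)"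
proof -
  have 1: "d x (x \<star> r) (t q s v) + d x (x \<star> s) (t q r v) = d x r (t (x \<star> q) s v) + d x s (t (x \<star> q) r v)"
    by (rule lincomb3 [OF _ d_mult_t [of x "r + s" q v] d_mult_t [of x r q v, symmetric] d_mult_t [of x s q v, symmetric]])
      (simp add: lin algebra_simps)
  show ?thesis
    by (rule lincomb1 [OF _ 1 [symmetric]]) (simp add: psi_def lin malcev' algebra_simps)
qed

lemma psi_malcev': "psi r v x q (x \<star> s) = - (x \<star> psi r v x q s)"
  by (simp add: psi_swap23 [of r v x q "x \<star> s"] psi_malcev psi_swap23 [of r v x s q])

lemma psi_malcev_lin:
  "psi r v z (x \<star> q) s + psi r v x (z \<star> q) s = - (z \<star> psi r v x q s) - x \<star> psi r v z q s"
  "psi r v z q (x \<star> s) + psi r v x q (z \<star> s) = - (z \<star> psi r v x q s) - x \<star> psi r v z q s"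
  by (rule lincomb3 [OF _ psi_malcev [of r v "x + z" q s] psi_malcev [of r v x q s, symmetric] psi_malcev [of r v z q s, symmetric]],
      simp add: lin psi_add algebra_simps)
    (rule lincomb3 [OF _ psi_malcev' [of r v "x + z" q s] psi_malcev' [of r v x q s, symmetric] psi_malcev' [of r v z q s, symmetric]],
      simp add: lin psi_add algebra_simps)

text \<open>The antisymmetrization of \<open>psi\<close> in its first two arguments is alternating in all five
  arguments; the cyclic identity for \<open>t\<close> then forces it to vanish.\<close>

lemma psi_sym: "psi r v p q s = psi v r p q s"
proof -
  define A where "A r v p q s = psi r v p q s - psi v r p q s" for r v p q s
  have A12: "A v r p q s = - A r v p q s" for r v p q s
    by (simp add: A_def)
  have A34: "A r v q p s = - A r v p q s" for r v p q s
    by (simp add: A_def psi_swap12 [of _ _ q p])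
  have A45: "A r v p s q = - A r v p q s" for r v p q s
    by (simp add: A_def psi_swap23 [of _ _ p s])
  have A0: "A r v p p s = 0" for r v p s
    by (simp add: A_def)
  have 1: "A r v p q s + A r v p q s = A r s p q v - A v s p q r - A r q p s v + A v q p s r" for r v p q s
  proof -
    have c1: "t r s v = t v s r - t v r s" for r s v
      using t_cyc [of r s v] by (simp add: t_anti [of s v] t_anti [of v r] algebra_simps)
    have 2: "A r v p q s = - d p q (t v r s) + d p s (t v r q) + d p r (t q s v) - d p v (t q s r)"
      by (simp add: A_def psi_def c1 [of r s v] t_anti [of q r] t_anti [of q v] c1 [of r q v] lin algebra_simps)
    show ?thesis
      by (rule lincomb6 [OF _ 2 2 two_d_t [of p q v r s, symmetric] two_d_t [of p s v r q] two_d_t [of p r q s v]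
            two_d_t [of p v q s r, symmetric]])
        (simp add: A_def psi_swap23 [of s r p v q] psi_swap23 [of q r p v s] psi_swap23 [of q v p r s]
          psi_swap23 [of s v p r q] algebra_simps)
  qed
  have 2: "A r p p s v = A v p p s r" for r p s v
    using 1 [of r v p p s] by (simp add: A0)
  have 3: "A r p p s v = 0" for r p s v
    by (rule eq_self_neg) (metis 2 A45 minus_minus)
  have A23: "A r p v s u = - A r v p s u" for r p v s u
  proof -
    have "A r (p + v) (p + v) s u = A r p p s u + A r v v s u + (A r p v s u + A r v p s u)"
      by (simp add: A_def psi_add algebra_simps)
    then show ?thesis
      by (simp add: 3 eq_neg_iff_add_eq_0)
  qed
  have A25: "A r s p q v = - A r v p q s" for r v p q s
    by (metis A23 A34 A45 minus_minus)
  \<comment> \<open>By alternation each of the four signed terms on the right of \<open>1\<close> is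
    \<open>- A r v p q s\<close>, so that \<open>6 A = 0\<close>.\<close>
  have "A r v p q s + A r v p q s = - A r v p q s - A r v p q s - A r v p q s - A r v p q s"
    using 1 [of r v p q s] A25 [of r s p q v] A25 [of v s p q r] A25 [of r q p s v] A25 [of v q p s r]
      A12 [of v r p q s] A12 [of v r p s q] A45 [of r v p s q]
    by simp
  then have "(A r v p q s + A r v p q s) + (A r v p q s + A r v p q s) + (A r v p q s + A r v p q s) = 0"
    by (simp add: algebra_simps)
  then have "A r v p q s + A r v p q s = 0"
    by (rule torsion3)
  then show ?thesis
    using torsion2 [of "A r v p q s"] by (simp add: A_def)
qed

lemma d_derivation_t: "d a b (t x y z) = t (d a b x) y z + t x (d a b y) z + t x y (d a b z)"
  by (simp add: d_def [of a b] m_t t_t [of a b x y z] algebra_simps)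

text \<open>The swaps make \<open>h\<close> alternating. Moving \<open>d x p\<close> into
  \<open>t\<close> as a derivation splits \<open>h p s q u\<close> into two values of
  \<open>k\<close>, which is antisymmetric in its last two arguments. Reversing the order of the
  four arguments is an even permutation, yet it changes the sign of this splitting.\<close>

lemma d_t_d: "d x p (t x s (d x q u)) = 0"
proof -
  define h where "h p s q u = d x p (t x s (d x q u))" for p s q u
  define k where "k s p q u = t x s (d x p (d x q u))" for s p q u
  have h12: "h s p q u = - h p s q u" for p s q u
    unfolding h_def by (rule dt_swap)
  have h23: "h p q s u = - h p s q u" for p s q u
    unfolding h_def by (simp add: td_swap [of x q s])
  have h34: "h p s u q = - h p s q u" for p s q u
    unfolding h_def by (simp add: d_swap23 [of x u q])
  have k: "h p s q u = k s p q u + k q u p s" for p s q u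
    unfolding h_def k_def
    by (simp add: d_derivation_t td_swap [of x "d x p s" q] d_swap23 [of x "d x p s" u])
  have k34: "k s p u q = - k s p q u" for p s q u
    unfolding k_def by (simp add: d_swap23 [of x u q])
  have 1: "h u q s p = - h p s q u"
    by (simp add: k k34 [of s p u q] k34 [of q u s p])
  have 2: "h u q s p = h p s q u"
    by (simp add: h34 [of u q s p] h23 [of u q p s] h12 [of u p q s] h34 [of p u q s] h23 [of p u s q] h34 [of p s u q])
  have "h p s q u = - h p s q u"
    using 1 2 by simp
  then show ?thesis
    unfolding h_def by (rule eq_self_neg)
qed

text \<open>By \<open>psi_diag\<close> and \<open>d_t_d\<close> the expression vanishes when
  \<open>x\<close> and \<open>y\<close> coincide in the slots of \<open>psi\<close>; polarization
  makes \<open>L\<close> symmetric, while expanding \<open>psi\<close> makes it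
  antisymmetric.\<close>

lemma psi_d: "psi y (d x y v) x q r = 0"
proof -
  define L where "L x y = psi y (d x y v) x q r" for x y
  define \<alpha> where "\<alpha> x y = d x y (t x q (d y r v))" for x y
  define \<beta> where "\<beta> x y = d y q (t x r (d x y v))" for x y
  have L_sym: "L x y = L y x" for x y
    using cubic_polar [of "\<lambda>a b c. psi a (d b y v) c q r" y x]
    by (simp add: L_def psi_diag d_t_d psi_add lin d_swap12 [of y x] eq_neg_iff_add_eq_0)
  have 1: "d x q (t y r (d x y v)) = d x y (t x q (d y r v))" for x y q r
  proof -
    have "t y r (d x y v) = - t x y (d y r v)"
      by (simp add: d_swap12 [of x y] td_swap [of y r x] t_anti [of y x])
    then show ?thesis
      by (simp add: dt_swap [of x q y])
  qed
  have 2: "d x y (t q r (d x y v)) = \<beta> x y + d x y (t x r (d y q v))" for x y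
    using cubic_polar [of "\<lambda>a b c. d a y (t b r (d c y v))" q x]
    by (simp add: \<beta>_def d_t_d lin d_swap12 [of q y] algebra_simps eq_neg_iff_add_eq_0)
  have L_eq: "L x y = \<alpha> x y + \<beta> x y" for x y
    by (simp add: L_def psi_def 1 [of x q y r] 1 [of x r y q] 2 \<alpha>_def t_anti [of q y])
  have \<alpha>: "\<alpha> y x = - \<beta> x y" for x y
    by (simp add: \<alpha>_def \<beta>_def dt_swap [of y x q] t_anti [of y x] td_swap [of x y r])
  have "L x y = - L y x"
    using \<alpha> [of x y] \<alpha> [of y x] by (simp add: L_eq)
  then have "L x y = - L x y"
    by (simp add: L_sym [of y x])
  then show ?thesis
    unfolding L_def by (rule eq_self_neg)
qed

text \<open>For the eventual form this says that \<open>d x q\<close> is skew. \<open>I\<close> is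
  symmetric in \<open>s, v\<close> by \<open>psi_sym\<close> and antisymmetric in
  \<open>s, q\<close> by \<open>psi_d\<close>; a function of three arguments with both properties is
  zero.\<close>

lemma psi_d_invariant: "psi (d x q s) v x p r + psi s (d x q v) x p r = 0"
proof -
  define I where "I s v q = psi (d x q s) v x p r + psi s (d x q v) x p r" for s v q
  have sym: "I v s q = I s v q" for s v q
    by (simp add: I_def psi_sym [of v] psi_sym [of "d x q v"] add.commute)
  have 1: "I (s + q) v (s + q) = I s v s + I q v q + (I s v q + I q v s)" for s v q
    by (simp add: I_def lin psi_add d_swap23 [of x s q] algebra_simps)
  have alt: "I q v s = - I s v q" for s v q
    using 1 [of s q v] by (simp add: I_def psi_d d_swap23 [of x s q] eq_neg_iff_add_eq_0 add.commute)
  have "I s v q = - I s v q"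
    using alt [of s v q] sym [of v q s] alt [of v q s] sym [of q s v] alt [of q s v] sym [of s v q] by simp
  then show ?thesis
    unfolding I_def by (rule eq_self_neg)
qed

text \<open>The same symmetric-antisymmetric argument: the defect \<open>c\<close> is symmetric in
  \<open>s, r\<close>, by \<open>two_d_t\<close> and because \<open>d x p\<close> is a derivation of
  \<open>t\<close>, and antisymmetric in \<open>q, r\<close>.\<close>

lemma d_psi: "d x p (psi s v x q r) = psi s v x p (d x q r)"
proof -
  define c where "c s q r = d x p (psi s v x q r) - psi s v x p (d x q r)" for s q r
  have sym: "c r q s = c s q r" for s q r
  proof -
    have 1: "d x p (psi r v x q s) - d x p (psi s v x q r) = d x p (d x q (t r s v)) + d x p (d x q (t r s v))"
      using arg_cong [OF two_d_t [of x q r s v], of "d x p"] by (simp add: lin)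
    show ?thesis
      by (rule lincomb6 [OF _ 1 two_d_t [of x p "d x q r" s v] two_d_t [of x p r "d x q s" v] two_d_t [of x p r s "d x q v"]
            psi_d_invariant [of x q r v p s] psi_d_invariant [of x q s v p r, symmetric]])
        (simp add: c_def d_derivation_t lin algebra_simps)
  qed
  have alt: "c s r q = - c s q r" for s q r
    by (simp add: c_def psi_swap23 [of s v x r q] d_swap23 [of x r q])
  have "c s q r = - c s q r"
    using sym [of r q s] alt [of r s q] sym [of q s r] alt [of q r s] sym [of s r q] alt [of s q r] by simp
  then have "c s q r = 0"
    by (rule eq_self_neg)
  then show ?thesis
    by (simp add: c_def)
qed

lemma psi_malcev'': "psi r v x y (y \<star> s) = - (y \<star> psi r v x y s)"
  by (simp add: psi_swap12 [of r v x y] psi_malcev')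

lemma psi_mult_left: "psi r v (x \<star> y) y s = y \<star> psi r v x y s"
  using psi_malcev [of r v y x s]
  by (simp add: m_anti [of y x] psi_swap12 [of r v y "x \<star> y"] psi_swap12 [of r v y x])

text \<open>The analogue of \<open>t_d\<close>, proved like \<open>mult_d\<close> with
  \<open>psi s v\<close> in the role of \<open>d\<close>. It supplies the condition
  \<open>t_f\<close> when alternating forms are built from \<open>psi\<close>.\<close>

lemma t_psi: "t x y (psi s v x y r) = 0"
proof -
  let ?P = "psi s v x y r" and ?z = "x \<star> y"
  have 1: "psi s v x y (?z \<star> r) - y \<star> (x \<star> ?P) = - (?z \<star> ?P) - x \<star> (y \<star> ?P)"
    using psi_malcev_lin(2) [of s v ?z y x r] by (simp add: psi_mult_left psi_malcev' algebra_simps)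
  have "?z \<star> r = x \<star> (y \<star> r) - y \<star> (x \<star> r) + (d x y r + d x y r + d x y r)"
    by (simp add: commutator_d algebra_simps)
  then have 2: "psi s v x y (?z \<star> r) = x \<star> (y \<star> ?P) - y \<star> (x \<star> ?P) + (d x y ?P + d x y ?P + d x y ?P)"
    by (simp add: psi_add psi_malcev' psi_malcev'' d_psi)
  have "?z \<star> ?P = d x y ?P"
    by (rule cancel3, rule lincomb4 [OF _ 1 2 [symmetric] commutator_d [of x y ?P, symmetric] commutator_d [of x y ?P, symmetric]])
      (simp add: algebra_simps)
  then show ?thesis
    by (simp add: d_def)
qed

text \<open>Each parenthesized difference is a Jacobian up to one product, and \<open>sagle\<close>
  makes the cyclic sum of these Jacobians a multiple of \<open>x \<star> d z u y\<close>. The result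
  is written in products only, so that it can be inserted into \<open>f x _ r s\<close> in
  \<open>P_mult_zero\<close>.\<close>

lemma cyclic_mult:
  "(x \<star> y) \<star> (z \<star> u) - (x \<star> (z \<star> u)) \<star> y + ((x \<star> z) \<star> (u \<star> y) - (x \<star> (u \<star> y)) \<star> z)
    + ((x \<star> u) \<star> (y \<star> z) - (x \<star> (y \<star> z)) \<star> u)
    = x \<star> ((z \<star> u) \<star> y) + x \<star> ((u \<star> y) \<star> z) + x \<star> ((y \<star> z) \<star> u)"
proof -
  let ?e = "x \<star> d z u y"
  have 1: "(d x (z \<star> u) y + d x (z \<star> u) y + d x (z \<star> u) y) + (d x (u \<star> y) z + d x (u \<star> y) z + d x (u \<star> y) z)
      + (d x (y \<star> z) u + d x (y \<star> z) u + d x (y \<star> z) u) = - (?e + ?e + ?e + ?e + ?e + ?e)"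
    by (rule lincomb3 [OF _ sagle [of z u y x] sagle [of u y z x] sagle [of y z u x]])
      (simp add: d_cycle [of "z \<star> u" y x] d_cycle [of "u \<star> y" z x] d_cycle [of "y \<star> z" u x]
        d_cycle [of u y z] d_cycle [of y z u] d_swap23 [of z x u] d_swap23 [of u x y] d_swap23 [of y x z]
        d_cycle [of u x z] d_cycle [of y x u] d_cycle [of z x y] algebra_simps)
  have 2: "?e + ?e + ?e = x \<star> ((z \<star> u) \<star> y) + x \<star> ((u \<star> y) \<star> z) + x \<star> ((y \<star> z) \<star> u)"
    using arg_cong [OF three_d [of z u y], of "\<lambda>v. x \<star> v"]
    by (simp add: lin m_anti [of z "u \<star> y"] m_anti [of u "y \<star> z"] m_anti [of z y] algebra_simps)
  show ?thesis
    by (rule lincomb6 [OF _ three_d [of x "z \<star> u" y] three_d [of x "u \<star> y" z] three_d [of x "y \<star> z" u]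
          1 [symmetric] 2 2])
      (simp add: m_anti [of "z \<star> u" "x \<star> y"] m_anti [of "u \<star> y" "x \<star> z"] m_anti [of "y \<star> z" "x \<star> u"] algebra_simps)
qed

end

section \<open>Alternating forms in four arguments\<close>

text \<open>The conditions copy \<open>malcev\<close> and \<open>t_d\<close>, which the nonzero
  three-argument \<open>d\<close> satisfies; it is the fourth alternating argument that forces
  vanishing.\<close>

locale alternating_form = malcev_triple m t
  for m :: "'a::ab_group_add \<Rightarrow> 'a \<Rightarrow> 'a" (infixl \<open>\<star>\<close> 75) and t +
  fixes f :: "'a \<Rightarrow> 'a \<Rightarrow> 'a \<Rightarrow> 'a \<Rightarrow> 'a"
  assumes f_add1: "f (p + p') q r s = f p q r s + f p' q r s"
    and f_swap12: "f q p r s = - f p q r s"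
    and f_swap23: "f p r q s = - f p q r s"
    and f_swap34: "f p q s r = - f p q r s"
    and f_malcev: "f p (p \<star> q) r s = - (p \<star> f p q r s)"
    and t_f: "t x y (f x y r s) = 0"
begin

lemma f_add2: "f p (q + q') r s = f p q r s + f p q' r s"
  by (subst (1 2 3) f_swap12) (simp add: f_add1)

lemma f_add3: "f p q (r + r') s = f p q r s + f p q r' s"
  by (subst (1 2 3) f_swap23) (simp add: f_add2)

lemma f_add4: "f p q r (s + s') = f p q r s + f p q r s'"
  by (subst (1 2 3) f_swap34) (simp add: f_add3)

lemmas f_add = f_add1 f_add2 f_add3 f_add4

lemma f_simps [simp]:
  "f 0 q r s = 0" "f p 0 r s = 0" "f p q 0 s = 0" "f p q r 0 = 0"
  "f (- p) q r s = - f p q r s" "f p (- q) r s = - f p q r s" "f p q (- r) s = - f p q r s" "f p q r (- s) = - f p q r s"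
  "f (p - p') q r s = f p q r s - f p' q r s" "f p (q - q') r s = f p q r s - f p q' r s"
  "f p q (r - r') s = f p q r s - f p q r' s" "f p q r (s - s') = f p q r s - f p q r s'"
  using additive_zero [of "\<lambda>u. f u q r s"] additive_zero [of "\<lambda>u. f p u r s"]
    additive_zero [of "\<lambda>u. f p q u s"] additive_zero [of "\<lambda>u. f p q r u"]
    additive_minus [of "\<lambda>u. f u q r s"] additive_minus [of "\<lambda>u. f p u r s"]
    additive_minus [of "\<lambda>u. f p q u s"] additive_minus [of "\<lambda>u. f p q r u"]
  by (simp_all add: f_add)

lemma f_self [simp]: "f p p r s = 0" "f p q q s = 0" "f p q r r = 0" "f p q p s = 0" "f p q r q = 0" "f p q r p = 0"
proof -
  show 1: "f p p r s = 0" for p r s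
    by (rule eq_self_neg) (rule f_swap12)
  show 2: "f p q q s = 0" for p q s
    by (rule eq_self_neg) (rule f_swap23)
  show 3: "f p q r r = 0" for p q r
    by (rule eq_self_neg) (rule f_swap34)
  show 4: "f p q p s = 0" for p q s
    using 1 [of p q s] by (simp add: f_swap23 [of p q p])
  show "f p q r q = 0"
    using 2 [of p q r] by (simp add: f_swap34 [of p q r q])
  show "f p q r p = 0"
    using 4 [of p q r] by (simp add: f_swap34 [of p q r p])
qed

lemma f_malcev3: "f p q (p \<star> r) s = - (p \<star> f p q r s)"
  by (simp add: f_swap23 [of p q "p \<star> r"] f_malcev f_swap23 [of p r q])

lemma f_malcev4: "f p q r (p \<star> s) = - (p \<star> f p q r s)"
  by (simp add: f_swap34 [of p q r "p \<star> s"] f_malcev3 f_swap34 [of p q s r])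

lemma f_malcev3': "f p q (q \<star> r) s = - (q \<star> f p q r s)"
  by (simp add: f_swap12 [of p q] f_malcev3)

lemma f_mult_left: "f (x \<star> y) y r s = y \<star> f x y r s"
proof -
  have "f (x \<star> y) y r s = - f (y \<star> x) y r s"
    by (simp add: m_anti [of x y])
  then show ?thesis
    by (simp add: f_swap12 [of "y \<star> x" y] f_malcev f_swap12 [of y x])
qed

lemma f_malcev_lin:
  "f z (x \<star> q) r s + f x (z \<star> q) r s = - (z \<star> f x q r s) - x \<star> f z q r s"
  "f z q (x \<star> r) s + f x q (z \<star> r) s = - (z \<star> f x q r s) - x \<star> f z q r s"
  by (rule lincomb3 [OF _ f_malcev [of "x + z" q r s] f_malcev [of x q r s, symmetric] f_malcev [of z q r s, symmetric]],
      simp add: lin f_add algebra_simps)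
    (rule lincomb3 [OF _ f_malcev3 [of "x + z" q r s] f_malcev3 [of x q r s, symmetric] f_malcev3 [of z q r s, symmetric]],
      simp add: lin f_add algebra_simps)

text \<open>Both sides are \<open>f x y (y \<star> r) (x \<star> s)\<close>, with the two
  multiplications pulled out in either order.\<close>

lemma mult_f_commute: "x \<star> (y \<star> f x y r s) = y \<star> (x \<star> f x y r s)"
  using f_malcev4 [of x y "y \<star> r" s] f_malcev3' [of x y r "x \<star> s"]
  by (simp add: f_malcev3' f_malcev4)

text \<open>By \<open>t_f\<close>, \<open>(x \<star> y) \<star> ?F\<close> is
  \<open>d x y ?F\<close>, so \<open>commutator_d\<close> equates the vanishing commutator with
  \<open>1 - 3 = -2\<close> times this element.\<close>

lemma mult_f: "(x \<star> y) \<star> f x y r s = 0"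
proof -
  let ?F = "f x y r s"
  have 1: "(x \<star> y) \<star> ?F = d x y ?F"
    using t_f [of x y r s] by (simp add: d_def)
  have "(x \<star> y) \<star> ?F + (x \<star> y) \<star> ?F = 0"
    by (rule lincomb4 [OF _ commutator_d [of x y ?F] 1 1 1]) (simp add: mult_f_commute [of x y r s] algebra_simps)
  then show ?thesis
    by (rule torsion2)
qed

lemma mult_f_lin: "(x \<star> y) \<star> f x u r s + (x \<star> u) \<star> f x y r s = 0"
  using mult_f [of x "y + u" r s] by (simp add: lin f_add mult_f add.commute)

lemma f_mult_mult: "f x y ((x \<star> y) \<star> r) s = 0"
  using f_malcev_lin(2) [of "x \<star> y" y x r s]
  by (simp add: mult_f f_mult_left f_malcev3 mult_f_commute [of x y r s])

text \<open>Fixing the argument \<open>x\<close>, the map \<open>x \<star> _\<close> may be moved freely between the remaining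
  arguments of \<open>f x\<close>.\<close>

definition P :: "'a \<Rightarrow> 'a \<Rightarrow> 'a \<Rightarrow> 'a \<Rightarrow> 'a \<Rightarrow> 'a" where
  "P x y u r s = f x ((x \<star> y) \<star> u) r s"

lemma P_add: "P x (y + y') u r s = P x y u r s + P x y' u r s" "P x y (u + u') r s = P x y u r s + P x y u' r s"
    "P x y u (r + r') s = P x y u r s + P x y u r' s" "P x y u r (s + s') = P x y u r s + P x y u r s'"
  by (simp_all add: P_def lin f_add)

lemma P_minus [simp]: "P x (- y) u r s = - P x y u r s" "P x y (- u) r s = - P x y u r s"
    "P x y u (- r) s = - P x y u r s" "P x y u r (- s) = - P x y u r s"
  by (simp_all add: P_def)

lemma P_swap34: "P x y u s r = - P x y u r s"
  unfolding P_def by (rule f_swap34)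

lemma P_swap13: "P x r u y s = - P x y u r s"
proof -
  have 1: "P x y u y s = 0" for y
    using f_mult_mult [of x y u s] by (simp add: P_def f_swap23 [of x "(x \<star> y) \<star> u" y])
  show ?thesis
    using 1 [of "y + r"] by (simp add: P_add 1 eq_neg_iff_add_eq_0 add.commute)
qed

lemma f_d_swap: "f x (d x r u) y s = - f x (d x y u) r s"
proof -
  have 1: "f x (d x y u) y s = 0" for y
  proof (rule torsion3)
    have "f x (d x y u) y s + f x (d x y u) y s + f x (d x y u) y s
        = f x (d x y u + d x y u + d x y u) y s"
      by (simp add: f_add)
    also have "\<dots> = 0"
      unfolding three_d using f_mult_mult [of x y u s]
      by (simp add: f_add f_swap23 [of x _ y] f_malcev3 f_malcev3' mult_f_commute [of x y u s])
    finally show "f x (d x y u) y s + f x (d x y u) y s + f x (d x y u) y s = 0" .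
  qed
  show ?thesis
    using 1 [of "y + r"] by (simp add: lin f_add 1 eq_neg_iff_add_eq_0 add.commute)
qed

text \<open>The multiplication by \<open>x\<close> is absorbed into \<open>u\<close> inside
  \<open>d\<close>; \<open>sw\<close> moves that argument to a plain slot of \<open>f\<close>, from
  which it comes out with the opposite sign.\<close>

lemma mult_f_d: "x \<star> f x (d x y u) r s = 0"
proof -
  have sw: "f x (d x y r) u s = - f x (d x y u) r s" for u r
    by (simp add: d_swap23 [of x y r] f_d_swap [of x r y u s] d_swap23 [of x u y])
  have "x \<star> f x (d x y u) r s = f x (d x y (x \<star> u)) r s"
    by (simp add: malcev f_malcev)
  also have "\<dots> = - f x (d x y r) (x \<star> u) s"
    by (simp add: sw [of "x \<star> u"])
  also have "\<dots> = - (x \<star> f x (d x y u) r s)"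
    by (simp add: f_malcev3 sw [of r u])
  finally show ?thesis
    by (rule eq_self_neg)
qed

text \<open>\<open>f x _ r s\<close> vanishes on \<open>d x y (x \<star> u)\<close>. Expanding three
  times this Jacobian gives \<open>P x y (x \<star> u) r s\<close> and two further terms, which
  cancel.\<close>

lemma P_mult: "P x y (x \<star> u) r s = 0"
proof -
  let ?w = "x \<star> u"
  have 1: "f x (d x y ?w) r s = 0"
    using mult_f_d [of x y u r s] by (simp add: malcev f_malcev)
  have "f x ((x \<star> y) \<star> ?w) r s - f x (x \<star> (y \<star> ?w)) r s + f x (y \<star> (x \<star> ?w)) r s = 0"
    using arg_cong [OF three_d [of x y ?w], of "\<lambda>v. f x v r s"] by (simp add: f_add 1)
  then have 2: "P x y ?w r s + x \<star> f x (y \<star> ?w) r s - P x ?w y r s = 0"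
    by (simp add: P_def f_malcev m_anti [of y "x \<star> ?w"])
  have 3: "x \<star> f x (y \<star> ?w) r s = - (x \<star> P x u y r s)"
    by (simp add: P_def m_anti [of y ?w])
  have 4: "P x ?w y r s = - (x \<star> P x u y r s)"
    by (simp add: P_swap13 [of x ?w y r s] P_swap13 [of x u y r s]) (simp add: P_def f_malcev3)
  show ?thesis
    using 2 by (simp add: 3 4)
qed

text \<open>\<open>P_mult\<close> says that
  \<open>f x ((x \<star> y) \<star> (x \<star> u)) r s\<close> vanishes; this is its polarization in
  \<open>x\<close>.\<close>

lemma f_mult_mult': "f z ((x \<star> y) \<star> (x \<star> u)) r s = - P x y (z \<star> u) r s + P x u (z \<star> y) r s"
  using cubic_polar [of "\<lambda>a b c. f a ((b \<star> y) \<star> (c \<star> u)) r s" z x] P_mult [of _ y u r s]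
  by (simp add: P_def lin f_add m_anti [of "z \<star> y" "x \<star> u"] algebra_simps)

text \<open>For \<open>z = r\<close> the left side of \<open>f_mult_mult'\<close> is zero, so
  \<open>q\<close> is symmetric in \<open>y, u\<close>. It is antisymmetric in \<open>y, s\<close>,
  hence zero, and polarization in \<open>r\<close> gives the claim.\<close>

lemma P_mult_swap: "P x y (r \<star> u) z s = - P x y (z \<star> u) r s"
proof -
  have 1: "P x y (r \<star> u) r s = 0" for r
  proof -
    define q where "q y u s = P x y (r \<star> u) r s" for y u s
    have s12: "q u y s = q y u s" for y u s
      using f_mult_mult' [of r x y u r s] by (simp add: q_def)
    have s13: "q s u y = - q y u s" for y u s
      by (simp add: q_def P_swap13 [of x s _ r y] P_swap34 [of x r _ s y] P_swap13 [of x r _ y s])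
    have "q y u s = - q s y u"
      by (simp only: s12 [of y u s] s13 [of u y s])
    also have "q s y u = - q u s y"
      by (simp only: s12 [of s y u] s13 [of y s u])
    also have "q u s y = - q y u s"
      by (simp only: s12 [of u s y] s13 [of s u y])
    finally have "q y u s = - q y u s"
      by simp
    then show ?thesis
      unfolding q_def by (rule eq_self_neg)
  qed
  show ?thesis
    using 1 [of "z + r"] by (simp add: lin P_add 1 eq_neg_iff_add_eq_0 add.commute)
qed

lemma P_sym_sum: "P x y u r s + P x u y r s = x \<star> f x y (u \<star> r) s + x \<star> f x u (y \<star> r) s"
proof -
  have 1: "f (x \<star> u) y r s + f (x \<star> y) u r s = - f x y (u \<star> r) s - f x u (y \<star> r) s"
    by (rule lincomb2 [OF _ f_malcev_lin(1) [of y u x r s] f_malcev_lin(2) [of y x u r s, symmetric]])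
      (simp add: m_anti [of u x] m_anti [of y x] f_swap12 [of y "x \<star> u"] f_swap12 [of u "x \<star> y"]
        f_swap12 [of y x] f_swap12 [of u x])
  have 2: "x \<star> f (x \<star> u) y r s + x \<star> f (x \<star> y) u r s = - (x \<star> f x y (u \<star> r) s) - x \<star> f x u (y \<star> r) s"
    using arg_cong [OF 1, of "\<lambda>v. x \<star> v"] by (simp add: lin)
  show ?thesis
    by (rule lincomb4 [OF _ f_malcev_lin(1) [of "x \<star> y" x u r s] f_malcev_lin(1) [of "x \<star> u" x y r s]
          mult_f_lin [of x y u r s, symmetric] 2 [symmetric]])
      (simp add: P_def f_swap12 [of "x \<star> u" "x \<star> y"] algebra_simps)
qed

definition T :: "'a \<Rightarrow> 'a \<Rightarrow> 'a \<Rightarrow> 'a \<Rightarrow> 'a \<Rightarrow> 'a \<Rightarrow> 'a" where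
  "T x a b z u e = f x (a \<star> b) (x \<star> (z \<star> u)) e"

text \<open>Three instances of \<open>P_sym_sum\<close> trade the two summands on the left, which
  arise from \<open>cyclic_mult\<close>, for one value of \<open>P\<close> of the kind to be
  computed and values of \<open>T\<close>.\<close>

lemma P_plus_f:
  "P x (z \<star> u) y r s + f x (x \<star> ((z \<star> u) \<star> y)) r s
    = T x y r z u s + T x s y z u r - T x r s z u y - P x y (z \<star> u) r s"
proof -
  let ?w = "z \<star> u"
  have 1: "P x y ?w r s + P x ?w y r s = - (x \<star> f x (?w \<star> r) y s) + T x y r z u s" for y r s
    using P_sym_sum [of x y ?w r s]
    by (simp add: T_def f_swap23 [of x y "?w \<star> r"] f_swap23 [of x "?w" "y \<star> r"] f_malcev3)
  have 2: "P x s ?w y r = P x y ?w r s" "P x s ?w r y = - P x y ?w r s"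
    by (simp_all add: P_swap13 [of x s ?w y r] P_swap34 [of x y ?w s r] P_swap34 [of x s ?w r y])
  show ?thesis
    by (rule lincomb3 [OF _ 1 [of y r s] 1 [of s y r] 1 [of s r y]])
      (simp add: 2 f_malcev P_swap34 [of x ?w s r y] f_swap34 [of x "?w \<star> y" s r] f_swap34 [of x "?w \<star> r" s y]
        T_def m_anti [of s r] algebra_simps)
qed

text \<open>Applying \<open>f x _ r s\<close> to the cyclic identity evaluates \<open>6 P x y (z \<star> u) r s\<close> as a sum of values of
  \<open>T\<close>, which cancel in the sum over four even permutations of the alternating arguments \<open>y, z, u, r, s\<close>.\<close>

lemma P_mult_zero: "P x y (z \<star> u) r s = 0"
proof -
  define p where "p y z u r s = P x y (z \<star> u) r s" for y z u r s
  have sw23: "p y u z r s = - p y z u r s" for y z u r s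
    by (simp add: p_def m_anti [of u z])
  have sw45: "p y z u s r = - p y z u r s" for y z u r s
    unfolding p_def by (rule P_swap34)
  have sw14: "p r z u y s = - p y z u r s" for y z u r s
    unfolding p_def by (rule P_swap13)
  have sw24: "p y r u z s = - p y z u r s" for y z u r s
    unfolding p_def by (rule P_mult_swap)
  have sw12: "p z y u r s = - p y z u r s" for y z u r s
    by (simp only: sw14 [of z y u r s] sw24 [of r y u z s] sw14 [of r z u y s] minus_minus)
  have sw34: "p y z r u s = - p y z u r s" for y z u r s
    by (simp only: sw23 [of y z r u s] sw24 [of y r z u s] sw23 [of y u z r s] minus_minus)
  have cyc: "p z u y r s = p y z u r s" for y z u r s
    by (simp only: sw23 [of z u y r s] sw12 [of z y u r s] minus_minus)
  define S where "S a b c e g = T x a b c e g" for a b c e g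
  have S12: "S b a c e g = - S a b c e g" and S34: "S a b e c g = - S a b c e g"
    and S13: "S c e a b g = - S a b c e g" for a b c e g
    by (simp_all add: S_def T_def m_anti [of b a] m_anti [of e c] f_swap23 [of x "c \<star> e"] f_malcev f_malcev3)
  have six: "p y z u r s + p y z u r s + p y z u r s + (p y z u r s + p y z u r s + p y z u r s)
      = S y r z u s + S s y z u r - S r s z u y + (S z r u y s + S s z u y r - S r s u y z)
        + (S u r y z s + S s u y z r - S r s y z u)" for y z u r s
  proof -
    have 1: "P x y (z \<star> u) r s + P x z (u \<star> y) r s + P x u (y \<star> z) r s
      = P x (z \<star> u) y r s + f x (x \<star> ((z \<star> u) \<star> y)) r s
        + (P x (u \<star> y) z r s + f x (x \<star> ((u \<star> y) \<star> z)) r s)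
        + (P x (y \<star> z) u r s + f x (x \<star> ((y \<star> z) \<star> u)) r s)"
      by (rule lincomb1 [OF _ arg_cong [OF cyclic_mult [of x y z u], of "\<lambda>v. f x v r s"]])
        (simp add: P_def f_add algebra_simps)
    then show ?thesis
      unfolding P_plus_f p_def [symmetric] S_def [symmetric]
      using cyc [of z u y r s] cyc [of y z u r s] by (simp add: algebra_simps)
  qed
  let ?q = "p y z u r s"
  have "p r u z y s = ?q" "p u r y z s = ?q" "p z y r u s = ?q"
    by (simp_all only: sw14 [of r u z y s] sw23 [of y u z r s] sw24 [of u r y z s] sw12 [of u z y r s] cyc [of z u y r s]
        sw12 [of z y r u s] sw34 [of y z r u s] minus_minus)
  note q = this
  define Q where "Q = ?q + ?q + ?q + (?q + ?q + ?q)"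
  have "Q + Q + (Q + Q) = 0"
    unfolding Q_def
    by (rule lincomb4 [OF _ six [of y z u r s] six [of r u z y s, unfolded q] six [of u r y z s, unfolded q]
            six [of z y r u s, unfolded q]])
      (simp add:
          S12 [of s r] S12 [of u r] S12 [of y r] S12 [of z r] S12 [of u s] S12 [of y s] S12 [of z s] S12 [of y u] S12
          [of z u] S12 [of z y]
          S34 [of _ _ s r] S34 [of _ _ u r] S34 [of _ _ y r] S34 [of _ _ z r] S34 [of _ _ u s] S34 [of _ _ y s] S34 [of
          _ _ z s] S34 [of _ _ y u] S34 [of _ _ z u] S34 [of _ _ z y]
          S13 [of u y r s] S13 [of u z r s] S13 [of y z r s] S13 [of s y r u] S13 [of s z r u] S13 [of y z r u] S13 [of
          s u r y] S13 [of s z r y] S13 [of u z r y] S13 [of s u r z] S13 [of s y r z] S13 [of u y r z] S13 [of y z s u]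
          S13 [of u z s y] S13 [of u y s z] algebra_simps)
  from torsion2 [OF torsion2 [OF this]] have "?q + ?q + ?q = 0"
    unfolding Q_def by (rule torsion2)
  then have "?q = 0"
    by (rule torsion3)
  then show ?thesis
    by (simp add: p_def)
qed

text \<open>By \<open>f_mult_mult'\<close> and \<open>P_mult_zero\<close>, \<open>g\<close>
  alternates in its four arguments. Exchanging the two factors permutes them evenly, but
  anticommutativity changes the sign.\<close>

lemma f_square_square: "f ((a \<star> b) \<star> (c \<star> e)) p q r = 0"
proof -
  define g where "g a b c e = f ((a \<star> b) \<star> (c \<star> e)) p q r" for a b c e
  have s12: "g b a c e = - g a b c e" and s34: "g a b e c = - g a b c e" and s: "g c e a b = - g a b c e" for a b c e
    by (simp_all add: g_def m_anti [of b a] m_anti [of e c] m_anti [of "c \<star> e" "a \<star> b"])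
  have "g (a + c) b (a + c) e = g a b a e + g c b c e + (g c b a e + g a b c e)" for a b c e
    by (simp add: g_def lin f_add algebra_simps)
  moreover have "g x y x u = 0" for x y u
    by (simp add: g_def f_swap12 [of "(x \<star> y) \<star> (x \<star> u)" p] f_mult_mult' P_mult_zero)
  ultimately have s13: "g c b a e = - g a b c e" for a b c e
    by (simp add: eq_neg_iff_add_eq_0)
  have "g a e c b = - g a b c e"
    by (simp only: s12 [of a e c b] s34 [of e a c b] s13 [of e a b c] s12 [of b a e c] s34 [of a b e c] minus_minus)
  then have "g a b c e = - g a b c e"
    using s [of c e a b] s13 [of c e a b] by simp
  then show ?thesis
    unfolding g_def by (rule eq_self_neg)
qed

end

section \<open>Operators commuting with multiplications\<close>

text \<open>The projection \<open>\<pi>\<close> onto the part on which the structure lives (the odd part of a triality algebra)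
  avoids carrier sets: all operations factor through \<open>\<pi>\<close>.\<close>

locale perfect_malcev_triple = malcev_triple m t
  for m :: "'a::ab_group_add \<Rightarrow> 'a \<Rightarrow> 'a" (infixl \<open>\<star>\<close> 75) and t +
  fixes \<pi> :: "'a \<Rightarrow> 'a"
  assumes pi_add: "\<pi> (x + y) = \<pi> x + \<pi> y"
    and pi_m: "\<pi> x \<star> y = x \<star> y" "\<pi> (x \<star> y) = x \<star> y"
    and pi_t: "t (\<pi> x) y z = t x y z" "t x y (\<pi> z) = t x y z" "\<pi> (t x y z) = t x y z"
    and m_generates: "\<lbrakk>0 \<in> S; \<And>x y. x \<in> S \<Longrightarrow> y \<in> S \<Longrightarrow> x + y \<in> S; \<And>x y. x \<star> y \<in> S\<rbrakk> \<Longrightarrow> \<pi> x \<in> S"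
    and d_generates: "\<lbrakk>0 \<in> S; \<And>x y. x \<in> S \<Longrightarrow> y \<in> S \<Longrightarrow> x + y \<in> S; \<And>x y z. d x y z \<in> S\<rbrakk> \<Longrightarrow> \<pi> x \<in> S"
    and d_nondegenerate: "(\<And>x y. d x y z = 0) \<Longrightarrow> \<pi> z = 0"
begin

lemma pi_m2: "x \<star> \<pi> y = x \<star> y"
  by (subst (1 2) m_anti) (simp add: pi_m)

lemma pi_t2: "t x (\<pi> y) z = t x y z"
  by (subst (1 2) t_anti) (simp add: pi_t)

lemma pi_simps [simp]: "\<pi> 0 = 0" "\<pi> (- x) = - \<pi> x" "\<pi> (x - y) = \<pi> x - \<pi> y"
  using additive_zero [of \<pi>] additive_minus [of \<pi>] by (simp_all add: pi_add)

lemma pi_d: "d (\<pi> x) y z = d x y z" "d x (\<pi> y) z = d x y z" "d x y (\<pi> z) = d x y z" "\<pi> (d x y z) = d x y z"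
  by (simp_all add: d_def pi_m pi_m2 pi_t pi_t2)

lemma pi_psi: "psi r v p q (\<pi> s) = psi r v p q s" "\<pi> (psi r v p q s) = psi r v p q s"
  "psi (\<pi> r) v p q s = psi r v p q s" "psi r (\<pi> v) p q s = psi r v p q s"
  by (simp_all add: psi_def pi_d pi_t pi_t2 pi_add)

text \<open>\<open>f_square_square\<close> covers only products of two products. Perfectness is used
  three times: it frees the factor \<open>c \<star> e\<close>, then \<open>a \<star> b\<close>, then
  the whole argument.\<close>

lemma form_zero:
  assumes "alternating_form m t f" and pi: "\<And>p q r s. f (\<pi> p) q r s = f p q r s"
  shows "f p q r s = 0"
proof -
  interpret alternating_form m t f
    by fact
  have 1: "f ((a \<star> b) \<star> c) q r s = 0" for a b c
    using m_generates [of "{c. f ((a \<star> b) \<star> c) q r s = 0}" c]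
    by (simp add: lin f_add f_square_square pi_m2)
  have 2: "f (a \<star> b) q r s = 0" for a b
    using m_generates [of "{a. f (a \<star> b) q r s = 0}" a]
    by (simp add: lin f_add 1 pi_m)
  show ?thesis
    using m_generates [of "{p. f p q r s = 0}" p]
    by (simp add: lin f_add 2 pi)
qed

text \<open>\<open>d_psi\<close> is the case in which the outer and the inner pair share an
  argument. It makes the difference alternate in all of \<open>a, b, p, q\<close>, and
  \<open>form_zero\<close> applies.\<close>

lemma d_psi_commute: "d a b (psi r v p q s) = psi r v a b (d p q s)"
proof -
  define f where "f a b p q = d a b (psi r v p q s) - psi r v a b (d p q s)" for a b p q
  have swap23: "f a p b q = - f a b p q" for a b p q
  proof -
    have 0: "f a b b q = 0" for a b q
      using d_psi [of b a r v q s]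
      by (simp add: f_def d_swap12 [of a b] psi_swap12 [of r v a b])
    show ?thesis
      using 0 [of a "b + p" q] 0 [of a b q] 0 [of a p q]
      by (simp add: f_def lin psi_add eq_neg_iff_add_eq_0 algebra_simps)
  qed
  have "alternating_form m t f"
  proof unfold_locales
    show "f q p r s = - f p q r s" for p q r s
      by (simp add: f_def d_swap12 [of q p] psi_swap12 [of _ _ q p])
    show "f p q s r = - f p q r s" for p q r s
      by (simp add: f_def d_swap12 [of s r] psi_swap12 [of _ _ s r])
    show "f p r q s = - f p q r s" for p q r s
      by (rule swap23)
  qed (simp_all add: f_def lin psi_add malcev psi_malcev t_psi algebra_simps)
  then have "f a b p q = 0"
    by (rule form_zero) (simp add: f_def pi_d psi_def)
  then show ?thesis
    by (simp add: f_def)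
qed

text \<open>The quotient of \<open>psi\<close> by \<open>d\<close>: nondegeneracy of
  \<open>d\<close> gives uniqueness. For \<open>u = d p q s\<close> the element
  \<open>psi r v p q s\<close> is a solution by \<open>d_psi_commute\<close>, and such
  \<open>u\<close> generate, whence existence.\<close>

definition scalar :: "'a \<Rightarrow> 'a \<Rightarrow> 'a \<Rightarrow> 'a" where
  "scalar r v u = (THE w. \<pi> w = w \<and> (\<forall>p q. d p q w = psi r v p q u))"

lemma d_eq: "\<pi> w = w \<Longrightarrow> \<pi> w' = w' \<Longrightarrow> (\<And>p q. d p q w = d p q w') \<Longrightarrow> w = w'"
  using d_nondegenerate [of "w - w'"] by simp

lemma scalarI: "\<pi> w = w \<Longrightarrow> (\<And>p q. d p q w = psi r v p q u) \<Longrightarrow> scalar r v u = w"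
  unfolding scalar_def by (rule the_equality) (auto intro: d_eq)

lemma scalar_d: "scalar r v (d p q s) = psi r v p q s"
  by (rule scalarI) (simp_all add: pi_psi d_psi_commute)

lemma scalar_ex: "\<exists>w. \<pi> w = w \<and> (\<forall>p q. d p q w = psi r v p q u)"
proof -
  define S where "S = {u. \<exists>w. \<pi> w = w \<and> (\<forall>p q. d p q w = psi r v p q u)}"
  have "\<pi> u \<in> S"
  proof (rule d_generates)
    show "0 \<in> S"
      by (auto simp: S_def intro: exI [of _ 0])
    show "x + y \<in> S" if "x \<in> S" "y \<in> S" for x y
    proof -
      from that obtain w w' where "\<pi> w = w" "\<forall>p q. d p q w = psi r v p q x" "\<pi> w' = w'" "\<forall>p q. d p q w' = psi r v p q y"
        by (auto simp: S_def)
      then show ?thesis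
        by (auto simp: S_def pi_add lin psi_add intro!: exI [of _ "w + w'"])
    qed
    show "d x y z \<in> S" for x y z
      by (auto simp: S_def pi_psi d_psi_commute intro!: exI [of _ "psi r v x y z"])
  qed
  then show ?thesis
    by (simp add: S_def pi_psi)
qed

lemma pi_scalar: "\<pi> (scalar r v u) = scalar r v u" and d_scalar: "d p q (scalar r v u) = psi r v p q u"
  using scalar_ex [of r v u] scalarI [of _ r v u] by auto

lemma scalar_add: "scalar r v (u + u') = scalar r v u + scalar r v u'"
  by (rule scalarI) (simp_all add: pi_add pi_scalar lin psi_add d_scalar)

lemma scalar_minus [simp]: "scalar r v 0 = 0" "scalar r v (- u) = - scalar r v u" "scalar r v (u - u') = scalar r v u - scalar r v u'"
  using additive_zero [of "scalar r v"] additive_minus [of "scalar r v"] by (simp_all add: scalar_add)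

text \<open>The failure of \<open>scalar r v\<close> to commute with multiplications is measured by an alternating form
  in six arguments, which vanishes.\<close>

lemma scalar_mult: "scalar r v (w \<star> u) = w \<star> scalar r v u"
proof -
  define \<delta> where "\<delta> w u = scalar r v (w \<star> u) - w \<star> scalar r v u" for w u
  have \<delta>_add: "\<delta> (w + w') u = \<delta> w u + \<delta> w' u" "\<delta> w (u + u') = \<delta> w u + \<delta> w u'" for w w' u u'
    by (simp_all add: \<delta>_def lin scalar_add algebra_simps)
  have pi\<delta>: "\<pi> (\<delta> w u) = \<delta> w u" for w u
    by (simp add: \<delta>_def pi_scalar pi_m)
  have 0: "\<delta> w (d p q s) = 0" for w p q s
  proof -
    define f where "f a b w p = d a b (\<delta> w (d p q s))" for a b w p
    have 1: "f a b b p = 0" for a b p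
      by (simp add: f_def \<delta>_def d_scalar malcev psi_malcev'')
    have 2: "f a b p p = 0" for a b p
      using scalar_d [of r v p "p \<star> q" s]
      by (simp add: f_def \<delta>_def malcev scalar_d psi_malcev)
    have f_add: "f (a + a') b w p = f a b w p + f a' b w p" "f a (b + b') w p = f a b w p + f a b' w p"
      "f a b (w + w') p = f a b w p + f a b w' p" "f a b w (p + p') = f a b w p + f a b w p'" for a a' b b' w w' p p'
      by (simp_all add: f_def lin \<delta>_add)
    have "alternating_form m t f"
    proof unfold_locales
      show "f q p r s = - f p q r s" for p q r s
        by (simp add: f_def d_swap12 [of q p])
      show "f p r q s = - f p q r s" for p q r s
        using 1 [of p "q + r" s] by (simp add: f_add 1 [of p q s] 1 [of p r s] eq_neg_iff_add_eq_0 add.commute)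
      show "f p q s r = - f p q r s" for p q r s
        using 2 [of p q "r + s"] by (simp add: f_add 2 [of p q r] 2 [of p q s] eq_neg_iff_add_eq_0 add.commute)
    qed (simp_all add: f_add, simp_all add: f_def malcev)
    then have "f a b w p = 0" for a b
      by (rule form_zero) (simp add: f_def pi_d)
    then show ?thesis
      using d_eq [of "\<delta> w (d p q s)" 0] by (simp add: f_def pi\<delta>)
  qed
  have "\<delta> w (\<pi> u) = 0"
    using d_generates [of "{u. \<delta> w u = 0}" u] 0 by (simp add: \<delta>_add) (simp add: \<delta>_def)
  moreover have "scalar r v (\<pi> u) = scalar r v u" for u
    by (rule scalarI) (simp_all add: pi_scalar d_scalar pi_psi)
  ultimately show ?thesis
    by (simp add: \<delta>_def pi_m2)
qed

theorem t_scalar: "t r s v + t r s v = scalar r v s - scalar s v r"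
proof (rule d_eq)
  show "d p q (t r s v + t r s v) = d p q (scalar r v s - scalar s v r)" for p q
    using two_d_t [of p q r s v] by (simp add: lin d_scalar)
qed (simp_all add: pi_add pi_t pi_scalar)

end

section \<open>Simple triality algebras\<close>

locale simple_triality = lie_algebra_with_triality scale bracket \<sigma> \<rho>
  for scale :: "'k::field \<Rightarrow> 'a::ab_group_add \<Rightarrow> 'a" (infixr \<open>\<cdot>\<close> 75)
    and bracket :: "'a \<Rightarrow> 'a \<Rightarrow> 'a" and \<sigma> \<rho> :: "'a \<Rightarrow> 'a" +
  assumes two: "(2::'k) \<noteq> 0" and three: "(3::'k) \<noteq> 0" and simple: "lie_simple"
begin

lemma linear_props:
  assumes "Vector_Spaces.linear scale scale f"
  shows "f (x + y) = f x + f y" "f (c \<cdot> x) = c \<cdot> f x" "f 0 = 0" "f (- x) = - f x" "f (x - y) = f x - f y"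
proof -
  interpret module_hom scale scale f
    using assms by (simp add: linear_iff_module_hom)
  show "f (x + y) = f x + f y" "f (c \<cdot> x) = c \<cdot> f x" "f 0 = 0" "f (- x) = - f x" "f (x - y) = f x - f y"
    by (simp_all add: add scale neg diff)
qed

lemma torsion2: "x + x = 0 \<Longrightarrow> x = (0::'a)"
proof -
  assume "x + x = 0"
  then have "2 \<cdot> x = 0"
    by (metis scale_left_distrib scale_one one_add_one)
  with two show ?thesis
    by simp
qed

lemma torsion3: "x + x + x = 0 \<Longrightarrow> x = (0::'a)"
proof -
  assume "x + x + x = 0"
  moreover have "(3::'k) = 1 + 1 + 1"
    by simp
  ultimately have "3 \<cdot> x = 0"
    by (simp only: scale_left_distrib scale_one)
  with three show ?thesis
    by simp
qed

lemma cancel2: "x + x = y + y \<Longrightarrow> x = (y::'a)"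
  using torsion2 [of "x - y"] by (simp add: algebra_simps)

lemma cancel3: "x + x + x = y + y + y \<Longrightarrow> x = (y::'a)"
  using torsion3 [of "x - y"] by (simp add: algebra_simps)

lemma bracket_add: "bracket (x + y) z = bracket x z + bracket y z" "bracket x (y + z) = bracket x y + bracket x z"
  and bracket_simps [simp]: "bracket 0 y = 0" "bracket x 0 = 0"
    "bracket (- x) y = - bracket x y" "bracket x (- y) = - bracket x y"
    "bracket (x - y) z = bracket x z - bracket y z" "bracket x (y - z) = bracket x y - bracket x z"
    "bracket (c \<cdot> x) y = c \<cdot> bracket x y" "bracket x (c \<cdot> y) = c \<cdot> bracket x y"
  using linear_props [OF linear_left] linear_props [OF linear_right] by auto

lemma sigma_add: "\<sigma> (x + y) = \<sigma> x + \<sigma> y" and rho_add: "\<rho> (x + y) = \<rho> x + \<rho> y"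
  and sigma_simps [simp]: "\<sigma> 0 = 0" "\<sigma> (- x) = - \<sigma> x" "\<sigma> (x - y) = \<sigma> x - \<sigma> y" "\<sigma> (c \<cdot> x) = c \<cdot> \<sigma> x"
    "\<sigma> (bracket x y) = bracket (\<sigma> x) (\<sigma> y)"
  and rho_simps [simp]: "\<rho> 0 = 0" "\<rho> (- x) = - \<rho> x" "\<rho> (x - y) = \<rho> x - \<rho> y" "\<rho> (c \<cdot> x) = c \<cdot> \<rho> x"
    "\<rho> (bracket x y) = bracket (\<rho> x) (\<rho> y)"
  using automorphism_sigma automorphism_rho linear_props [of \<sigma>] linear_props [of \<rho>]
  unfolding lie_automorphism_def by auto

lemma sigma_sigma [simp]: "\<sigma> (\<sigma> x) = x"
  using sigma_square by (simp add: fun_eq_iff)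

lemma rho_rho_rho [simp]: "\<rho> (\<rho> (\<rho> x)) = x"
  using rho_cube by (simp add: fun_eq_iff)

lemma sigma_rho: "\<sigma> (\<rho> x) = \<rho> (\<rho> (\<sigma> x))" and sigma_rho_rho: "\<sigma> (\<rho> (\<rho> x)) = \<rho> (\<sigma> x)"
proof -
  have "inv \<rho> = \<rho> \<circ> \<rho>"
    by (rule inv_unique_comp) (simp_all add: fun_eq_iff)
  then have *: "\<sigma> (\<rho> (\<sigma> y)) = \<rho> (\<rho> y)" for y
    using sigma_rho_sigma by (simp add: fun_eq_iff)
  then show 1: "\<sigma> (\<rho> x) = \<rho> (\<rho> (\<sigma> x))" for x
    using * [of "\<sigma> x"] by simp
  show "\<sigma> (\<rho> (\<rho> x)) = \<rho> (\<sigma> x)"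
    by (simp add: 1)
qed

lemma bracket_anti: "bracket x y = - bracket y x"
proof -
  have "bracket (x + y) (x + y) = bracket x y + bracket y x"
    by (simp add: bracket_add alternating [of x] alternating [of y] del: bracket_simps)
  then show ?thesis
    by (simp add: alternating eq_neg_iff_add_eq_0)
qed

lemma bracket_derivation: "bracket a (bracket x y) = bracket (bracket a x) y + bracket x (bracket a y)"
  using jacobi [of a x y] by (simp add: bracket_anti [of y "bracket a x"] bracket_anti [of y a] algebra_simps)

section \<open>Odd elements and brackets with their rotations\<close>

definition \<pi> :: "'a \<Rightarrow> 'a" where "\<pi> x = (1 / 2) \<cdot> (x - \<sigma> x)"

definition \<tau> :: "'a \<Rightarrow> 'a" where "\<tau> x = \<rho> x - \<rho> (\<rho> x)"

lemma half: "x = (1 / 2) \<cdot> (x + x)"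
proof -
  have "(1 / 2) \<cdot> (x + x) = (1 / 2 + 1 / 2) \<cdot> x"
    by (simp only: scale_left_distrib scale_right_distrib)
  also have "(1 / 2 + 1 / 2) = (1::'k)"
    using two by (simp add: field_simps)
  finally show ?thesis
    by simp
qed

lemma pi_odd: "\<sigma> (\<pi> x) = - \<pi> x"
  by (simp add: \<pi>_def scale_right_diff_distrib)

lemma pi_of_odd: "\<sigma> x = - x \<Longrightarrow> \<pi> x = x"
  using half [of x] by (simp add: \<pi>_def)

lemma pi_of_even: "\<sigma> x = x \<Longrightarrow> \<pi> x = 0"
  by (simp add: \<pi>_def)

lemma sigma_minus_pi: "\<sigma> (x - \<pi> x) = x - \<pi> x"
proof -
  have "x - \<sigma> x = \<pi> x + \<pi> x"
    by (simp add: \<pi>_def scale_right_distrib [symmetric] half [symmetric])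
  then show ?thesis
    by (simp add: pi_odd algebra_simps)
qed

lemma even_odd_zero: "\<sigma> x = x \<Longrightarrow> \<sigma> x = - x \<Longrightarrow> x = 0"
  using torsion2 [of x] by (metis add.right_inverse)

lemma odd_sum: "\<sigma> x = - x \<Longrightarrow> \<rho> (\<rho> x) = - x - \<rho> x"
proof -
  assume "\<sigma> x = - x"
  then have "(x + \<rho> x + \<rho> (\<rho> x)) + (x + \<rho> x + \<rho> (\<rho> x)) = 0"
    using triality [of x] by (simp add: algebra_simps) (simp add: neg_eq_iff_add_eq_0 algebra_simps)
  from torsion2 [OF this] show ?thesis
    by (simp add: algebra_simps eq_neg_iff_add_eq_0)
qed

lemma tau_even: "\<sigma> x = - x \<Longrightarrow> \<sigma> (\<tau> x) = \<tau> x"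
  by (simp add: \<tau>_def sigma_rho)

lemma tau_add: "\<tau> (x + y) = \<tau> x + \<tau> y" and tau_simps [simp]: "\<tau> 0 = 0" "\<tau> (- x) = - \<tau> x" "\<tau> (x - y) = \<tau> x - \<tau> y"
    "\<tau> (c \<cdot> x) = c \<cdot> \<tau> x"
  by (simp_all add: \<tau>_def rho_add scale_right_diff_distrib)

text \<open>Brackets of odd elements with rotated ones reduce to \<open>bracket x y\<close> and its
  rotations. The relations behind this are triality for \<open>p\<close>, where
  \<open>\<sigma> p = - d - p\<close>, and the bracket of
  \<open>x + \<rho> x + \<rho> (\<rho> x) = 0\<close> with \<open>y\<close>.\<close>

lemma bracket_rho:
  assumes x: "\<sigma> x = - x" and y: "\<sigma> y = - y"
  defines "d \<equiv> bracket x y"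
  shows "bracket x (\<rho> y) + bracket x (\<rho> y) = \<rho> (\<rho> d) - d - \<rho> d"
    and "bracket (\<rho> x) y = bracket x (\<rho> y)"
proof -
  define p where "p = bracket x (\<rho> y)"
  have q: "bracket x (\<rho> (\<rho> y)) = - d - p"
    by (simp add: odd_sum [OF y] d_def p_def)
  have s: "\<sigma> p = - d - p"
    by (simp add: p_def x y sigma_rho q [unfolded p_def])
  have A: "- d - p - p + (- \<rho> d - \<rho> p - \<rho> p) + (- \<rho> (\<rho> d) - \<rho> (\<rho> p) - \<rho> (\<rho> p)) = 0"
    using triality [of p] by (simp add: s)
  have p1: "\<rho> p = bracket (\<rho> x) (\<rho> (\<rho> y))" and p2: "\<rho> (\<rho> p) = bracket (\<rho> (\<rho> x)) y"
    by (simp_all add: p_def)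
  have q1: "bracket (\<rho> x) y = - \<rho> d - \<rho> p"
    using arg_cong [OF q, of \<rho>] by simp
  have B: "d + (- \<rho> d - \<rho> p) + \<rho> (\<rho> p) = 0"
  proof -
    have "d + bracket (\<rho> x) y + bracket (\<rho> (\<rho> x)) y = 0"
      by (simp add: odd_sum [OF x] d_def)
    then show ?thesis
      by (simp only: q1 p2)
  qed
  have B1: "\<rho> d + (- \<rho> (\<rho> d) - \<rho> (\<rho> p)) + p = 0"
    using arg_cong [OF B, of \<rho>] by (simp add: rho_add)
  have C: "d - \<rho> (\<rho> d) - \<rho> p + p = 0"
    by (rule lincomb2 [OF _ B B1]) (simp add: algebra_simps)
  have 1: "p + p = \<rho> (\<rho> d) - d - \<rho> d"
    by (rule cancel3, rule lincomb5 [OF _ A [symmetric] C C B1 B1]) (simp add: algebra_simps)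
  then show "bracket x (\<rho> y) + bracket x (\<rho> y) = \<rho> (\<rho> d) - d - \<rho> d"
    by (simp add: p_def)
  have 2: "\<rho> p + \<rho> p = d - \<rho> d - \<rho> (\<rho> d)"
    using arg_cong [OF 1, of \<rho>] by (simp add: rho_add)
  show "bracket (\<rho> x) y = bracket x (\<rho> y)"
    unfolding q1 p_def [symmetric]
    by (rule cancel2, rule lincomb2 [OF _ 1 [symmetric] 2 [symmetric]]) (simp add: algebra_simps)
qed

text \<open>The right side is \<open>- \<tau> (bracket x y)\<close>, so the product is
  anticommutative although its definition treats the factors differently.\<close>

lemma bracket_tau:
  assumes x: "\<sigma> x = - x" and y: "\<sigma> y = - y"
  shows "bracket (\<tau> x) y = \<rho> (\<rho> (bracket x y)) - \<rho> (bracket x y)"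
proof -
  have 1: "bracket (\<rho> (\<rho> x)) y = - bracket x y - bracket (\<rho> x) y"
    by (simp add: odd_sum [OF x])
  show ?thesis
    unfolding \<tau>_def bracket_simps 1
    using bracket_rho [OF x y] by (simp add: algebra_simps)
qed

lemma bracket_tau_tau:
  assumes x: "\<sigma> x = - x" and y: "\<sigma> y = - y"
  shows "bracket (\<tau> x) (\<tau> y) = bracket x y + bracket x y + bracket x y
    - \<tau> (bracket (\<tau> x) y) - \<tau> (bracket (\<tau> x) y)"
proof -
  define p where "p = bracket x (\<rho> y)"
  let ?d = "bracket x y"
  have p: "p + p = \<rho> (\<rho> ?d) - ?d - \<rho> ?d"
    unfolding p_def by (rule bracket_rho [OF x y])
  have p1: "\<rho> p + \<rho> p = ?d - \<rho> ?d - \<rho> (\<rho> ?d)"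
    using arg_cong [OF p, of \<rho>] by (simp add: rho_add)
  have q: "\<rho> (bracket (\<rho> x) y) = \<rho> p" "\<rho> (bracket x (\<rho> y)) = \<rho> p"
    by (simp_all only: bracket_rho [OF x y] p_def)
  have 1: "bracket (\<tau> x) (\<tau> y) = \<rho> ?d + \<rho> (\<rho> ?d) - \<rho> p - \<rho> p"
    using q by (simp add: \<tau>_def algebra_simps)
  show ?thesis
    unfolding bracket_tau [OF x y]
    by (rule lincomb2 [OF _ 1 p1 [symmetric]]) (simp add: \<tau>_def algebra_simps)
qed

definition prod :: "'a \<Rightarrow> 'a \<Rightarrow> 'a" (infixl \<open>\<star>\<close> 75) where
  "x \<star> y = bracket (\<tau> (\<pi> x)) (\<pi> y)"

definition triple :: "'a \<Rightarrow> 'a \<Rightarrow> 'a \<Rightarrow> 'a" where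
  "triple x y z = bracket (bracket (\<pi> x) (\<pi> y)) (\<pi> z)"

lemma pi_add: "\<pi> (x + y) = \<pi> x + \<pi> y" and pi_scale: "\<pi> (c \<cdot> x) = c \<cdot> \<pi> x"
  by (simp_all add: \<pi>_def sigma_add scale_right_distrib scale_right_diff_distrib mult.commute)

lemma pi_odd': "\<sigma> x = - x \<Longrightarrow> \<sigma> y = y \<Longrightarrow> \<pi> (bracket y x) = bracket y x"
  by (rule pi_of_odd) simp

lemma pi_pi [simp]: "\<pi> (\<pi> x) = \<pi> x"
  by (rule pi_of_odd) (rule pi_odd)

lemma pi_prod [simp]: "\<pi> (x \<star> y) = x \<star> y" "\<pi> x \<star> y = x \<star> y" "x \<star> \<pi> y = x \<star> y"
  unfolding prod_def by (simp_all add: pi_odd' pi_odd tau_even)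

lemma pi_triple [simp]: "\<pi> (triple x y z) = triple x y z" "triple (\<pi> x) y z = triple x y z"
  "triple x (\<pi> y) z = triple x y z" "triple x y (\<pi> z) = triple x y z"
  unfolding triple_def by (simp_all add: pi_odd' pi_odd)

lemma prod_eq: "x \<star> y = \<rho> (\<rho> (bracket (\<pi> x) (\<pi> y))) - \<rho> (bracket (\<pi> x) (\<pi> y))"
  unfolding prod_def by (rule bracket_tau) (rule pi_odd)+

lemma prod_of_odd: "\<sigma> x = - x \<Longrightarrow> \<sigma> y = - y \<Longrightarrow> x \<star> y = bracket (\<tau> x) y"
  by (simp add: prod_def pi_of_odd)

lemma triple_of_odd: "\<sigma> x = - x \<Longrightarrow> \<sigma> y = - y \<Longrightarrow> \<sigma> z = - z \<Longrightarrow> triple x y z = bracket (bracket x y) z"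
  by (simp add: triple_def pi_of_odd)

lemma prod_odd: "\<sigma> (x \<star> y) = - (x \<star> y)"
  using pi_odd [of "x \<star> y"] by simp

lemma prod_prod: "x \<star> (y \<star> z) = bracket (\<tau> (\<pi> x)) (bracket (\<tau> (\<pi> y)) (\<pi> z))"
  "(x \<star> y) \<star> z = bracket (\<tau> (bracket (\<tau> (\<pi> x)) (\<pi> y))) (\<pi> z)"
  using prod_def [of x "y \<star> z"] prod_def [of "x \<star> y" z] by (simp_all only: pi_prod) (simp_all add: prod_def)

lemma invariant_derivation:
  assumes h: "\<rho> h = h" "\<sigma> h = h"
  shows "bracket h (x \<star> y) = bracket h (\<pi> x) \<star> y + x \<star> bracket h (\<pi> y)"
proof -
  have "bracket h (\<tau> u) = \<tau> (bracket h u)" for u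
    by (simp add: \<tau>_def h)
  moreover have "\<pi> (bracket h (\<pi> u)) = bracket h (\<pi> u)" for u
    by (simp add: pi_odd' pi_odd h)
  ultimately show ?thesis
    by (simp add: prod_def bracket_derivation [of h])
qed

sublocale malcev_triple prod triple
proof unfold_locales
  show anti: "x \<star> y = - (y \<star> x)" for x y
    by (simp add: prod_eq bracket_anti [of "\<pi> y"])
  have tau_tau: "bracket (\<tau> (\<pi> x)) (\<tau> (\<pi> y)) = bracket (\<pi> x) (\<pi> y) + bracket (\<pi> x) (\<pi> y) + bracket (\<pi> x) (\<pi> y)
      - \<tau> (x \<star> y) - \<tau> (x \<star> y)" for x y
    unfolding prod_def by (rule bracket_tau_tau) (rule pi_odd)+
  have comm: "x \<star> (y \<star> z) - y \<star> (x \<star> z) = bracket (bracket (\<tau> (\<pi> x)) (\<tau> (\<pi> y))) (\<pi> z)" for x y z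
    unfolding prod_prod using bracket_derivation [of "\<tau> (\<pi> x)" "\<tau> (\<pi> y)" "\<pi> z"] by (simp add: algebra_simps)
  show "x \<star> (y \<star> z) - y \<star> (x \<star> z) = triple x y z + triple x y z + triple x y z - (x \<star> y) \<star> z - (x \<star> y) \<star> z" for x y z
    unfolding comm tau_tau by (simp add: triple_def prod_def [of "x \<star> y"] bracket_add)
  show "x \<star> (y \<star> (z \<star> w)) - y \<star> (x \<star> (z \<star> w)) + (x \<star> y) \<star> (z \<star> w)
      = (x \<star> (y \<star> z) - y \<star> (x \<star> z) + (x \<star> y) \<star> z) \<star> w + z \<star> (x \<star> (y \<star> w) - y \<star> (x \<star> w) + (x \<star> y) \<star> w)" for x y z w
  proof -
    \<comment> \<open>The operator is the bracket with \<open>h\<close>, the sum of the rotations of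
      \<open>e\<close>: one has \<open>[\<tau> x, \<tau> y] + \<tau> (x \<star> y) = 3 e - \<tau> (x
      \<star> y)\<close> on odd elements \<open>x, y\<close>, and
      \<open>\<tau> (x \<star> y) = 2 e - \<rho> e - \<rho> (\<rho> e)\<close>.\<close>
    define e where "e = bracket (\<pi> x) (\<pi> y)"
    define h where "h = e + \<rho> e + \<rho> (\<rho> e)"
    have "\<sigma> e = e"
      by (simp add: e_def pi_odd)
    then have h: "\<rho> h = h" "\<sigma> h = h"
      by (simp_all add: h_def rho_add sigma_add sigma_rho algebra_simps)
    have 1: "(x \<star> y) \<star> u = bracket (\<tau> (x \<star> y)) (\<pi> u)" for u
      by (simp add: prod_def [of "x \<star> y"])
    have 2: "\<tau> (x \<star> y) = e + e - \<rho> e - \<rho> (\<rho> e)"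
      by (simp add: prod_eq e_def [symmetric] \<tau>_def algebra_simps)
    have 3: "x \<star> (y \<star> u) - y \<star> (x \<star> u) + (x \<star> y) \<star> u = bracket h (\<pi> u)" for u
      unfolding comm tau_tau 1 2 by (simp add: h_def e_def [symmetric] bracket_add)
    show ?thesis
      unfolding 3 pi_prod by (rule invariant_derivation [OF h])
  qed
  show "w \<star> triple x y z = triple (w \<star> x) y z + triple x (w \<star> y) z + triple x y (w \<star> z)" for w x y z
  proof -
    have 1: "w \<star> triple x y z = bracket (\<tau> (\<pi> w)) (triple x y z)"
      unfolding prod_def by simp
    show ?thesis
      unfolding 1 unfolding triple_def pi_prod unfolding prod_def
      by (simp add: bracket_derivation [of "\<tau> (\<pi> w)"] bracket_add)
  qed
  show "triple u v (triple x y z) = triple (triple u v x) y z + triple x (triple u v y) z + triple x y (triple u v z)" for u v x y z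
  proof -
    have 1: "triple u v (triple x y z) = bracket (bracket (\<pi> u) (\<pi> v)) (triple x y z)"
      by (subst triple_def) simp
    show ?thesis
      unfolding 1 unfolding triple_def [of x y z] triple_def [of _ y z] triple_def [of x _ z] triple_def [of x y] pi_triple
      unfolding triple_def
      by (simp add: bracket_derivation [of "bracket (\<pi> u) (\<pi> v)"] bracket_add)
  qed
  show "triple x y z + triple y z x + triple z x y = 0" for x y z
    by (rule lincomb1 [OF _ jacobi [of "\<pi> x" "\<pi> y" "\<pi> z", symmetric]])
      (simp add: triple_def bracket_anti [of "bracket (\<pi> x) (\<pi> y)"] bracket_anti [of "bracket (\<pi> y) (\<pi> z)"]
        bracket_anti [of "bracket (\<pi> z) (\<pi> x)"] algebra_simps)
  show "x + x = 0 \<Longrightarrow> x = 0" "x + x + x = 0 \<Longrightarrow> x = 0" for x :: 'a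
    by (fact torsion2, fact torsion3)
  show "triple x y z = - triple y x z" for x y z
    by (simp add: triple_def bracket_anti [of "\<pi> x" "\<pi> y"])
qed (simp_all add: prod_def triple_def pi_add tau_add bracket_add)

section \<open>Ideals built from subspaces of the odd part\<close>

lemma odd_subspace: "subspace {x. \<sigma> x = - x}"
  by (rule subspaceI) (simp_all add: sigma_add)

lemma even_subspace: "subspace {x. \<sigma> x = x}"
  by (rule subspaceI) (simp_all add: sigma_add)

lemma subspace_third: "subspace I \<Longrightarrow> x + x + x \<in> I \<Longrightarrow> x \<in> I"
proof -
  assume I: "subspace I" "x + x + x \<in> I"
  have "x + x + x = 3 \<cdot> x"
    using scale_left_distrib [of "1 + 1" 1 x] scale_left_distrib [of 1 1 x] by simp
  with subspace_scale [OF I, of "1 / 3"] show ?thesis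
    using three by simp
qed

lemma subspace_half: "subspace I \<Longrightarrow> x + x \<in> I \<Longrightarrow> x \<in> I"
  using subspace_scale [of I "x + x" "1 / 2"] half [of x] by simp

lemma ideal_cases: "lie_ideal I \<Longrightarrow> I = {0} \<or> I = UNIV"
  using simple unfolding lie_simple_def by blast

lemma lie_idealI: "subspace I \<Longrightarrow> (\<And>x y. y \<in> I \<Longrightarrow> bracket x y \<in> I) \<Longrightarrow> lie_ideal I"
  by (simp add: lie_ideal_def)

lemma exists_odd: "\<exists>x. \<sigma> x = - x \<and> x \<noteq> 0"
proof (rule ccontr)
  assume none: "\<nexists>x. \<sigma> x = - x \<and> x \<noteq> 0"
  have sigma: "\<sigma> x = x" for x
    using none sigma_minus_pi [of x] pi_odd [of x] by (metis diff_zero)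
  then have "\<rho> x = \<rho> (\<rho> x)" for x
    using sigma_rho [of x] by simp
  then have "\<rho> x = x" for x
    by (metis rho_rho_rho)
  with sigma nontrivial show False
    by (auto simp: fun_eq_iff)
qed

lemma ideal_even:
  assumes I: "lie_ideal I" and even: "\<And>x. x \<in> I \<Longrightarrow> \<sigma> x = x"
  shows "I = {0}"
proof -
  obtain x where "\<sigma> x = - x" "x \<noteq> 0"
    using exists_odd by auto
  then have "x \<notin> I"
    using even [of x] even_odd_zero [of x] by auto
  then show ?thesis
    using ideal_cases [OF I] by auto
qed

text \<open>The even elements that annihilate \<open>C\<close> form an ideal, as brackets with odd
  elements vanish on them. An ideal of even elements is zero because \<open>C\<close> is
  not.\<close>

lemma even_faithful:
  assumes "\<sigma> b = b" and "\<And>c. \<sigma> c = - c \<Longrightarrow> bracket b c = 0"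
  shows "b = 0"
proof -
  define I where "I = {b. \<sigma> b = b \<and> (\<forall>c. \<sigma> c = - c \<longrightarrow> bracket b c = 0)}"
  have "lie_ideal I"
  proof (rule lie_idealI)
    show "subspace I"
      by (rule subspaceI) (auto simp: I_def sigma_add bracket_add)
    show "bracket x y \<in> I" if y: "y \<in> I" for x y
    proof -
      define b where "b = x - \<pi> x"
      have b: "\<sigma> b = b"
        by (simp only: b_def sigma_minus_pi)
      have "bracket (\<pi> x) y = 0"
        using y pi_odd [of x] by (auto simp: I_def bracket_anti [of "\<pi> x"])
      then have eq: "bracket x y = bracket b y"
        by (simp add: b_def)
      have "bracket (bracket b y) c = 0" if c: "\<sigma> c = - c" for c
        using y c b bracket_derivation [of b y c] by (simp add: I_def)
      then show ?thesis
        using y b by (simp add: eq I_def)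
    qed
  qed
  then have "I = {0}"
    by (rule ideal_even) (simp add: I_def)
  then show ?thesis
    using assms by (auto simp: I_def)
qed

lemma three_triple: "\<sigma> x = - x \<Longrightarrow> \<sigma> y = - y \<Longrightarrow> \<sigma> z = - z \<Longrightarrow>
   bracket (bracket x y) z + bracket (bracket x y) z + bracket (bracket x y) z
    = x \<star> (y \<star> z) - y \<star> (x \<star> z) + (x \<star> y) \<star> z + (x \<star> y) \<star> z"
  using m_m [of x y z] by (simp add: triple_of_odd algebra_simps)

text \<open>The critical point is that \<open>[C, [I, C]]\<close> lies in \<open>I\<close>. Three
  times a double bracket is a combination of products, and products with an element of
  \<open>I\<close> stay in \<open>I\<close> since \<open>\<tau>\<close> maps odd elements to even
  ones.\<close>

lemma odd_module_ideal:
  assumes I: "subspace I" and odd: "\<And>i. i \<in> I \<Longrightarrow> \<sigma> i = - i"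
    and mod: "\<And>b i. \<sigma> b = b \<Longrightarrow> i \<in> I \<Longrightarrow> bracket b i \<in> I"
  defines "W \<equiv> {bracket i c | i c. i \<in> I \<and> \<sigma> c = - c}"
  shows "lie_ideal {i + w | i w. i \<in> I \<and> w \<in> span W}"
proof (rule lie_idealI)
  show "subspace {i + w | i w. i \<in> I \<and> w \<in> span W}"
    by (rule subspace_sums [OF I subspace_span])
  have left: "c \<star> i \<in> I" "i \<star> c \<in> I" if "i \<in> I" for i c
  proof -
    show "c \<star> i \<in> I"
      using mod [OF tau_even [OF pi_odd] that] pi_of_odd [OF odd [OF that]] by (simp add: prod_def)
    then show "i \<star> c \<in> I"
      using subspace_neg [OF I, of "c \<star> i"] m_anti [of i c] by simp
  qed
  have WI: "bracket c w \<in> I" if c: "\<sigma> c = - c" and "w \<in> span W" for c w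
    using that(2)
  proof (induction rule: span_induct_alt)
    case base
    show ?case
      using subspace_0 [OF I] by simp
  next
    case (step k x y)
    from step(1) obtain i c' where x: "x = bracket i c'" "i \<in> I" "\<sigma> c' = - c'"
      by (auto simp: W_def)
    have "i \<star> (c' \<star> c) - c' \<star> (i \<star> c) + (i \<star> c') \<star> c + (i \<star> c') \<star> c \<in> I"
      by (intro subspace_add [OF I] subspace_diff [OF I] left x(2))
    then have "bracket (bracket i c') c \<in> I"
      unfolding three_triple [OF odd [OF x(2)] x(3) c, symmetric] by (rule subspace_third [OF I])
    then have "bracket c x \<in> I"
      using subspace_neg [OF I] bracket_anti [of c x] by (simp add: x(1))
    then show ?case
      using step(2) by (simp add: bracket_add subspace_add [OF I] subspace_scale [OF I])
  qed
  have WW: "bracket b w \<in> span W" if b: "\<sigma> b = b" and "w \<in> span W" for b w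
    using that(2)
  proof (induction rule: span_induct_alt)
    case base
    show ?case
      by (simp add: span_zero)
  next
    case (step k x y)
    from step(1) obtain i c where x: "x = bracket i c" "i \<in> I" "\<sigma> c = - c"
      by (auto simp: W_def)
    have "\<sigma> (bracket b c) = - bracket b c"
      by (simp add: b x)
    then have "bracket (bracket b i) c \<in> W" "bracket i (bracket b c) \<in> W"
      using x mod [OF b x(2)] unfolding W_def by blast+
    then have "bracket (bracket b i) c \<in> span W" "bracket i (bracket b c) \<in> span W"
      by (simp_all add: span_base)
    then have "bracket b x \<in> span W"
      by (simp add: x bracket_derivation [of b] span_add)
    then show ?case
      using step(2) by (simp add: bracket_add span_add span_scale)
  qed
  show "bracket a y \<in> {i + w | i w. i \<in> I \<and> w \<in> span W}" if y: "y \<in> {i + w | i w. i \<in> I \<and> w \<in> span W}" for a y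
  proof -
    obtain i w where y: "y = i + w" "i \<in> I" "w \<in> span W"
      using y by auto
    let ?b = "a - \<pi> a"
    have "bracket i (\<pi> a) \<in> span W"
      using y pi_odd [of a] by (auto intro!: span_base simp: W_def)
    then have "bracket (\<pi> a) i \<in> span W"
      using span_neg bracket_anti [of "\<pi> a" i] by simp
    then have 1: "bracket (\<pi> a) i + bracket ?b w \<in> span W"
      using WW [OF sigma_minus_pi y(3)] by (rule span_add)
    have 2: "bracket ?b i + bracket (\<pi> a) w \<in> I"
      using mod [OF sigma_minus_pi y(2)] WI [OF pi_odd y(3)] by (rule subspace_add [OF I])
    have "bracket a y = (bracket ?b i + bracket (\<pi> a) w) + (bracket (\<pi> a) i + bracket ?b w)"
      by (simp add: y bracket_add algebra_simps)
    with 1 2 show ?thesis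
      by blast
  qed
qed

text \<open>\<open>C\<close> is an irreducible module over the even part: parity separates the two
  summands of the ideal \<open>K\<close>, so \<open>I\<close> can be read off from it.\<close>

lemma odd_module_cases:
  assumes I: "subspace I" and odd: "\<And>i. i \<in> I \<Longrightarrow> \<sigma> i = - i"
    and mod: "\<And>b i. \<sigma> b = b \<Longrightarrow> i \<in> I \<Longrightarrow> bracket b i \<in> I"
  shows "I = {0} \<or> I = {x. \<sigma> x = - x}"
proof -
  define W where "W = {bracket i c | i c. i \<in> I \<and> \<sigma> c = - c}"
  define K where "K = {i + w | i w. i \<in> I \<and> w \<in> span W}"
  have "W \<subseteq> {x. \<sigma> x = x}"
    by (auto simp: W_def odd)
  then have W: "\<sigma> w = w" if "w \<in> span W" for w
    using span_minimal [OF _ even_subspace, of W] that by blast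
  have "lie_ideal K"
    unfolding K_def W_def using assms by (rule odd_module_ideal)
  then show ?thesis
  proof (rule disjE [OF ideal_cases])
    assume "K = {0}"
    moreover have "i \<in> K" if "i \<in> I" for i
      unfolding K_def by (rule CollectI, rule exI [of _ i], rule exI [of _ 0]) (simp add: that span_zero)
    ultimately show ?thesis
      using subspace_0 [OF I] by auto
  next
    assume K: "K = UNIV"
    have "c \<in> I" if c: "\<sigma> c = - c" for c
    proof -
      from K obtain i w where cw: "c = i + w" "i \<in> I" "w \<in> span W"
        unfolding K_def by blast
      have "\<sigma> (c - i) = - (c - i)"
        by (simp add: c odd [OF cw(2)])
      then have "w = 0"
        using W [OF cw(3)] cw(1) by (intro even_odd_zero) auto
      with cw show ?thesis
        by simp
    qed
    with odd show ?thesis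
      by auto
  qed
qed

lemma even_span: "\<sigma> b = b \<Longrightarrow> b \<in> span {bracket x y | x y. \<sigma> x = - x \<and> \<sigma> y = - y}"
proof -
  assume b: "\<sigma> b = b"
  let ?O = "{x. \<sigma> x = - x}"
  define W where "W = {bracket x y | x y. x \<in> ?O \<and> \<sigma> y = - y}"
  define K where "K = {i + w | i w. i \<in> ?O \<and> w \<in> span W}"
  have "lie_ideal K"
    unfolding K_def W_def by (rule odd_module_ideal [OF odd_subspace]) auto
  moreover have "i \<in> K" if "i \<in> ?O" for i
    unfolding K_def by (rule CollectI, rule exI [of _ i], rule exI [of _ 0]) (use that in \<open>simp add: span_zero\<close>)
  moreover obtain x where "x \<in> ?O" "x \<noteq> 0"
    using exists_odd by blast
  ultimately have "K = UNIV"
    using ideal_cases [of K] by blast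
  then obtain i w where bw: "b = i + w" "\<sigma> i = - i" "w \<in> span W"
    unfolding K_def by blast
  have "W \<subseteq> {x. \<sigma> x = x}"
    by (auto simp: W_def)
  then have "\<sigma> w = w"
    using span_minimal [OF _ even_subspace, of W] bw(3) by blast
  then have "i = 0"
    using bw b by (intro even_odd_zero) (auto simp: sigma_add)
  with bw show ?thesis
    by (simp add: W_def)
qed

text \<open>Invariance under the even part thus splits into invariance under elements fixed by S_3,
  which act as derivations of \<open>\<star>\<close>, and under multiplications. The factors are
  \<open>h\<close>, the sum of the rotations of \<open>b\<close>, and
  \<open>c = \<rho> b - \<rho> (\<rho> b)\<close>.\<close>

lemma even_decompose:
  assumes b: "\<sigma> b = b"
  obtains h c where "\<rho> h = h" "\<sigma> h = h" "\<sigma> c = - c" "b + b + b = h - \<tau> c"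
proof
  show "\<rho> (b + \<rho> b + \<rho> (\<rho> b)) = b + \<rho> b + \<rho> (\<rho> b)"
    by (simp add: rho_add algebra_simps)
  show "\<sigma> (b + \<rho> b + \<rho> (\<rho> b)) = b + \<rho> b + \<rho> (\<rho> b)" "\<sigma> (\<rho> b - \<rho> (\<rho> b)) = - (\<rho> b - \<rho> (\<rho> b))"
    by (simp_all add: sigma_add sigma_rho b algebra_simps)
  show "b + b + b = b + \<rho> b + \<rho> (\<rho> b) - \<tau> (\<rho> b - \<rho> (\<rho> b))"
    by (simp add: \<tau>_def algebra_simps)
qed

lemma invariant_subspace_cases:
  assumes I: "subspace I" and odd: "\<And>i. i \<in> I \<Longrightarrow> \<sigma> i = - i"
    and mod: "\<And>h i. \<rho> h = h \<Longrightarrow> \<sigma> h = h \<Longrightarrow> i \<in> I \<Longrightarrow> bracket h i \<in> I"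
    and mult: "\<And>c i. i \<in> I \<Longrightarrow> c \<star> i \<in> I"
  shows "I = {0} \<or> I = {x. \<sigma> x = - x}"
proof (rule odd_module_cases [OF I odd])
  show "bracket b i \<in> I" if b: "\<sigma> b = b" and i: "i \<in> I" for b i
  proof (rule even_decompose [OF b])
    fix h c
    assume h: "\<rho> h = h" "\<sigma> h = h" and c: "\<sigma> c = - c" and eq: "b + b + b = h - \<tau> c"
    have "bracket (b + b + b) i = bracket h i - c \<star> i"
      unfolding eq using c odd [OF i] by (simp add: prod_of_odd)
    then have "bracket b i + bracket b i + bracket b i \<in> I"
      using subspace_diff [OF I mod [OF h i] mult [OF i]] by (simp add: bracket_add)
    then show ?thesis
      by (rule subspace_third [OF I])
  qed
qed

section \<open>Perfectness and nondegeneracy from simplicity\<close>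

lemma prod_scale: "(c \<cdot> x) \<star> y = c \<cdot> (x \<star> y)" "x \<star> (c \<cdot> y) = c \<cdot> (x \<star> y)"
  by (simp_all add: prod_def pi_scale)

lemma triple_scale: "triple (c \<cdot> x) y z = c \<cdot> triple x y z" "triple x (c \<cdot> y) z = c \<cdot> triple x y z"
  "triple x y (c \<cdot> z) = c \<cdot> triple x y z"
  by (simp_all add: triple_def pi_scale)

lemma d_scale: "d (c \<cdot> x) y z = c \<cdot> d x y z" "d x (c \<cdot> y) z = c \<cdot> d x y z" "d x y (c \<cdot> z) = c \<cdot> d x y z"
  by (simp_all add: d_def prod_scale triple_scale scale_right_diff_distrib)

lemma d_pi [simp]: "\<pi> (d x y z) = d x y z" "d (\<pi> x) y z = d x y z" "d x (\<pi> y) z = d x y z" "d x y (\<pi> z) = d x y z"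
  using pi_of_odd [of "d x y z"] by (simp_all add: d_def prod_odd pi_odd' pi_odd triple_def)

lemma d_odd: "\<sigma> (d x y z) = - d x y z"
  using pi_odd [of "d x y z"] by simp

lemma invariant_derivation_d:
  assumes h: "\<rho> h = h" "\<sigma> h = h"
  shows "bracket h (d x y z) = d (bracket h (\<pi> x)) y z + d x (bracket h (\<pi> y)) z + d x y (bracket h (\<pi> z))"
proof -
  have "\<pi> (bracket h (\<pi> u)) = bracket h (\<pi> u)" for u
    by (simp add: pi_odd' pi_odd h)
  then have "bracket h (triple x y z) = triple (bracket h (\<pi> x)) y z + triple x (bracket h (\<pi> y)) z + triple x y (bracket h (\<pi> z))"
    by (simp add: triple_def bracket_derivation [of h] bracket_add)
  moreover have "bracket h ((x \<star> y) \<star> z) = (bracket h (\<pi> x) \<star> y) \<star> z + (x \<star> bracket h (\<pi> y)) \<star> z + (x \<star> y) \<star> bracket h (\<pi> z)"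
    using invariant_derivation [OF h, of "x \<star> y" z] invariant_derivation [OF h, of x y] by (simp add: m_add_left)
  ultimately show ?thesis
    by (simp add: d_def algebra_simps)
qed

text \<open>If the product vanished, so would double brackets of odd elements, and by faithfulness
  \<open>[C, C]\<close>. Then \<open>C\<close> would be an ideal, hence all of \<open>A\<close>, and
  \<open>A\<close> abelian.\<close>

lemma prod_nonzero: "\<exists>x y. x \<star> y \<noteq> 0"
proof (rule ccontr)
  assume "\<nexists>x y. x \<star> y \<noteq> 0"
  then have 0: "x \<star> y = 0" for x y
    by blast
  have br: "bracket x y = 0" if "\<sigma> x = - x" "\<sigma> y = - y" for x y
  proof (rule even_faithful)
    show "bracket (bracket x y) c = 0" if "\<sigma> c = - c" for c
      by (rule torsion3) (simp only: three_triple [OF \<open>\<sigma> x = - x\<close> \<open>\<sigma> y = - y\<close> that] 0 add_0 diff_0 minus_zero)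
  qed (simp add: that)
  have "lie_ideal {x. \<sigma> x = - x}"
  proof (rule lie_idealI)
    show "bracket a y \<in> {x. \<sigma> x = - x}" if "y \<in> {x. \<sigma> x = - x}" for a y
    proof -
      define b where "b = a - \<pi> a"
      have b: "\<sigma> b = b"
        by (simp only: b_def sigma_minus_pi)
      have "bracket a y = bracket b y"
        using br [OF pi_odd [of a], of y] that by (simp add: b_def)
      then show ?thesis
        using that by (simp add: b)
    qed
  qed (rule odd_subspace)
  then have "{x. \<sigma> x = - x} = {0} \<or> {x. \<sigma> x = - x} = UNIV"
    by (rule ideal_cases)
  then have "\<sigma> x = - x" for x
    using exists_odd by blast
  then have "bracket x y = 0" for x y
    by (intro br)
  then show False
    using simple by (simp add: lie_simple_def)
qed

lemma span_prod: "\<sigma> x = - x \<Longrightarrow> x \<in> span {x \<star> y | x y. True}"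
proof -
  let ?P = "{x \<star> y | x y. True}"
  have "span ?P = {0} \<or> span ?P = {x. \<sigma> x = - x}"
  proof (rule invariant_subspace_cases)
    have "?P \<subseteq> {x. \<sigma> x = - x}"
      by (auto simp: prod_odd)
    then show odd: "\<sigma> i = - i" if "i \<in> span ?P" for i
      using span_minimal [OF _ odd_subspace] that by blast
    show "c \<star> i \<in> span ?P" for c i
      by (rule span_base) auto
    show "bracket h i \<in> span ?P" if h: "\<rho> h = h" "\<sigma> h = h" and "i \<in> span ?P" for h i
      using that(3)
    proof (induction rule: span_induct_alt)
      case (step k x y)
      then obtain u v where "x = u \<star> v"
        by auto
      have "bracket h (\<pi> u) \<star> v \<in> span ?P" "u \<star> bracket h (\<pi> v) \<in> span ?P"
        by (rule span_base, blast)+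
      then have "bracket h x \<in> span ?P"
        unfolding \<open>x = u \<star> v\<close> invariant_derivation [OF h] by (rule span_add)
      then show ?case
        using step by (simp add: bracket_add span_add span_scale)
    qed (simp add: span_zero)
  qed (rule subspace_span)
  moreover obtain u v where "u \<star> v \<noteq> 0"
    using prod_nonzero by blast
  then have "span ?P \<noteq> {0}"
    using span_base [of "u \<star> v" ?P] by blast
  ultimately show "\<sigma> x = - x \<Longrightarrow> x \<in> span ?P"
    by blast
qed

text \<open>If \<open>d\<close> vanishes, multiplications are derivations too, so the whole even
  part acts on \<open>C\<close> by derivations and commutes with \<open>\<tau>\<close>. The algebra
  then resembles \<open>L + L\<close> with \<open>\<sigma>\<close> exchanging the summands, odd
  elements \<open>(u, -u)\<close> and \<open>\<tau>\<close> sending these to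
  \<open>(u, u)\<close>.\<close>

lemma d_nonzero: "\<exists>x y z. d x y z \<noteq> 0"
proof (rule ccontr)
  assume "\<nexists>x y z. d x y z \<noteq> 0"
  then have 0: "d x y z = 0" for x y z
    by blast
  have der: "x \<star> (y \<star> z) = (x \<star> y) \<star> z + y \<star> (x \<star> z)" for x y z
    using commutator_d [of x y z] by (simp add: 0 algebra_simps)
  have br: "bracket x y = \<tau> (x \<star> y)" if x: "\<sigma> x = - x" and y: "\<sigma> y = - y" for x y
  proof -
    have "bracket x y - \<tau> (x \<star> y) = 0"
    proof (rule even_faithful)
      show "bracket (bracket x y - \<tau> (x \<star> y)) c = 0" if c: "\<sigma> c = - c" for c
        using 0 [of x y c] by (simp add: d_def triple_of_odd x y c prod_of_odd [OF prod_odd c])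
      show "\<sigma> (bracket x y - \<tau> (x \<star> y)) = bracket x y - \<tau> (x \<star> y)"
        by (simp add: x y tau_even [OF prod_odd])
    qed
    then show ?thesis
      by simp
  qed
  have evder: "bracket b (x \<star> z) = bracket b x \<star> z + x \<star> bracket b z"
    if b: "\<sigma> b = b" and x: "\<sigma> x = - x" and z: "\<sigma> z = - z" for b x z
  proof (rule even_decompose [OF b])
    fix h c
    assume h: "\<rho> h = h" "\<sigma> h = h" and c: "\<sigma> c = - c" and eq: "b + b + b = h - \<tau> c"
    have 1: "bracket b u + bracket b u + bracket b u = bracket h u - c \<star> u" if u: "\<sigma> u = - u" for u
    proof -
      have "bracket b u + bracket b u + bracket b u = bracket (b + b + b) u"
        by (simp add: bracket_add)
      then show ?thesis
        by (simp add: eq prod_of_odd c u)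
    qed
    have hd: "bracket h (x \<star> z) = bracket h x \<star> z + x \<star> bracket h z"
      using invariant_derivation [OF h, of x z] by (simp add: pi_of_odd x z)
    have 2: "bracket b x \<star> z + bracket b x \<star> z + bracket b x \<star> z = bracket h x \<star> z - (c \<star> x) \<star> z"
      using arg_cong [OF 1 [OF x], of "\<lambda>u. u \<star> z"] by (simp add: add_simps)
    have 3: "x \<star> bracket b z + x \<star> bracket b z + x \<star> bracket b z = x \<star> bracket h z - x \<star> (c \<star> z)"
      using arg_cong [OF 1 [OF z], of "\<lambda>u. x \<star> u"] by (simp add: add_simps)
    show ?thesis
      by (rule cancel3, rule lincomb3 [OF _ 1 [OF prod_odd [of x z]] 2 [symmetric] 3 [symmetric]])
        (simp add: hd der [of c x z] algebra_simps)
  qed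
  have tau: "bracket b (\<tau> x) = \<tau> (bracket b x)" if b: "\<sigma> b = b" and x: "\<sigma> x = - x" for b x
  proof -
    have bx: "\<sigma> (bracket b x) = - bracket b x"
      by (simp add: b x)
    have "bracket b (\<tau> x) - \<tau> (bracket b x) = 0"
    proof (rule even_faithful)
      show "bracket (bracket b (\<tau> x) - \<tau> (bracket b x)) c = 0" if c: "\<sigma> c = - c" for c
      proof -
        have bc: "\<sigma> (bracket b c) = - bracket b c"
          by (simp add: b c)
        show ?thesis
          using bracket_derivation [of b "\<tau> x" c] evder [OF b x c]
          by (simp add: prod_of_odd [OF x c] prod_of_odd [OF x bc] prod_of_odd [OF bx c] algebra_simps)
      qed
      show "\<sigma> (bracket b (\<tau> x) - \<tau> (bracket b x)) = bracket b (\<tau> x) - \<tau> (bracket b x)"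
        by (simp add: b tau_even [OF x] tau_even [OF bx])
    qed
    then show ?thesis
      by simp
  qed
  \<comment> \<open>The counterpart of one summand \<open>L\<close>. Comparing parities shows that
    it is neither zero nor everything.\<close>
  define I where "I = {\<tau> x + x | x. \<sigma> x = - x}"
  have "lie_ideal I"
  proof (rule lie_idealI)
    show "subspace I"
    proof (rule subspaceI)
      show "0 \<in> I"
        unfolding I_def by (rule CollectI, rule exI [of _ 0]) simp
      show "x + y \<in> I" if xy: "x \<in> I" "y \<in> I" for x y
      proof -
        obtain u v where "x = \<tau> u + u" "\<sigma> u = - u" "y = \<tau> v + v" "\<sigma> v = - v"
          using xy unfolding I_def by blast
        then show ?thesis
          unfolding I_def by (intro CollectI exI [of _ "u + v"]) (simp add: tau_add sigma_add)
      qed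
      show "c \<cdot> x \<in> I" if x: "x \<in> I" for c x
      proof -
        obtain u where "x = \<tau> u + u" "\<sigma> u = - u"
          using x unfolding I_def by blast
        then show ?thesis
          unfolding I_def by (intro CollectI exI [of _ "c \<cdot> u"]) (simp add: scale_right_distrib)
      qed
    qed
    show "bracket a y \<in> I" if y: "y \<in> I" for a y
    proof -
      obtain x where y: "y = \<tau> x + x" and x: "\<sigma> x = - x"
        using y unfolding I_def by blast
      define b where "b = a - \<pi> a"
      have b: "\<sigma> b = b"
        by (simp only: b_def sigma_minus_pi)
      have "bracket (\<pi> a) (\<tau> x) = \<pi> a \<star> x"
        by (simp add: bracket_anti [of "\<pi> a"] prod_of_odd [OF x pi_odd, symmetric] m_anti [of a x])
      then have "bracket a y = \<tau> (bracket b x + \<pi> a \<star> x) + (bracket b x + \<pi> a \<star> x)"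
        using br [OF pi_odd [of a] x] tau [OF b x] by (simp add: y b_def bracket_add tau_add algebra_simps)
      moreover have "\<sigma> (bracket b x + \<pi> a \<star> x) = - (bracket b x + \<pi> a \<star> x)"
        by (simp add: sigma_add b x prod_odd del: pi_prod)
      ultimately show ?thesis
        unfolding I_def by blast
    qed
  qed
  obtain x where x: "\<sigma> x = - x" "x \<noteq> 0"
    using exists_odd by blast
  from ideal_cases [OF \<open>lie_ideal I\<close>] show False
  proof
    assume "I = {0}"
    then have "\<tau> x + x = 0"
      using x unfolding I_def by blast
    then have "x = - \<tau> x"
      by (simp add: eq_neg_iff_add_eq_0 add.commute)
    then have "\<sigma> x = x"
      using tau_even [OF x(1)] by (metis sigma_simps(2))
    then show False
      using x even_odd_zero [of x] by simp
  next
    assume "I = UNIV"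
    then obtain y where y: "x = \<tau> y + y" "\<sigma> y = - y"
      unfolding I_def by blast
    have "\<sigma> (x - y) = - (x - y)"
      by (simp only: sigma_simps x y(2)) simp
    moreover have "x - y = \<tau> y"
      by (simp add: y(1))
    ultimately have "\<tau> y = 0"
      using tau_even [OF y(2)] by (intro even_odd_zero) (simp_all only:)
    then have "\<rho> y = \<rho> (\<rho> y)"
      by (simp add: \<tau>_def)
    then have "\<rho> y = y"
      by (metis rho_rho_rho)
    then have "y + y + y = 0"
      using odd_sum [OF y(2)] by (simp add: algebra_simps)
    then have "y = 0"
      by (rule torsion3)
    then show False
      using y x by simp
  qed
qed

text \<open>The common kernel is invariant: for multiplications, \<open>sagle\<close> first gives
  \<open>i \<star> d p q x = 0\<close> and then \<open>d (c \<star> i) p q = 0\<close>. It is not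
  \<open>C\<close> by \<open>d_nonzero\<close>.\<close>

lemma d_left_zero: "(\<And>x y. d x y u = 0) \<Longrightarrow> \<pi> u = 0"
proof -
  assume u: "\<And>x y. d x y u = 0"
  define N where "N = {u. \<sigma> u = - u \<and> (\<forall>x y. d x y u = 0)}"
  have "N = {0} \<or> N = {x. \<sigma> x = - x}"
  proof (rule invariant_subspace_cases)
    show "subspace N"
      by (rule subspaceI) (auto simp: N_def sigma_add lin d_scale)
    show "\<sigma> i = - i" if "i \<in> N" for i
      using that by (simp add: N_def)
    show "bracket h i \<in> N" if h: "\<rho> h = h" "\<sigma> h = h" and i: "i \<in> N" for h i
    proof -
      have "d x y (bracket h i) = 0" for x y
        using invariant_derivation_d [OF h, of x y i] i by (simp add: N_def pi_of_odd)
      then show ?thesis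
        using i h by (simp add: N_def)
    qed
    show "c \<star> i \<in> N" if i: "i \<in> N" for c i
    proof -
      have z: "d x y i = 0" "d i x y = 0" "d x i y = 0" for x y
        using i d_cycle [of x y i] d_swap23 [of x i y] by (auto simp: N_def)
      have 1: "i \<star> d p q x = 0" for p q x
        using sagle [of p q x i] by (intro eq_self_neg) (simp add: z algebra_simps)
      have "d (c \<star> i) p q = 0" for p q
        by (rule torsion3) (simp add: sagle z 1)
      then have "d p q (c \<star> i) = 0" for p q
        using d_cycle [of p q "c \<star> i"] by simp
      then show ?thesis
        by (simp add: N_def prod_odd)
    qed
  qed
  moreover have "N \<noteq> {x. \<sigma> x = - x}"
  proof
    assume N: "N = {x. \<sigma> x = - x}"
    have "d x y z = 0" for x y z
    proof -
      have "\<pi> z \<in> N"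
        by (simp add: N pi_odd)
      then have "d x y (\<pi> z) = 0"
        by (simp add: N_def del: d_pi)
      then show ?thesis
        by simp
    qed
    then show False
      using d_nonzero by blast
  qed
  moreover have "\<pi> u \<in> N"
    using u by (simp add: N_def pi_odd)
  ultimately show "\<pi> u = 0"
    by blast
qed

lemma span_d: "\<sigma> x = - x \<Longrightarrow> x \<in> span {d x y z | x y z. True}"
proof -
  let ?D = "{d x y z | x y z. True}"
  have D: "d x y z \<in> span ?D" for x y z
    by (rule span_base) blast
  have "span ?D = {0} \<or> span ?D = {x. \<sigma> x = - x}"
  proof (rule invariant_subspace_cases)
    have "?D \<subseteq> {x. \<sigma> x = - x}"
      by (auto simp: d_odd)
    then show odd: "\<sigma> i = - i" if "i \<in> span ?D" for i
      using span_minimal [OF _ odd_subspace] that by blast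
    have sym: "z \<star> d x y w - w \<star> d x y z \<in> span ?D" for x y z w
      unfolding sagle_aux [symmetric] by (intro span_add D)
    have rev: "d x y z = - d z y x" for x y z
      by (simp add: d_swap12 [of x y] d_cycle [of y x z])
    \<comment> \<open>Modulo \<open>span ?D\<close> the element \<open>z \<star> d x y w\<close> is
      symmetric in \<open>z, w\<close> by \<open>sym\<close> and alternating in
      \<open>x, y, w\<close>; three exchanges then show that its double is zero there.\<close>
    have mult: "z \<star> d x y w \<in> span ?D" for x y z w
    proof (rule subspace_half [OF subspace_span])
      have "z \<star> d x y w + z \<star> d x y w
          = (z \<star> d x y w - w \<star> d x y z) - (w \<star> d z y x - x \<star> d z y w) + (x \<star> d w y z - z \<star> d w y x)"
        by (simp add: rev [of z y x] rev [of w y z] rev [of w y x])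
      then show "z \<star> d x y w + z \<star> d x y w \<in> span ?D"
        by (simp only:) (intro span_add span_diff sym)
    qed
    show "c \<star> i \<in> span ?D" if "i \<in> span ?D" for c i
      using that
    proof (induction rule: span_induct_alt)
      case (step k x y)
      then have "c \<star> x \<in> span ?D"
        using mult by auto
      then show ?case
        using step by (simp add: add_simps prod_scale span_add span_scale)
    qed (simp add: span_zero)
    show "bracket h i \<in> span ?D" if h: "\<rho> h = h" "\<sigma> h = h" and "i \<in> span ?D" for h i
      using that(3)
    proof (induction rule: span_induct_alt)
      case (step k x y)
      then obtain u v w where "x = d u v w"
        by auto
      then have "bracket h x \<in> span ?D"
        by (simp only: invariant_derivation_d [OF h]) (intro span_add D)
      then show ?case
        using step by (simp add: bracket_add span_add span_scale)
    qed (simp add: span_zero)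
  qed (rule subspace_span)
  moreover obtain u v w where "d u v w \<noteq> 0"
    using d_nonzero by blast
  then have "span ?D \<noteq> {0}"
    using D [of u v w] by blast
  ultimately show "\<sigma> x = - x \<Longrightarrow> x \<in> span ?D"
    by blast
qed

sublocale perfect_malcev_triple prod triple \<pi>
proof unfold_locales
  fix S :: "'a set" and x
  assume S: "0 \<in> S" "\<And>x y. x \<in> S \<Longrightarrow> y \<in> S \<Longrightarrow> x + y \<in> S"
  show "\<pi> x \<in> S" if prod: "\<And>x y. x \<star> y \<in> S"
    using span_prod [OF pi_odd [of x]]
  proof (induction rule: span_induct_alt)
    case (step c x y)
    then obtain u v where "x = u \<star> v"
      by auto
    then have "c \<cdot> x \<in> S"
      using prod [of "c \<cdot> u" v] by (simp add: prod_scale)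
    then show ?case
      using step by (intro S)
  qed (rule S)
  show "\<pi> x \<in> S" if dS: "\<And>x y z. d x y z \<in> S"
    using span_d [OF pi_odd [of x]]
  proof (induction rule: span_induct_alt)
    case (step c x y)
    then obtain u v w where "x = d u v w"
      by auto
    then have "c \<cdot> x \<in> S"
      using dS [of "c \<cdot> u" v w] by (simp add: d_scale)
    then show ?case
      using step by (intro S)
  qed (rule S)
qed (simp_all add: pi_add d_left_zero)

end

section \<open>The invariant form\<close>

locale central_triality = simple_triality scale bracket \<sigma> \<rho>
  for scale :: "'k::field \<Rightarrow> 'a::ab_group_add \<Rightarrow> 'a" (infixr \<open>\<cdot>\<close> 75)
    and bracket :: "'a \<Rightarrow> 'a \<Rightarrow> 'a" and \<sigma> \<rho> :: "'a \<Rightarrow> 'a" +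
  assumes central: "centroid \<subseteq> range scale"
begin

text \<open>\<open>three_triple\<close> writes double brackets as products, so \<open>T\<close>
  respects them and with them the action of the even part. An even \<open>b\<close> is sent to the
  even \<open>b'\<close> that acts on \<open>C\<close> as \<open>T\<close> after \<open>b\<close>,
  unique by faithfulness; together with \<open>T\<close> this is an element of the centroid.\<close>

lemma odd_endomorphism_scalar:
  assumes T_add: "\<And>u v. T (u + v) = T u + T v" and T_scale: "\<And>c u. T (c \<cdot> u) = c \<cdot> T u"
    and T_prod: "\<And>w u. T (w \<star> u) = w \<star> T u" and T_odd: "\<And>u. \<sigma> (T u) = - T u"
  shows "\<exists>k. \<forall>u. \<sigma> u = - u \<longrightarrow> T u = k \<cdot> u"
proof -
  have T_diff: "T (u - v) = T u - T v" and T_minus: "T (- u) = - T u" for u v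
    using additive_minus [of T] T_add by auto
  have T_prod': "T u \<star> w = T (u \<star> w)" for u w
    by (simp add: m_anti [of _ w] T_prod T_minus)
  have T_triple: "T (bracket (bracket x y) z) = bracket (bracket (T x) y) z"
    "T (bracket (bracket x y) z) = bracket (bracket x y) (T z)"
    if "\<sigma> x = - x" "\<sigma> y = - y" "\<sigma> z = - z" for x y z
  proof -
    have 1: "T (bracket (bracket x y) z) + T (bracket (bracket x y) z) + T (bracket (bracket x y) z)
        = T (x \<star> (y \<star> z)) - T (y \<star> (x \<star> z)) + T ((x \<star> y) \<star> z) + T ((x \<star> y) \<star> z)"
      unfolding T_add [symmetric] T_diff [symmetric] three_triple [OF that] ..
    show "T (bracket (bracket x y) z) = bracket (bracket (T x) y) z"
      by (rule cancel3) (simp only: 1 three_triple [OF T_odd that(2,3)] T_prod' T_prod [symmetric])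
    show "T (bracket (bracket x y) z) = bracket (bracket x y) (T z)"
      by (rule cancel3) (simp only: 1 three_triple [OF that(1,2) T_odd] T_prod)
  qed
  have T_even: "T (bracket b c) = bracket b (T c)" if b: "\<sigma> b = b" and c: "\<sigma> c = - c" for b c
    using even_span [OF b]
  proof (induction rule: span_induct_alt)
    case base
    show ?case
      using T_diff [of 0 0] by simp
  next
    case (step k x y)
    then obtain u v where "x = bracket u v" "\<sigma> u = - u" "\<sigma> v = - v"
      by auto
    then have "T (bracket x c) = bracket x (T c)"
      using T_triple(2) [of u v c] c by simp
    then show ?case
      using step by (simp add: bracket_add T_add T_scale)
  qed
  define R where "R b b' \<longleftrightarrow> \<sigma> b' = b' \<and> (\<forall>c. \<sigma> c = - c \<longrightarrow> bracket b' c = T (bracket b c))" for b b'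
  have R_ex: "\<exists>b'. R b b'" if b: "\<sigma> b = b" for b
    using even_span [OF b]
  proof (induction rule: span_induct_alt)
    case base
    show ?case
      using T_diff [of 0 0] by (intro exI [of _ 0]) (simp add: R_def)
  next
    case (step k x y)
    then obtain u v where uv: "x = bracket u v" "\<sigma> u = - u" "\<sigma> v = - v"
      by auto
    then have "R x (bracket (T u) v)"
      using T_triple(1) [of u v] by (simp add: R_def T_odd)
    moreover obtain y' where "R y y'"
      using step by blast
    ultimately have "R (k \<cdot> x + y) (k \<cdot> bracket (T u) v + y')"
      by (simp add: R_def sigma_add bracket_add T_add T_scale)
    then show ?case
      by blast
  qed
  have R_unique: "b' = b''" if R: "R b b'" "R b b''" for b b' b''
  proof -
    have "b' - b'' = 0"
    proof (rule even_faithful)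
      show "bracket (b' - b'') c = 0" if "\<sigma> c = - c" for c
        using R that unfolding R_def bracket_simps by auto
    qed (use R in \<open>simp add: R_def\<close>)
    then show ?thesis
      by simp
  qed
  define E where "E b = (THE b'. R b b')" for b
  have E_eq: "E b = b'" if "R b b'" for b b'
    unfolding E_def by (rule the_equality, rule that) (rule R_unique [OF _ that])
  have E: "R b (E b)" if "\<sigma> b = b" for b
    using R_ex [OF that] E_eq by auto
  define C where "C a = T (\<pi> a) + E (a - \<pi> a)" for a
  have even: "\<sigma> (a - \<pi> a) = a - \<pi> a" for a
    by (rule sigma_minus_pi)
  have C_add: "C (a + a') = C a + C a'" for a a'
  proof -
    have "R (a + a' - \<pi> (a + a')) (E (a - \<pi> a) + E (a' - \<pi> a'))"
      using E [OF even [of a]] E [OF even [of a']]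
      by (simp add: R_def sigma_add bracket_add pi_add T_add T_diff algebra_simps)
    from E_eq [OF this] show ?thesis
      by (simp add: C_def pi_add T_add algebra_simps)
  qed
  have C_scale: "C (k \<cdot> a) = k \<cdot> C a" for k a
  proof -
    have "R (k \<cdot> a - \<pi> (k \<cdot> a)) (k \<cdot> E (a - \<pi> a))"
      using E [OF even [of a]]
      by (simp add: R_def pi_scale T_scale scale_right_diff_distrib [symmetric] bracket_simps(7)
          del: bracket_simps(5))
    from E_eq [OF this] show ?thesis
      by (simp add: C_def pi_scale T_scale scale_right_distrib)
  qed
  have C_odd: "C c = T c" if c: "\<sigma> c = - c" for c
    using E_eq [of 0 0] T_diff [of 0 0] c by (simp add: C_def pi_of_odd R_def)
  have C_even: "R b (C b)" if b: "\<sigma> b = b" for b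
    using E [OF b] T_diff [of 0 0] b by (simp add: C_def pi_of_even)
  have C_bracket: "C (bracket u v) = bracket (C u) v" for u v
  proof -
    have ee: "C (bracket b b') = bracket (C b) b'" if b: "\<sigma> b = b" "\<sigma> b' = b'" for b b'
    proof -
      have bb: "\<sigma> (bracket b b') = bracket b b'"
        by (simp add: b)
      have "R (bracket b b') (bracket (C b) b')"
        unfolding R_def
      proof (intro conjI allI impI)
        show "\<sigma> (bracket (C b) b') = bracket (C b) b'"
          using C_even [OF b(1)] b by (simp add: R_def)
        fix c assume c: "\<sigma> c = - c"
        have o: "\<sigma> (bracket b c) = - bracket b c" "\<sigma> (bracket b' c) = - bracket b' c"
          by (simp_all add: b c)
        have "bracket (bracket (C b) b') c = bracket (C b) (bracket b' c) - bracket b' (bracket (C b) c)"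
          by (simp add: bracket_derivation [of "C b" b' c])
        also have "\<dots> = T (bracket b (bracket b' c)) - bracket b' (T (bracket b c))"
          using C_even [OF b(1)] o c by (simp add: R_def)
        also have "\<dots> = T (bracket b (bracket b' c) - bracket b' (bracket b c))"
          using T_even [OF b(2) o(1)] by (simp add: T_diff)
        also have "\<dots> = T (bracket (bracket b b') c)"
          by (simp add: bracket_derivation [of b b' c])
        finally show "bracket (bracket (C b) b') c = T (bracket (bracket b b') c)" .
      qed
      from R_unique [OF C_even [OF bb] this] show ?thesis .
    qed
    have eo: "C (bracket b c) = bracket (C b) c" if b: "\<sigma> b = b" and c: "\<sigma> c = - c" for b c
      using C_even [OF b] C_odd [of "bracket b c"] b c by (simp add: R_def)
    have oe: "C (bracket c b) = bracket (C c) b" if b: "\<sigma> b = b" and c: "\<sigma> c = - c" for b c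
      using C_odd [of "bracket c b"] C_odd [OF c] T_even [OF b c] b c
      by (simp add: bracket_anti [of _ b] T_minus)
    have oo: "C (bracket c c') = bracket (C c) c'" if c: "\<sigma> c = - c" "\<sigma> c' = - c'" for c c'
    proof -
      have R: "R (bracket c c') (bracket (T c) c')"
        using T_triple(1) [OF c] c by (simp add: R_def T_odd)
      have "\<sigma> (bracket c c') = bracket c c'"
        by (simp add: c)
      from R_unique [OF C_even [OF this] R] show ?thesis
        by (simp only: C_odd [OF c(1)])
    qed
    define b where "b = u - \<pi> u"
    define b' where "b' = v - \<pi> v"
    have u: "u = b + \<pi> u" and v: "v = b' + \<pi> v" and b: "\<sigma> b = b" "\<sigma> b' = b'"
      unfolding b_def b'_def sigma_minus_pi by simp_all
    have o: "\<sigma> (\<pi> u) = - \<pi> u" "\<sigma> (\<pi> v) = - \<pi> v"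
      by (rule pi_odd)+
    have "C (bracket (b + \<pi> u) (b' + \<pi> v)) = bracket (C (b + \<pi> u)) (b' + \<pi> v)"
      by (simp add: bracket_add C_add ee [OF b] eo [OF b(1) o(2)] oe [OF b(2) o(1)] oo [OF o])
    then show ?thesis
      using u v by simp
  qed
  have C_bracket': "C (bracket u v) = bracket u (C v)" for u v
  proof -
    have "C (- bracket v u) = - C (bracket v u)"
      using C_scale [of "- 1" "bracket v u"] by simp
    then show ?thesis
      by (simp add: bracket_anti [of u] C_bracket)
  qed
  have "Vector_Spaces.linear scale scale C"
    by unfold_locales (simp_all add: C_add C_scale)
  then have "C \<in> centroid"
    unfolding centroid_def using C_bracket C_bracket' by blast
  then obtain k where "C = scale k"
    using central by blast
  then show ?thesis
    using C_odd by (intro exI [of _ k]) auto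
qed

section \<open>The symmetric form and its invariance\<close>

lemma psi_scale: "psi (c \<cdot> r) v p q s = c \<cdot> psi r v p q s" "psi r (c \<cdot> v) p q s = c \<cdot> psi r v p q s"
  "psi r v p q (c \<cdot> s) = c \<cdot> psi r v p q s"
  by (simp_all add: psi_def d_scale triple_scale scale_right_distrib)

lemma scalar_scale: "scalar (c \<cdot> r) v u = c \<cdot> scalar r v u" "scalar r (c \<cdot> v) u = c \<cdot> scalar r v u"
  "scalar r v (c \<cdot> u) = c \<cdot> scalar r v u"
  by (rule scalarI, simp_all add: pi_scale pi_scalar psi_scale d_scale d_scalar)+

lemma scalar_add': "scalar (r + r') v u = scalar r v u + scalar r' v u" "scalar r (v + v') u = scalar r v u + scalar r v' u"
  by (rule scalarI, simp_all add: pi_add pi_scalar psi_add lin d_scalar)+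

lemma scalar_sym: "scalar r v u = scalar v r u"
  by (rule scalarI) (simp_all add: pi_scalar d_scalar psi_sym)

text \<open>The factor \<open>- 2\<close> absorbs the 2 of \<open>t_scalar\<close> and fixes the
  sign used in \<open>bracket_bracket_form\<close>. The choice is unambiguous because
  \<open>C\<close> is nonzero.\<close>

definition form :: "'a \<Rightarrow> 'a \<Rightarrow> 'k" where
  "form r v = (SOME k. \<forall>u. \<sigma> u = - u \<longrightarrow> scalar r v u = (- 2 * k) \<cdot> u)"

lemma scalar_form: "\<sigma> u = - u \<Longrightarrow> scalar r v u = (- 2 * form r v) \<cdot> u"
proof -
  have "\<sigma> (scalar r v u) = - scalar r v u" for u
    using pi_odd [of "scalar r v u"] by (simp add: pi_scalar)
  then obtain k where k: "\<forall>u. \<sigma> u = - u \<longrightarrow> scalar r v u = k \<cdot> u"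
    using odd_endomorphism_scalar [of "scalar r v"] by (auto simp: scalar_add scalar_scale scalar_mult)
  have "\<exists>k. \<forall>u. \<sigma> u = - u \<longrightarrow> scalar r v u = (- 2 * k) \<cdot> u"
    using k two by (intro exI [of _ "- k / 2"]) simp
  then show "\<sigma> u = - u \<Longrightarrow> scalar r v u = (- 2 * form r v) \<cdot> u"
    unfolding form_def by (rule someI2_ex) blast
qed

lemma form_eqI: "(\<And>u. \<sigma> u = - u \<Longrightarrow> scalar r v u = (- 2 * k) \<cdot> u) \<Longrightarrow> form r v = k"
proof -
  assume k: "\<And>u. \<sigma> u = - u \<Longrightarrow> scalar r v u = (- 2 * k) \<cdot> u"
  obtain u where u: "\<sigma> u = - u" "u \<noteq> 0"
    using exists_odd by blast
  then have "(- 2 * form r v) \<cdot> u = (- 2 * k) \<cdot> u"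
    using k [OF u(1)] scalar_form [OF u(1), of r v] by simp
  then have "- 2 * form r v = - 2 * k"
    by (rule scale_right_imp_eq [OF u(2)])
  then show ?thesis
    using two by simp
qed

lemma form_add: "form (r + r') v = form r v + form r' v" "form r (v + v') = form r v + form r v'"
  by (rule form_eqI, simp only: scalar_add' scalar_form distrib_left scale_left_distrib)+

lemma form_scale: "form (c \<cdot> r) v = c * form r v" "form r (c \<cdot> v) = c * form r v"
  by (rule form_eqI, simp only: scalar_scale scalar_form scale_scale mult.left_commute [of c])+

lemma form_sym: "form r v = form v r"
  by (rule form_eqI, subst scalar_sym, rule scalar_form)

lemma form_simps [simp]: "form 0 v = 0" "form r 0 = 0" "form (- r) v = - form r v" "form r (- v) = - form r v"
  "form (r - r') v = form r v - form r' v" "form r (v - v') = form r v - form r v'"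
proof -
  show zero: "form 0 v = 0" "form r 0 = 0" for r v
    using form_scale(1) [of 0 0 v] form_scale(2) [of r 0 0] by simp_all
  show minus: "form (- r) v = - form r v" "form r (- v) = - form r v" for r v
    using form_scale(1) [of "- 1" r v] form_scale(2) [of r "- 1" v] by simp_all
  show "form (r - r') v = form r v - form r' v" "form r (v - v') = form r v - form r v'"
    using form_add(1) [of r "- r'" v] form_add(2) [of r v "- v'"] by (simp_all add: minus)
qed

lemma bracket_bracket_form:
  assumes "\<sigma> r = - r" "\<sigma> s = - s" "\<sigma> v = - v"
  shows "bracket (bracket r s) v = form s v \<cdot> r - form r v \<cdot> s"
proof -
  have "bracket (bracket r s) v + bracket (bracket r s) v = (- 2 * form r v) \<cdot> s - (- 2 * form s v) \<cdot> r"
    unfolding triple_of_odd [OF assms, symmetric] t_scalar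
    unfolding scalar_form [OF assms(1)] scalar_form [OF assms(2)] ..
  also have "\<dots> = (form s v + form s v) \<cdot> r - (form r v + form r v) \<cdot> s"
    unfolding mult_minus_left mult_2 scale_minus_left by (rule minus_diff_minus [THEN trans]) simp
  also have "\<dots> = form s v \<cdot> r - form r v \<cdot> s + (form s v \<cdot> r - form r v \<cdot> s)"
    unfolding scale_left_distrib by (rule add_diff_add)
  finally show ?thesis
    by (rule cancel2)
qed

lemma t_form: "\<sigma> r = - r \<Longrightarrow> \<sigma> s = - s \<Longrightarrow> \<sigma> v = - v \<Longrightarrow> triple r s v = form s v \<cdot> r - form r v \<cdot> s"
  by (simp add: triple_of_odd bracket_bracket_form)

lemma not_spanned_by_one:
  assumes "\<And>r. \<sigma> r = - r \<Longrightarrow> \<exists>k. r = k \<cdot> s"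
  shows False
proof -
  obtain x y where "\<pi> x \<star> \<pi> y \<noteq> 0"
    using prod_nonzero by auto
  moreover obtain j k where "\<pi> x = j \<cdot> s" "\<pi> y = k \<cdot> s"
    using assms [OF pi_odd] by meson
  ultimately show False
    by (simp only: prod_scale m_self scale_zero_right simp_thms)
qed

text \<open>Multiplication by \<open>w\<close> is a derivation of \<open>t\<close>; inserting
  \<open>t_form\<close> leaves \<open>c \<cdot> r = e \<cdot> s\<close> for every odd
  \<open>r\<close>. With \<open>c\<close> nonzero, \<open>C\<close> would be at most a line, where
  an anticommutative product vanishes.\<close>

lemma form_invariant:
  assumes w: "\<sigma> w = - w" and s: "\<sigma> s = - s" and v: "\<sigma> v = - v"
  shows "form (w \<star> s) v = - form s (w \<star> v)"
proof (rule ccontr)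
  define c where "c = form (w \<star> s) v + form s (w \<star> v)"
  assume "form (w \<star> s) v \<noteq> - form s (w \<star> v)"
  then have c: "c \<noteq> 0"
    by (simp add: c_def eq_neg_iff_add_eq_0)
  have "\<exists>k. r = k \<cdot> s" if r: "\<sigma> r = - r" for r
  proof -
    define e where "e = form (w \<star> r) v + form r (w \<star> v)"
    have 1: "w \<star> (form s v \<cdot> r - form r v \<cdot> s) = (form s v \<cdot> (w \<star> r) - form (w \<star> r) v \<cdot> s)
        + (form (w \<star> s) v \<cdot> r - form r v \<cdot> (w \<star> s)) + (form s (w \<star> v) \<cdot> r - form r (w \<star> v) \<cdot> s)"
      using m_t [of w r s v] by (simp only: t_form r s v prod_odd)
    have "c \<cdot> r = e \<cdot> s"
      by (rule lincomb1 [OF _ 1 [symmetric]])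
        (simp add: c_def e_def prod_scale scale_left_distrib algebra_simps)
    then have "r = (e / c) \<cdot> s"
      using c by (metis divide_inverse_commute scale_scale scale_one left_inverse)
    then show ?thesis ..
  qed
  from not_spanned_by_one [OF this] show False .
qed

lemma even_skew:
  assumes b: "\<sigma> b = b" and u: "\<sigma> u = - u" and v: "\<sigma> v = - v"
  shows "form (bracket b u) v = - form u (bracket b v)"
  using even_span [OF b]
proof (induction rule: span_induct_alt)
  case base
  show ?case
    by simp
next
  case (step c x y)
  then obtain p q where x: "x = bracket p q" "\<sigma> p = - p" "\<sigma> q = - q"
    by auto
  have "form (bracket x u) v = - form u (bracket x v)"
    unfolding x(1) bracket_bracket_form [OF x(2,3) u] bracket_bracket_form [OF x(2,3) v]
    by (simp add: form_scale form_sym [of u] form_sym [of v])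
  with step show ?case
    by (simp add: bracket_add form_add form_scale)
qed

lemma form_nondegenerate:
  assumes v: "\<sigma> v = - v" and 0: "\<And>u. \<sigma> u = - u \<Longrightarrow> form u v = 0"
  shows "v = 0"
proof -
  define N where "N = {v. \<sigma> v = - v \<and> (\<forall>u. \<sigma> u = - u \<longrightarrow> form u v = 0)}"
  have "N = {0} \<or> N = {x. \<sigma> x = - x}"
  proof (rule odd_module_cases)
    show "subspace N"
      by (rule subspaceI) (auto simp: N_def sigma_add form_add form_scale)
    show "\<sigma> i = - i" if "i \<in> N" for i
      using that by (simp add: N_def)
    show "bracket b i \<in> N" if b: "\<sigma> b = b" and i: "i \<in> N" for b i
    proof -
      have "form u (bracket b i) = 0" if u: "\<sigma> u = - u" for u
      proof -
        have "\<sigma> i = - i" "form (bracket b u) i = 0"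
          using i u b by (simp_all add: N_def)
        with even_skew [OF b u] show ?thesis
          by simp
      qed
      then show ?thesis
        using b i by (simp add: N_def)
    qed
  qed
  moreover have "N \<noteq> {x. \<sigma> x = - x}"
  proof
    assume N: "N = {x. \<sigma> x = - x}"
    have f0: "form u v = 0" if "\<sigma> u = - u" "\<sigma> v = - v" for u v
    proof -
      have "v \<in> N"
        using that N by blast
      then show ?thesis
        using that unfolding N_def by blast
    qed
    have b0: "bracket x y = 0" if "\<sigma> x = - x" "\<sigma> y = - y" for x y
    proof (rule even_faithful)
      show "bracket (bracket x y) c = 0" if "\<sigma> c = - c" for c
        using bracket_bracket_form [of x y c] \<open>\<sigma> x = - x\<close> \<open>\<sigma> y = - y\<close> that by (simp add: f0)
    qed (simp add: that)
    have "x \<star> y = 0" for x y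
      unfolding prod_eq by (simp add: b0 pi_odd)
    then show False
      using prod_nonzero by blast
  qed
  ultimately show ?thesis
    using assms unfolding N_def by blast
qed

text \<open>The case \<open>z = x\<close> of \<open>m_m\<close>. If \<open>form x x = - 1\<close>,
  multiplication by \<open>x\<close> squares to \<open>- 1\<close> on the complement of
  \<open>x\<close>, as for a unit imaginary octonion; hence the normalization to \<open>- 1\<close>
  in \<open>orthonormal\<close>.\<close>

lemma mult_mult_self:
  assumes "\<sigma> x = - x" "\<sigma> y = - y"
  shows "x \<star> (x \<star> y) = form x x \<cdot> y - form x y \<cdot> x"
proof (rule cancel3)
  have t: "triple x y x = form x y \<cdot> x - form x x \<cdot> y"
    using t_form [of x y x] assms by (simp add: form_sym [of y])
  have "- (x \<star> (x \<star> y)) = triple x y x + triple x y x + triple x y x + x \<star> (x \<star> y) + x \<star> (x \<star> y)"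
    using m_m [of x y x] by (simp add: m_anti [of y x] m_anti [of "x \<star> y" x])
  then have 1: "- (x \<star> (x \<star> y)) = (form x y \<cdot> x - form x x \<cdot> y) + (form x y \<cdot> x - form x x \<cdot> y)
      + (form x y \<cdot> x - form x x \<cdot> y) + x \<star> (x \<star> y) + x \<star> (x \<star> y)"
    by (simp only: t)
  show "x \<star> (x \<star> y) + x \<star> (x \<star> y) + x \<star> (x \<star> y)
    = form x x \<cdot> y - form x y \<cdot> x + (form x x \<cdot> y - form x y \<cdot> x) + (form x x \<cdot> y - form x y \<cdot> x)"
    by (rule lincomb1 [OF _ 1 [symmetric]]) (simp add: algebra_simps)
qed

text \<open>The first identity polarizes \<open>mult_mult_self\<close> at \<open>x + y\<close>; the
  second is the first with \<open>y\<close> and \<open>v\<close> exchanged, up to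
  anticommutativity.\<close>

lemma mult_mult_swap:
  assumes "\<sigma> x = - x" "\<sigma> y = - y" "\<sigma> v = - v" "form x y = 0" "form x v = 0" "form y v = 0"
  shows "x \<star> (y \<star> v) = - (y \<star> (x \<star> v))" "x \<star> (y \<star> v) = - ((x \<star> y) \<star> v)"
proof -
  have swap: "x \<star> (y \<star> v) = - (y \<star> (x \<star> v))"
    if "\<sigma> x = - x" "\<sigma> y = - y" "\<sigma> v = - v" "form x y = 0" "form x v = 0" "form y v = 0" for x y v
  proof -
    have f: "form (x + y) (x + y) = form x x + form y y" "form (x + y) v = 0"
      using that by (simp_all add: form_add form_sym [of y x])
    have 1: "(x + y) \<star> ((x + y) \<star> v) = form x x \<cdot> v + form y y \<cdot> v"
      using mult_mult_self [of "x + y" v, unfolded f] that by (simp add: sigma_add scale_left_distrib)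
    have 2: "x \<star> (x \<star> v) = form x x \<cdot> v" and 3: "y \<star> (y \<star> v) = form y y \<cdot> v"
      using mult_mult_self [of x v] mult_mult_self [of y v] that by simp_all
    show ?thesis
      by (rule lincomb3 [OF _ 1 2 [symmetric] 3 [symmetric]]) (simp add: m_add_left m_add_right)
  qed
  show 1: "x \<star> (y \<star> v) = - (y \<star> (x \<star> v))"
    by (rule swap) (rule assms)+
  have "x \<star> (v \<star> y) = - (v \<star> (x \<star> y))"
    by (rule swap) (use assms in \<open>simp_all add: form_sym [of v]\<close>)
  then have "(x \<star> y) \<star> v = - (x \<star> (y \<star> v))"
    by (simp add: m_anti [of v y] m_anti [of v "x \<star> y"])
  then show "x \<star> (y \<star> v) = - ((x \<star> y) \<star> v)"
    by (simp only: minus_minus)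
qed

section \<open>Orthonormal families\<close>

definition orthonormal :: "'a set \<Rightarrow> bool" where
  "orthonormal E \<longleftrightarrow> finite E \<and>
    (\<forall>e\<in>E. \<sigma> e = - e \<and> form e e = - 1 \<and> (\<forall>e'\<in>E. e' \<noteq> e \<longrightarrow> form e e' = 0))"

definition complete :: "'a set \<Rightarrow> bool" where
  "complete E \<longleftrightarrow> (\<forall>w. \<sigma> w = - w \<longrightarrow> w = - (\<Sum>e\<in>E. form w e \<cdot> e))"

lemma orthonormal_empty: "orthonormal {}"
  by (simp add: orthonormal_def)

lemma orthonormal_insert:
  assumes "orthonormal E" "\<sigma> e = - e" "form e e = - 1" "\<And>x. x \<in> E \<Longrightarrow> form e x = 0"
  shows "orthonormal (insert e E)" "card (insert e E) = Suc (card E)"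
proof -
  have "e \<notin> E"
    using assms(3) assms(4) [of e] by auto
  then show "card (insert e E) = Suc (card E)"
    using assms(1) by (simp add: orthonormal_def)
  show "orthonormal (insert e E)"
    unfolding orthonormal_def
  proof (intro conjI ballI impI)
    show "form x y = 0" if "x \<in> insert e E" "y \<in> insert e E" "y \<noteq> x" for x y
      using that assms(1) assms(4) [of x] assms(4) [of y] form_sym [of x e] unfolding orthonormal_def by auto
  qed (use assms in \<open>auto simp: orthonormal_def\<close>)
qed

lemma form_sum: "form (\<Sum>i\<in>I. h i) v = (\<Sum>i\<in>I. form (h i) v)"
  by (induction I rule: infinite_finite_induct) (simp_all add: form_add)

lemma form_orthonormal_sum:
  assumes E: "orthonormal E" and e: "e \<in> E"
  shows "form (\<Sum>x\<in>E. g x \<cdot> x) e = - g e"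
proof -
  have "(\<Sum>x\<in>E. g x * form x e) = (\<Sum>x\<in>E. if x = e then - g e else 0)"
    by (rule sum.cong) (use E e in \<open>auto simp: orthonormal_def\<close>)
  then show ?thesis
    using E e by (simp add: form_sum form_scale orthonormal_def)
qed

lemma sigma_sum: "\<sigma> (\<Sum>i\<in>I. h i) = (\<Sum>i\<in>I. \<sigma> (h i))"
  by (induction I rule: infinite_finite_induct) (simp_all add: sigma_add)

lemma perp_residue:
  assumes E: "orthonormal E" and w: "\<sigma> w = - w"
  defines "u \<equiv> w + (\<Sum>e\<in>E. form w e \<cdot> e)"
  shows "\<sigma> u = - u" "\<And>e. e \<in> E \<Longrightarrow> form u e = 0"
proof -
  have "\<sigma> e = - e" if "e \<in> E" for e
    using E that by (simp add: orthonormal_def)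
  then show "\<sigma> u = - u"
    unfolding u_def by (simp add: sigma_add w sigma_sum sum_negf)
  show "form u e = 0" if "e \<in> E" for e
    unfolding u_def by (simp add: form_add form_orthonormal_sum [OF E that])
qed

lemma completeI:
  assumes E: "orthonormal E" and perp: "\<And>u. \<sigma> u = - u \<Longrightarrow> (\<And>e. e \<in> E \<Longrightarrow> form u e = 0) \<Longrightarrow> u = 0"
  shows "complete E"
  unfolding complete_def
proof (intro allI impI)
  fix w assume "\<sigma> w = - w"
  from perp [OF perp_residue [OF E this]] show "w = - (\<Sum>e\<in>E. form w e \<cdot> e)"
    by (simp add: eq_neg_iff_add_eq_0)
qed

text \<open>By polarization a complement consisting of isotropic vectors is totally isotropic, hence
  perpendicular to itself and to \<open>E\<close>, and zero by nondegeneracy. Conversely, an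
  incomplete \<open>E\<close> leaves a vector that can be normalized.\<close>

lemma isotropic_perp:
  assumes E: "orthonormal E"
    and iso: "\<And>u. \<sigma> u = - u \<Longrightarrow> (\<And>e. e \<in> E \<Longrightarrow> form u e = 0) \<Longrightarrow> form u u = 0"
  shows "complete E"
proof (rule completeI [OF E])
  fix u assume u: "\<sigma> u = - u" "\<And>e. e \<in> E \<Longrightarrow> form u e = 0"
  show "u = 0"
  proof (rule form_nondegenerate [OF u(1)])
    fix w assume w: "\<sigma> w = - w"
    define s where "s = (\<Sum>e\<in>E. form w e \<cdot> e)"
    define r where "r = w + s"
    have r: "\<sigma> r = - r" "\<And>e. e \<in> E \<Longrightarrow> form r e = 0"
      unfolding r_def s_def by (rule perp_residue [OF E w], assumption?)+
    have "form r r = 0" "form u u = 0"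
      using iso [OF r] iso [OF u] by simp_all
    moreover have "form (r + u) (r + u) = 0"
      by (rule iso) (simp_all add: sigma_add r u form_add)
    ultimately have "form r u + form r u = 0"
      using form_sym [of u r] by (simp add: form_add)
    then have "2 * form r u = 0"
      by (simp only: mult_2)
    then have "form (w + s) u = 0"
      using two by (simp add: r_def)
    moreover have "form s u = 0"
      unfolding s_def form_sum form_scale using u(2) by (intro sum.neutral) (simp add: form_sym)
    ultimately show "form w u = 0"
      by (simp add: form_add)
  qed
qed

end

section \<open>Imaginary octonions\<close>

locale closed_triality = central_triality scale bracket \<sigma> \<rho>
  for scale :: "'k::alg_closed_field \<Rightarrow> 'a::ab_group_add \<Rightarrow> 'a" (infixr \<open>\<cdot>\<close> 75)
    and bracket :: "'a \<Rightarrow> 'a \<Rightarrow> 'a" and \<sigma> \<rho> :: "'a \<Rightarrow> 'a"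
begin

lemma orthonormal_extend:
  assumes E: "orthonormal E" and "\<not> complete E"
  shows "\<exists>e. \<sigma> e = - e \<and> form e e = - 1 \<and> (\<forall>x\<in>E. form e x = 0)"
proof -
  obtain u where u: "\<sigma> u = - u" "\<And>e. e \<in> E \<Longrightarrow> form u e = 0" "form u u \<noteq> 0"
    using isotropic_perp [OF E] assms(2) by metis
  obtain s where s: "s ^ 2 = - 1 / form u u"
    using nth_root_exists [of 2 "- 1 / form u u"] by auto
  have "form (s \<cdot> u) (s \<cdot> u) = s ^ 2 * form u u"
    by (simp add: form_scale power2_eq_square)
  then have "form (s \<cdot> u) (s \<cdot> u) = - 1"
    using u(3) by (simp add: s)
  moreover have "\<sigma> (s \<cdot> u) = - (s \<cdot> u)" "\<forall>x\<in>E. form (s \<cdot> u) x = 0"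
    using u by (simp_all add: form_scale)
  ultimately show ?thesis
    by blast
qed

lemma form_mult_left:
  assumes "\<sigma> x = - x" "\<sigma> y = - y"
  shows "form (x \<star> y) x = 0"
  using form_invariant [OF assms(1,1,2)] form_sym [of x "x \<star> y"] by simp

lemma form_mult_right:
  assumes "\<sigma> x = - x" "\<sigma> y = - y"
  shows "form (x \<star> y) y = 0"
  using form_mult_left [OF assms(2,1)] by (simp add: m_anti [of x y])

lemma form_mult_mult:
  assumes "\<sigma> x = - x" "\<sigma> y = - y" "\<sigma> v = - v" "form v v = - 1" "form v y = 0"
  shows "form (x \<star> v) (y \<star> v) = form x y"
  using form_invariant [of v x "v \<star> y"] mult_mult_self [of v y] assms
  by (simp add: prod_odd m_anti [of x v] m_anti [of y v])

text \<open>Excludes that \<open>C\<close> consists of the imaginary quaternions: an alternating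
  trilinear map on three spanning vectors is determined by one value.\<close>

lemma d_zero_of_three:
  assumes span: "\<And>w. \<sigma> w = - w \<Longrightarrow> \<exists>a b c. w = a \<cdot> x + b \<cdot> y + c \<cdot> z" and 0: "d x y z = 0"
  shows "d u v w = 0"
proof -
  obtain a1 b1 c1 where u: "\<pi> u = a1 \<cdot> x + b1 \<cdot> y + c1 \<cdot> z"
    using span [OF pi_odd] by blast
  obtain a2 b2 c2 where v: "\<pi> v = a2 \<cdot> x + b2 \<cdot> y + c2 \<cdot> z"
    using span [OF pi_odd] by blast
  obtain a3 b3 c3 where w: "\<pi> w = a3 \<cdot> x + b3 \<cdot> y + c3 \<cdot> z"
    using span [OF pi_odd] by blast
  have 1: "d y z x = 0" "d z x y = 0"
    using d_cycle [of x y z] d_cycle [of y z x] 0 by simp_all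
  have 2: "d y x z = 0" "d z y x = 0" "d x z y = 0"
    using d_swap12 [of y x z] d_swap12 [of z y x] d_swap12 [of x z y] 0 1 by simp_all
  have "d (\<pi> u) (\<pi> v) (\<pi> w) = 0"
    unfolding u v w by (simp only: d_add d_scale d_self 0 1 2 scale_zero_right add_0_left)
  then show ?thesis
    by simp
qed

text \<open>\<open>e1, e2, e3\<close> are quaternion units, and \<open>e4\<close> with its products
  \<open>e5, e6, e7\<close> comes from doubling. Orthonormality of the products reduces to that of
  the factors by \<open>form_mult_mult\<close> and \<open>form_invariant\<close>.\<close>

lemma orthonormal_seven: "\<exists>E. orthonormal E \<and> complete E \<and> card E = 7"
proof -
  have "\<not> complete {}"
    using exists_odd by (auto simp: complete_def)
  then obtain e1 where o1: "\<sigma> e1 = - e1" and n1: "form e1 e1 = - 1"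
    using orthonormal_extend [OF orthonormal_empty] by auto
  have E1: "orthonormal {e1}"
    using orthonormal_insert [OF orthonormal_empty o1 n1] by simp
  have "\<not> complete {e1}"
  proof
    assume "complete {e1}"
    then have "\<exists>k. r = k \<cdot> e1" if "\<sigma> r = - r" for r
      using that unfolding complete_def by (intro exI [of _ "- form r e1"]) simp
    then show False
      by (rule not_spanned_by_one)
  qed
  then obtain e2 where o2: "\<sigma> e2 = - e2" and n2: "form e2 e2 = - 1" and p21: "form e2 e1 = 0"
    using orthonormal_extend [OF E1] by auto
  have E2: "orthonormal {e2, e1}" "card {e2, e1} = 2"
    using orthonormal_insert [OF E1 o2 n2] p21 by simp_all
  have p12: "form e1 e2 = 0"
    using p21 form_sym [of e1 e2] by simp
  define e3 where "e3 = e1 \<star> e2"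
  have o3: "\<sigma> e3 = - e3"
    by (simp add: e3_def prod_odd)
  have p31: "form e3 e1 = 0" and p32: "form e3 e2 = 0"
    unfolding e3_def by (rule form_mult_left [OF o1 o2], rule form_mult_right [OF o1 o2])
  have n3: "form e3 e3 = - 1"
    unfolding e3_def by (simp add: form_mult_mult [OF o1 o1 o2 n2 p21] n1)
  have E3: "orthonormal {e3, e2, e1}" "card {e3, e2, e1} = 3"
    using orthonormal_insert [OF E2(1) o3 n3] p31 p32 E2(2) by auto
  have m13: "e1 \<star> e3 = - e2"
    using mult_mult_self [OF o1 o2] by (simp add: e3_def n1 p12)
  have m23: "e2 \<star> e3 = e1"
    using mult_mult_self [OF o2 o1] by (simp add: e3_def n2 p21 m_anti [of e1 e2])
  have "\<not> complete {e3, e2, e1}"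
  proof
    assume *: "complete {e3, e2, e1}"
    have "e3 \<notin> {e2, e1}" "e2 \<notin> {e1}"
      using n3 n2 p31 p32 p21 by auto
    then have span: "\<exists>a b c. w = a \<cdot> e1 + b \<cdot> e2 + c \<cdot> e3" if "\<sigma> w = - w" for w
      using * that unfolding complete_def
      by (intro exI [of _ "- form w e1"] exI [of _ "- form w e2"] exI [of _ "- form w e3"])
        (simp add: algebra_simps)
    have "form e1 e3 = 0" "form e2 e3 = 0"
      using p31 p32 form_sym [of e1 e3] form_sym [of e2 e3] by simp_all
    then have "d e1 e2 e3 = 0"
      unfolding d_def using t_form [OF o1 o2 o3] by (simp add: e3_def [symmetric])
    from d_zero_of_three [OF span this] show False
      using d_nonzero by blast
  qed
  then obtain e4 where o4: "\<sigma> e4 = - e4" and n4: "form e4 e4 = - 1"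
    and p4: "form e4 e1 = 0" "form e4 e2 = 0" "form e4 e3 = 0"
    using orthonormal_extend [OF E3(1)] by auto
  have E4: "orthonormal {e4, e3, e2, e1}" "card {e4, e3, e2, e1} = 4"
    using orthonormal_insert [OF E3(1) o4 n4] p4 E3(2) by auto
  have inv: "form (x \<star> e4) y = - form e4 (x \<star> y)" if "\<sigma> x = - x" "\<sigma> y = - y" for x y
    by (rule form_invariant [OF that(1) o4 that(2)])
  define e5 where "e5 = e1 \<star> e4"
  define e6 where "e6 = e2 \<star> e4"
  define e7 where "e7 = e3 \<star> e4"
  have o5: "\<sigma> e5 = - e5" and o6: "\<sigma> e6 = - e6" and o7: "\<sigma> e7 = - e7"
    by (simp_all add: e5_def e6_def e7_def prod_odd)
  have n: "form e5 e5 = - 1" "form e6 e6 = - 1" "form e7 e7 = - 1"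
    unfolding e5_def e6_def e7_def
    by (simp_all add: form_mult_mult [OF o1 o1 o4 n4 p4(1)] form_mult_mult [OF o2 o2 o4 n4 p4(2)]
        form_mult_mult [OF o3 o3 o4 n4 p4(3)] n1 n2 n3)
  have p5: "form e5 e1 = 0" "form e5 e2 = 0" "form e5 e3 = 0" "form e5 e4 = 0"
    unfolding e5_def using form_mult_left [OF o1 o4] form_mult_right [OF o1 o4] inv [OF o1 o2] inv [OF o1 o3] p4
    by (simp_all add: e3_def [symmetric] m13)
  have p6: "form e6 e1 = 0" "form e6 e2 = 0" "form e6 e3 = 0" "form e6 e4 = 0"
    unfolding e6_def using form_mult_left [OF o2 o4] form_mult_right [OF o2 o4] inv [OF o2 o1] inv [OF o2 o3] p4
    by (simp_all add: m_anti [of e2 e1] e3_def [symmetric] m23)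
  have p7: "form e7 e1 = 0" "form e7 e2 = 0" "form e7 e3 = 0" "form e7 e4 = 0"
    unfolding e7_def using form_mult_left [OF o3 o4] form_mult_right [OF o3 o4] inv [OF o3 o1] inv [OF o3 o2] p4
    by (simp_all add: m_anti [of e3 e1] m_anti [of e3 e2] m13 m23)
  have q: "form e6 e5 = 0" "form e7 e5 = 0" "form e7 e6 = 0"
    unfolding e5_def e6_def e7_def
    by (simp_all add: form_mult_mult [OF o2 o1 o4 n4 p4(1)] form_mult_mult [OF o3 o1 o4 n4 p4(1)]
        form_mult_mult [OF o3 o2 o4 n4 p4(2)] p21 p31 p32)
  have E5: "orthonormal {e5, e4, e3, e2, e1}" "card {e5, e4, e3, e2, e1} = 5"
    using orthonormal_insert [OF E4(1) o5 n(1)] p5 E4(2) by auto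
  have E6: "orthonormal {e6, e5, e4, e3, e2, e1}" "card {e6, e5, e4, e3, e2, e1} = 6"
    using orthonormal_insert [OF E5(1) o6 n(2)] p6 q(1) E5(2) by auto
  have E7: "orthonormal {e7, e6, e5, e4, e3, e2, e1}" "card {e7, e6, e5, e4, e3, e2, e1} = 7"
    using orthonormal_insert [OF E6(1) o7 n(3)] p7 q(2,3) E6(2) by auto
  have "complete {e7, e6, e5, e4, e3, e2, e1}"
  proof (rule completeI [OF E7(1)])
    fix v assume ov: "\<sigma> v = - v" and "\<And>e. e \<in> {e7, e6, e5, e4, e3, e2, e1} \<Longrightarrow> form v e = 0"
    then have "form v e1 = 0" "form v e2 = 0" "form v e3 = 0" "form v e4 = 0" "form v e5 = 0"
        "form v e6 = 0" "form v e7 = 0"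
      by simp_all
    then have v: "form e1 v = 0" "form e2 v = 0" "form e3 v = 0" "form e4 v = 0" "form e5 v = 0"
        "form e6 v = 0" "form e7 v = 0"
      by (simp_all only: form_sym [of v])
    have p: "form e1 e4 = 0" "form e2 e4 = 0" "form e3 e4 = 0" "form e1 e6 = 0"
      using p4 p6 form_sym [of e1 e4] form_sym [of e2 e4] form_sym [of e3 e4] form_sym [of e1 e6] by simp_all
    have f: "form e1 (e4 \<star> v) = 0" "form e2 (e4 \<star> v) = 0"
      using form_invariant [OF o4 o1 ov] form_invariant [OF o4 o2 ov] v(5,6)
      by (simp_all add: e5_def e6_def m_anti [of e4 e1] m_anti [of e4 e2])
    \<comment> \<open>For \<open>v\<close> perpendicular to all seven units,
      \<open>e3 \<star> (e4 \<star> v)\<close> is \<open>e7 \<star> v\<close> when computed through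
      \<open>e1, e2\<close> and \<open>- (e7 \<star> v)\<close> when computed directly. So
      \<open>e7 \<star> v = 0\<close>, while multiplication by \<open>e7\<close> squares to
      \<open>- 1\<close> on its complement.\<close>
    have "e3 \<star> (e4 \<star> v) = - (e1 \<star> (e2 \<star> (e4 \<star> v)))"
      using mult_mult_swap(2) [OF o1 o2 prod_odd p12 f] unfolding e3_def by (simp only: minus_minus)
    also have "e2 \<star> (e4 \<star> v) = - (e6 \<star> v)"
      unfolding e6_def by (rule mult_mult_swap(2) [OF o2 o4 ov p(2) v(2,4)])
    also have "- (e1 \<star> - (e6 \<star> v)) = - ((e1 \<star> e6) \<star> v)"
      using mult_mult_swap(2) [OF o1 o6 ov p(4) v(1,6)] by simp
    also have "e1 \<star> e6 = - e7"
      unfolding e6_def e7_def e3_def by (rule mult_mult_swap(2) [OF o1 o2 o4 p12 p(1,2)])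
    also have "- (- e7 \<star> v) = e7 \<star> v"
      by simp
    finally have "e3 \<star> (e4 \<star> v) = e7 \<star> v" .
    moreover have "e3 \<star> (e4 \<star> v) = - (e7 \<star> v)"
      unfolding e7_def by (rule mult_mult_swap(2) [OF o3 o4 ov p(3) v(3,4)])
    ultimately have "e7 \<star> v = 0"
      by (intro eq_self_neg) simp
    moreover have "e7 \<star> (e7 \<star> v) = - v"
      using mult_mult_self [OF o7 ov] by (simp add: n v)
    ultimately show "v = 0"
      by simp
  qed
  with E7 show ?thesis
    by blast
qed

end

section \<open>Matrices\<close>

lemma sum_UNIV_Plus: "(\<Sum>x\<in>UNIV. f x) = (\<Sum>a\<in>UNIV. f (Inl a)) + (\<Sum>b\<in>UNIV. f (Inr b))"
  for f :: "'m::finite + 'n::finite \<Rightarrow> 'b::comm_monoid_add"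
  using sum.Plus [of UNIV UNIV f] by simp

lemma split_form_square: "split_form ** split_form = (mat 1 :: 'k::field^('n + 'n)^('n::finite + 'n))"
  by (simp add: vec_eq_iff matrix_matrix_mult_def sum_UNIV_Plus split_form_def mat_def split_sum_all if_distrib
      if_distribR sum.delta sum.delta' cong: if_cong)

text \<open>The columns of the witness are the isotropic vectors \<open>u + \<iota> u'\<close> and
  \<open>u - \<iota> u'\<close> for pairs \<open>u, u'\<close> of standard basis vectors; partners
  pair to \<open>1 - \<iota> * \<iota> = 2\<close>.\<close>

lemma split_form_basis:
  fixes \<iota> :: "'k::field"
  assumes "\<iota> * \<iota> = - 1"
  obtains P :: "'k^('n + 'n)^('n::finite + 'n)" where "transpose P ** P = matrix_scale 2 split_form"
proof
  define P :: "'k^('n + 'n)^('n::finite + 'n)" where "P = (\<chi> i j. case (i, j) of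
      (Inl a, Inl b) \<Rightarrow> (if a = b then 1 else 0)
    | (Inl a, Inr b) \<Rightarrow> (if a = b then 1 else 0)
    | (Inr a, Inl b) \<Rightarrow> (if a = b then \<iota> else 0)
    | (Inr a, Inr b) \<Rightarrow> (if a = b then - \<iota> else 0))"
  show "transpose P ** P = matrix_scale 2 split_form"
    using assms
    by (simp add: vec_eq_iff transpose_def matrix_matrix_mult_def sum_UNIV_Plus split_form_def P_def matrix_scale_def
      split_sum_all if_distrib if_distribR sum.delta sum.delta' cong: if_cong)
qed

lemma skew_conjugate_classical_D:
  fixes P Q :: "'k::field^('n + 'n)^('n::finite + 'n)"
  assumes P: "transpose P ** P = matrix_scale 2 split_form" and PQ: "P ** Q = mat 1" and two: "(2::'k) \<noteq> 0"
  shows "transpose M = - M \<Longrightarrow> Q ** M ** P \<in> classical_D"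
    and "A \<in> classical_D \<Longrightarrow> transpose (P ** A ** Q) = - (P ** A ** Q)"
proof -
  have neg: "X ** (- Y) = - (X ** Y)" "(- X) ** Y = - (X ** Y)" for X Y :: "'k^('n + 'n)^('n + 'n)"
    by (simp_all add: matrix_matrix_mult_def vec_eq_iff sum_negf)
  have half: "matrix_scale (1 / 2) (matrix_scale 2 X) = X" for X :: "'k^('n + 'n)^('n + 'n)"
    using two by (simp add: matrix_scale_def vec_eq_iff)
  have S: "split_form = matrix_scale (1 / 2) (transpose P ** P)"
    by (simp add: P half)
  have tS: "transpose split_form = (split_form :: 'k^('n + 'n)^('n + 'n))"
    by (simp add: vec_eq_iff transpose_def split_form_def split_sum_all)
  have PTP: "transpose Q ** transpose P = mat 1"
    by (simp add: matrix_transpose_mul [symmetric] PQ transpose_mat)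
  { assume M: "transpose M = - M"
    have "transpose (Q ** M ** P) ** split_form = matrix_scale (1 / 2) (transpose P ** transpose M ** (transpose Q ** transpose P) ** P)"
      unfolding S by (simp add: matrix_transpose_mul matrix_scale_mult matrix_mul_assoc)
    also have "\<dots> = - matrix_scale (1 / 2) (transpose P ** M ** P)"
      by (simp add: PTP M neg) (simp add: matrix_scale_def vec_eq_iff)
    also have "matrix_scale (1 / 2) (transpose P ** M ** P) = matrix_scale (1 / 2) (transpose P ** (P ** Q) ** M ** P)"
      by (simp add: PQ)
    also have "\<dots> = split_form ** (Q ** M ** P)"
      unfolding S by (simp add: matrix_scale_mult matrix_mul_assoc)
    finally show "Q ** M ** P \<in> classical_D"
      by (simp add: classical_D_def) }
  { assume A: "A \<in> classical_D"
    have SQ: "transpose P = matrix_scale 2 split_form ** Q"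
      unfolding P [symmetric] by (simp add: matrix_mul_assoc [symmetric] PQ)
    have QS: "transpose Q ** matrix_scale 2 split_form = P"
      unfolding P [symmetric] by (simp add: matrix_mul_assoc PTP)
    have "transpose (P ** A ** Q) = transpose Q ** transpose A ** transpose P"
      by (simp add: matrix_transpose_mul matrix_mul_assoc)
    also have "\<dots> = matrix_scale 2 (transpose Q ** (transpose A ** split_form) ** Q)"
      unfolding SQ by (simp add: matrix_scale_mult matrix_mul_assoc)
    also have "transpose A ** split_form = - (split_form ** A)"
      using A by (simp add: classical_D_def eq_neg_iff_add_eq_0)
    also have "matrix_scale 2 (transpose Q ** - (split_form ** A) ** Q) = - ((transpose Q ** matrix_scale 2 split_form) ** A ** Q)"
      by (simp add: neg matrix_scale_mult matrix_mul_assoc) (simp add: matrix_scale_def vec_eq_iff)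
    finally show "transpose (P ** A ** Q) = - (P ** A ** Q)"
      by (simp add: QS) }
qed

section \<open>The representation by skew-symmetric matrices\<close>

locale framed_triality = central_triality scale bracket \<sigma> \<rho>
  for scale :: "'k::field \<Rightarrow> 'a::ab_group_add \<Rightarrow> 'a" (infixr \<open>\<cdot>\<close> 75)
    and bracket :: "'a \<Rightarrow> 'a \<Rightarrow> 'a" and \<sigma> \<rho> :: "'a \<Rightarrow> 'a" +
  fixes z :: "'i::finite" and e :: "'i \<Rightarrow> 'a"
  assumes frame_origin [simp]: "e z = 0"
    and frame_odd [simp]: "\<sigma> (e i) = - e i"
    and frame_form: "form (e i) (e j) = (if i = j \<and> i \<noteq> z then - 1 else 0)"
    and frame_expand: "\<sigma> w = - w \<Longrightarrow> w = - (\<Sum>i\<in>UNIV. form w (e i) \<cdot> e i)"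
begin

lemma frame_zero: "\<sigma> w = - w \<Longrightarrow> (\<And>i. form w (e i) = 0) \<Longrightarrow> w = 0"
  by (subst frame_expand) simp_all

lemma parseval: "\<sigma> x = - x \<Longrightarrow> (\<Sum>i\<in>UNIV. form x (e i) * form (e i) y) = - form x y"
proof -
  assume "\<sigma> x = - x"
  from arg_cong [OF frame_expand [OF this], of "\<lambda>u. form u y"] show ?thesis
    by (simp add: form_sum form_scale)
qed

definition origin :: "'i \<Rightarrow> 'k" where "origin i = (if i = z then 1 else 0)"

lemma origin_form [simp]: "origin i * form (e i) x = 0" "origin i * form x (e i) = 0"
  by (simp_all add: origin_def)

text \<open>Matrices of the action on \<open>k \<oplus> C\<close> in which \<open>\<sigma>\<close>-fixed elements \<open>b\<close> act by \<open>v \<mapsto> [b, v]\<close> on \<open>C\<close> and by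
  \<open>0\<close> on \<open>k\<close>, while \<open>c\<close> in \<open>C\<close> maps \<open>1\<close> to \<open>c\<close> and \<open>v\<close> to \<open>form c v\<close>. The index \<open>z\<close> stands for the unit of \<open>k\<close>;
  setting \<open>e z = 0\<close> lets all sums run over the whole index type.\<close>

definition mat_of :: "'a \<Rightarrow> 'k^'i^'i" where
  "mat_of a = (\<chi> i j. origin i * form (\<pi> a) (e j) - origin j * form (\<pi> a) (e i)
    - form (bracket (a - \<pi> a) (e j)) (e i))"

lemma mat_of_add: "mat_of (a + a') = mat_of a + mat_of a'"
  by (simp add: mat_of_def vec_eq_iff pi_add form_add bracket_add algebra_simps)

lemma mat_of_scale: "mat_of (c \<cdot> a) = matrix_scale c (mat_of a)"
  by (simp add: mat_of_def vec_eq_iff pi_scale form_scale matrix_scale_def algebra_simps)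

lemma even_skew_swap:
  assumes "\<sigma> b = b" "\<sigma> x = - x" "\<sigma> y = - y"
  shows "form (bracket b x) y = - form (bracket b y) x"
  unfolding even_skew [OF assms] form_sym [of x] ..

lemma mat_of_skew: "transpose (mat_of a) = - mat_of a"
proof -
  have 1: "mat_of a $ j $ i = - mat_of a $ i $ j" for i j
    unfolding mat_of_def vec_lambda_beta even_skew_swap [OF sigma_minus_pi frame_odd frame_odd, of a i j] by simp
  show ?thesis
    unfolding vec_eq_iff transpose_def vec_lambda_beta vector_uminus_component by (intro allI 1)
qed

lemma mat_of_odd: "\<sigma> c = - c \<Longrightarrow> mat_of c $ i $ j = origin i * form c (e j) - origin j * form c (e i)"
  by (simp add: mat_of_def pi_of_odd)

lemma mat_of_even: "\<sigma> b = b \<Longrightarrow> mat_of b $ i $ j = - form (bracket b (e j)) (e i)"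
  by (simp add: mat_of_def pi_of_even)

lemma mat_of_zero: "mat_of a = 0 \<Longrightarrow> a = 0"
proof -
  assume 0: "mat_of a = 0"
  then have 1: "mat_of a $ i $ j = 0" for i j
    by simp
  have "form (\<pi> a) (e j) = 0" for j
    using 1 [of z j] by (cases "j = z") (simp_all add: mat_of_def origin_def)
  then have c: "\<pi> a = 0"
    by (rule frame_zero [OF pi_odd])
  have b: "\<sigma> a = a"
    using sigma_minus_pi [of a] by (simp add: c)
  have e: "bracket a (e j) = 0" for j
    by (rule frame_zero) (use 1 [of _ j] in \<open>simp_all add: mat_of_even [OF b] b\<close>)
  show "a = 0"
  proof (rule even_faithful [OF b])
    fix w assume w: "\<sigma> w = - w"
    show "bracket a w = 0"
    proof (rule frame_zero)
      show "form (bracket a w) (e i) = 0" for i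
        using even_skew [OF b w, of "e i"] by (simp add: e)
    qed (simp add: b w)
  qed
qed

text \<open>The sum over the middle index is evaluated by \<open>parseval\<close>. The index
  \<open>z\<close> contributes the last term separately, because \<open>e z = 0\<close> makes it
  invisible to the form.\<close>

lemma mat_of_mult:
  assumes b: "\<sigma> b = b" "\<sigma> b' = b'" and c: "\<sigma> c = - c" "\<sigma> c' = - c'"
  shows "(mat_of (b + c) ** mat_of (b' + c')) $ i $ j
    = form (bracket b (e i) + origin i \<cdot> c) (bracket b' (e j) + origin j \<cdot> c') - form c (e i) * form c' (e j)"
proof -
  let ?p = "bracket b (e i) + origin i \<cdot> c" and ?q = "bracket b' (e j) + origin j \<cdot> c'"
  have p: "\<sigma> ?p = - ?p"
    by (simp add: sigma_add b c)
  have l: "mat_of (b + c) $ i $ k = form ?p (e k) - origin k * form c (e i)" for k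
    using even_skew_swap [OF b(1), of "e k" "e i"]
    by (simp add: mat_of_add mat_of_even [OF b(1)] mat_of_odd [OF c(1)] form_add form_scale)
  have r: "mat_of (b' + c') $ k $ j = origin k * form c' (e j) - form (e k) ?q" for k
    unfolding form_sym [of "e k"]
    by (simp add: mat_of_add mat_of_even [OF b(2)] mat_of_odd [OF c(2)] form_add form_scale)
  have k: "mat_of (b + c) $ i $ k * mat_of (b' + c') $ k $ j
      = - (form ?p (e k) * form (e k) ?q) - (if k = z then form c (e i) * form c' (e j) else 0)" for k
    unfolding l r by (simp add: origin_def)
  show ?thesis
    unfolding matrix_matrix_mult_def k using parseval [OF p, of ?q]
    by (simp add: k sum_subtractf sum_negf)
qed

lemma mat_of_bracket: "mat_of (bracket a a') = commutator (mat_of a) (mat_of a')"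
proof -
  define c b c' b' where "c = \<pi> a" and "b = a - \<pi> a" and "c' = \<pi> a'" and "b' = a' - \<pi> a'"
  have c: "\<sigma> c = - c" "\<sigma> c' = - c'" and b: "\<sigma> b = b" "\<sigma> b' = b'"
    unfolding c_def c'_def b_def b'_def by (rule pi_odd sigma_minus_pi)+
  have a: "a = b + c" "a' = b' + c'"
    by (simp_all add: c_def c'_def b_def b'_def)
  have ee: "\<sigma> (bracket b b' + bracket c c') = bracket b b' + bracket c c'"
    by (simp add: sigma_add b c)
  have oo: "\<sigma> (bracket b c' - bracket b' c) = - (bracket b c' - bracket b' c)"
    by (simp add: b c)
  have br: "bracket a a' = (bracket b b' + bracket c c') + (bracket b c' - bracket b' c)"
    unfolding a by (simp add: bracket_add bracket_anti [of c b'])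
  have "mat_of (bracket a a') $ i $ j = commutator (mat_of a) (mat_of a') $ i $ j" for i j
  proof -
    have 1: "form (bracket (bracket b b') (e j)) (e i)
        = form (bracket b (bracket b' (e j))) (e i) - form (bracket b' (bracket b (e j))) (e i)"
      using bracket_derivation [of b b' "e j"] by (simp add: form_add)
    have 2: "form (bracket b (bracket b' (e j))) (e i) = - form (bracket b (e i)) (bracket b' (e j))"
      "form (bracket b' (bracket b (e j))) (e i) = - form (bracket b' (e i)) (bracket b (e j))"
      by (rule even_skew_swap; simp add: b)+
    have 4: "form (bracket (bracket c c') (e j)) (e i) = form c' (e j) * form c (e i) - form c (e j) * form c' (e i)"
      using bracket_bracket_form [OF c frame_odd] by (simp add: form_scale)
    have 5: "form (bracket b c') (e k) = - form (bracket b (e k)) c'"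
      "form (bracket b' c) (e k) = - form (bracket b' (e k)) c" for k
      by (rule even_skew_swap; simp add: b c)+
    have "mat_of (bracket a a') $ i $ j = - form (bracket (bracket b b' + bracket c c') (e j)) (e i)
        + (origin i * form (bracket b c' - bracket b' c) (e j) - origin j * form (bracket b c' - bracket b' c) (e i))"
      unfolding br mat_of_add [of "bracket b b' + bracket c c'"] by (simp only: vector_add_component mat_of_even [OF ee] mat_of_odd [OF oo])
    also have "\<dots> = form (bracket b (e i)) (bracket b' (e j)) - form (bracket b' (e i)) (bracket b (e j))
        - (form c' (e j) * form c (e i) - form c (e j) * form c' (e i))
        + (origin i * (form (bracket b' (e j)) c - form (bracket b (e j)) c')
        - origin j * (form (bracket b' (e i)) c - form (bracket b (e i)) c'))"
      by (simp add: bracket_add form_add 1 2 4 5)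
    also have "\<dots> = commutator (mat_of a) (mat_of a') $ i $ j"
      unfolding commutator_def a vector_minus_component mat_of_mult [OF b c] mat_of_mult [OF b(2,1) c(2,1)]
      using form_sym [of c "bracket b' (e j)"] form_sym [of c' "bracket b (e j)"] form_sym [of c' c]
      by (simp add: form_add form_scale algebra_simps)
    finally show ?thesis .
  qed
  then show ?thesis
    by (simp add: vec_eq_iff)
qed

lemma bracket_sum: "bracket (\<Sum>i\<in>I. h i) y = (\<Sum>i\<in>I. bracket (h i) y)"
  by (induction I rule: infinite_finite_induct) (simp_all add: bracket_add)

text \<open>\<open>bracket (e i) (e j)\<close> acts on \<open>C\<close> as an elementary
  skew-symmetric matrix, up to sign. The factor \<open>1 / 2\<close> corrects for each pair of
  indices occurring twice; pairs containing \<open>z\<close> drop out of the double sum as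
  \<open>e z = 0\<close>.\<close>

definition of_mat :: "'k^'i^'i \<Rightarrow> 'a" where
  "of_mat S = - (\<Sum>i\<in>UNIV. S $ z $ i \<cdot> e i) - (1 / 2) \<cdot> (\<Sum>i\<in>UNIV. \<Sum>j\<in>UNIV. S $ i $ j \<cdot> bracket (e i) (e j))"

lemma mat_of_of_mat:
  assumes S: "transpose S = - S"
  shows "mat_of (of_mat S) = S"
proof -
  have skew: "S $ j $ i = - S $ i $ j" for i j
    using arg_cong [OF S, of "\<lambda>M. M $ i $ j"] by (simp add: transpose_def)
  have "2 * S $ i $ i = 0" for i
    using skew [of i i] by (simp only: mult_2) (metis add.right_inverse)
  then have diag: "S $ i $ i = 0" for i
    using two by simp
  define c where "c = - (\<Sum>i\<in>UNIV. S $ z $ i \<cdot> e i)"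
  define w where "w = (\<Sum>i\<in>UNIV. \<Sum>j\<in>UNIV. S $ i $ j \<cdot> bracket (e i) (e j))"
  define b where "b = (- 1 / 2) \<cdot> w"
  have c: "\<sigma> c = - c"
    unfolding c_def by (simp add: sigma_sum sum_negf)
  have b: "\<sigma> b = b"
    unfolding b_def w_def by (simp add: sigma_sum)
  have fc: "form c (e j) = S $ z $ j" for j
  proof -
    have "form c (e j) = (\<Sum>i\<in>UNIV. if i = j then (if j = z then 0 else S $ z $ j) else 0)"
      unfolding c_def form_simps form_sum form_scale sum_negf [symmetric]
      by (rule sum.cong) (simp_all add: frame_form)
    then show ?thesis
      by (simp add: diag)
  qed
  have fb: "form (bracket b (e j)) (e i) = (if i = z \<or> j = z then 0 else - S $ i $ j)" for i j
  proof -
    define r where "r = (if i = z \<or> j = z then 0 else S $ i $ j)"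
    have "S $ k $ l * form (bracket (bracket (e k) (e l)) (e j)) (e i)
        = (if l = j then if k = i then r else 0 else 0) + (if l = i then if k = j then r else 0 else 0)" for k l
      unfolding bracket_bracket_form [OF frame_odd frame_odd frame_odd] form_simps form_scale frame_form r_def
      using skew [of i j] diag [of i] diag [of j] by auto
    then have "form (bracket w (e j)) (e i) = r + r"
      unfolding w_def bracket_sum form_sum bracket_simps form_scale
      by (simp add: sum.distrib sum.delta)
    then show ?thesis
      using two by (simp add: b_def r_def form_scale field_simps)
  qed
  have "of_mat S = b + c"
    by (simp add: of_mat_def b_def c_def w_def)
  moreover have "mat_of (b + c) $ i $ j = S $ i $ j" for i j
    unfolding mat_of_add vector_add_component mat_of_even [OF b] mat_of_odd [OF c] fb fc origin_def
    using skew [of z i] by (simp add: diag)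
  ultimately show ?thesis
    by (simp add: vec_eq_iff)
qed

lemma of_mat_mat_of: "of_mat (mat_of a) = a"
proof -
  let ?a = "of_mat (mat_of a)"
  have "mat_of (a + (- 1) \<cdot> ?a) = mat_of a + matrix_scale (- 1) (mat_of a)"
    by (simp only: mat_of_add mat_of_scale mat_of_of_mat [OF mat_of_skew])
  then have "a + (- 1) \<cdot> ?a = 0"
    by (intro mat_of_zero) (simp add: matrix_scale_def vec_eq_iff)
  then show ?thesis
    by simp
qed

lemma finite_dimensional_framed: "finite_dimensional"
proof -
  define W where "W = range e \<union> range (\<lambda>(i, j). bracket (e i) (e j))"
  have "of_mat S \<in> span W" for S
    unfolding of_mat_def
    by (intro span_diff span_neg span_scale span_sum span_base) (auto simp: W_def)
  then have "a \<in> span W" for a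
    using of_mat_mat_of [of a] by metis
  moreover have "finite W"
    by (simp add: W_def)
  ultimately show ?thesis
    unfolding finite_dimensional_def by blast
qed

end

theorem theorem6:
  fixes scale :: "'k::alg_closed_field \<Rightarrow> 'a::ab_group_add \<Rightarrow> 'a"
    and bracket :: "'a \<Rightarrow> 'a \<Rightarrow> 'a"
    and \<sigma> \<rho> :: "'a \<Rightarrow> 'a"
  assumes "CHAR('k) \<noteq> 2" and "CHAR('k) \<noteq> 3"
    and "lie_algebra_with_triality scale bracket \<sigma> \<rho>"
    and "lie_algebra.simple_central scale bracket"
  shows "lie_algebra.finite_dimensional scale \<and>
    lie_algebra.lie_simple scale bracket \<and>
    lie_algebra.type_D4 scale bracket"
proof -
  interpret lie_algebra_with_triality scale bracket \<sigma> \<rho>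
    by fact
  have simple: "lie_simple" and centroid: "centroid = range scale"
    using assms(4) by (simp_all add: simple_central_def)
  have prime: "of_nat p \<noteq> (0::'k)" if "Factorial_Ring.prime p" "CHAR('k) \<noteq> p" for p :: nat
  proof
    assume "of_nat p = (0::'k)"
    then have "CHAR('k) dvd p"
      by (simp add: of_nat_eq_0_iff_char_dvd)
    then have "CHAR('k) = 1"
      using that by (auto simp: prime_nat_iff)
    then show False
      using of_nat_eq_0_iff_char_dvd [where 'a = 'k, of 1] by simp
  qed
  have two: "(2::'k) \<noteq> 0" and three: "(3::'k) \<noteq> 0"
    using prime [of 2] prime [of 3] assms(1,2) by simp_all
  interpret closed_triality scale bracket \<sigma> \<rho>
    by unfold_locales (use two three simple centroid in simp_all)
  obtain E where E: "orthonormal E" "complete E" "card E = 7"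
    using orthonormal_seven by blast
  \<comment> \<open>Of the eight indices one is reserved for the unit of \<open>k\<close>; the other
    seven match \<open>E\<close>.\<close>
  define z :: "4 + 4" where "z = Inl 0"
  have "card (UNIV - {z}) = card E"
    by (simp add: E card_Diff_singleton)
  then obtain g where g: "bij_betw g (UNIV - {z}) E"
    using finite_same_card_bij [of "UNIV - {z}" E] E(1) by (auto simp: orthonormal_def)
  define e where "e i = (if i = z then 0 else g i)" for i
  have gE: "g i \<in> E" if "i \<noteq> z" for i
    using bij_betwE [OF g] that by simp
  have g_eq: "g i = g j \<longleftrightarrow> i = j" if "i \<noteq> z" "j \<noteq> z" for i j
    using bij_betw_imp_inj_on [OF g] that by (auto dest: inj_onD)
  interpret framed_triality scale bracket \<sigma> \<rho> z e
  proof unfold_locales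
    show "e z = 0"
      by (simp add: e_def)
    show "\<sigma> (e i) = - e i" for i
      using E(1) gE [of i] by (simp add: e_def orthonormal_def)
    show "form (e i) (e j) = (if i = j \<and> i \<noteq> z then - 1 else 0)" for i j
      using E(1) gE [of i] gE [of j] g_eq [of i j] by (auto simp: e_def orthonormal_def)
    fix w assume "\<sigma> w = - w"
    then have "w = - (\<Sum>x\<in>E. scale (form w x) x)"
      using E(2) by (simp add: complete_def)
    also have "(\<Sum>x\<in>E. scale (form w x) x) = (\<Sum>i\<in>UNIV - {z}. scale (form w (g i)) (g i))"
      by (rule sum.reindex_bij_betw [OF g, symmetric])
    also have "\<dots> = (\<Sum>i\<in>UNIV - {z}. scale (form w (e i)) (e i))"
      by (rule sum.cong) (simp_all add: e_def)
    also have "\<dots> = (\<Sum>i\<in>UNIV. scale (form w (e i)) (e i))"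
      by (rule sum.mono_neutral_left) (simp_all add: e_def)
    finally show "w = - (\<Sum>i\<in>UNIV. scale (form w (e i)) (e i))" .
  qed
  obtain \<iota> :: 'k where "\<iota> ^ 2 = - 1"
    using nth_root_exists [of 2 "- 1::'k"] by auto
  then obtain P :: "'k^(4 + 4)^(4 + 4)" where P: "transpose P ** P = matrix_scale 2 split_form"
    by (auto intro: split_form_basis simp: power2_eq_square)
  \<comment> \<open>The inverse of \<open>P\<close>: multiply
    \<open>transpose P ** P = 2 split_form\<close> by \<open>split_form\<close>, which squares to
    the identity.\<close>
  define Q where "Q = matrix_scale (1 / 2) (split_form ** transpose P)"
  have "Q ** P = matrix_scale (1 / 2) (split_form ** (transpose P ** P))"
    by (simp add: Q_def matrix_scale_mult matrix_mul_assoc)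
  also have "\<dots> = matrix_scale (1 / 2) (matrix_scale 2 (mat 1))"
    by (simp add: P matrix_scale_mult split_form_square)
  also have "\<dots> = mat 1"
    using two by (simp add: matrix_scale_def vec_eq_iff)
  finally have QP: "Q ** P = mat 1" .
  then have PQ: "P ** Q = mat 1"
    by (simp add: matrix_left_right_inverse)
  define \<phi> where "\<phi> a = Q ** mat_of a ** P" for a
  have inverse: "Q ** (P ** X ** Q) ** P = X" "P ** (Q ** X ** P) ** Q = X" for X
  proof -
    have "Q ** (P ** X ** Q) ** P = (Q ** P) ** X ** (Q ** P)" "P ** (Q ** X ** P) ** Q = (P ** Q) ** X ** (P ** Q)"
      by (simp_all only: matrix_mul_assoc)
    then show "Q ** (P ** X ** Q) ** P = X" "P ** (Q ** X ** P) ** Q = X"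
      by (simp_all add: QP PQ)
  qed
  have "Vector_Spaces.linear scale matrix_scale \<phi>"
  proof -
    interpret target: vector_space "matrix_scale :: 'k \<Rightarrow> 'k^(4 + 4)^(4 + 4) \<Rightarrow> _"
      by (rule vector_space_matrix_scale)
    show ?thesis
      by unfold_locales (simp_all add: \<phi>_def mat_of_add mat_of_scale matrix_add_diff_mult matrix_scale_mult)
  qed
  moreover have "bij_betw \<phi> UNIV classical_D"
  proof (rule bij_betw_byWitness [where f' = "\<lambda>X. of_mat (P ** X ** Q)"])
    show "\<forall>a\<in>UNIV. of_mat (P ** \<phi> a ** Q) = a"
      by (simp add: \<phi>_def inverse of_mat_mat_of)
    show "\<forall>X\<in>classical_D. \<phi> (of_mat (P ** X ** Q)) = X"
      using skew_conjugate_classical_D(2) [OF P PQ two] by (simp add: \<phi>_def mat_of_of_mat inverse)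
    show "\<phi> ` UNIV \<subseteq> classical_D"
      using skew_conjugate_classical_D(1) [OF P PQ two mat_of_skew] by (auto simp: \<phi>_def)
  qed simp
  moreover have "\<phi> (bracket x y) = commutator (\<phi> x) (\<phi> y)" for x y
  proof -
    have "\<phi> a ** \<phi> a' = Q ** (mat_of a ** mat_of a') ** P" for a a'
    proof -
      have "\<phi> a ** \<phi> a' = Q ** mat_of a ** (P ** Q) ** mat_of a' ** P"
        by (simp only: \<phi>_def matrix_mul_assoc)
      then show ?thesis
        by (simp add: PQ matrix_mul_assoc)
    qed
    then show ?thesis
      by (simp add: commutator_def mat_of_bracket matrix_add_diff_mult) (simp add: \<phi>_def mat_of_bracket commutator_def matrix_add_diff_mult)
  qed
  ultimately have "type_D4"
    unfolding type_D4_def by blast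
  with simple finite_dimensional_framed show ?thesis
    by blast
qed

end
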